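(* Let $K$ be a commutative ring with unit, let $\mathcal{A},\mathcal{B}$ be small $K$-categories, and let $\eta_f,\varepsilon_f:f\dashv f^*:\mathcal{B}\to\mathcal{A}$ be an adjunction in the bicategory $\mathbf{Bim}$ (so $f$ is an $\mathcal{A}$-$\mathcal{B}$-bimodule). If the functor $f\otimes-:[\mathcal{A}^{\mathrm{op}},\mathrm{Mod}_K]\to[\mathcal{B}^{\mathrm{op}},\mathrm{Mod}_K]$ is precomonadic, then for all $(I,i_I),(J,i_J)\in\mathbf{I}^l_{\mathbf{Bim}(\mathcal{A},\mathcal{A})}(S_f)$, the canonical morphism $I\otimes J\to IJ$ is an isomorphism.
   Context: A $K$-category is a category enriched in $K$-modules; $[\mathcal{A},\mathrm{Mod}_K]$ is the category of $K$-linear functors. $\mathbf{Bim}$ is the bicategory whose 0-cells are small $K$-categories, with $\mathbf{Bim}(\mathcal{A},\mathcal{B})=[\mathcal{B}^{\mathrm{op}}\otimes_K\mathcal{A},\mathrm{Mod}_K]$ (the $\mathcal{A}$-$\mathcal{B}$-bimodules $\mathcal{A}\rightsquigarrow\mathcal{B}$), 2-cells the natural transformations, horizontal composition of $\phi:\mathcal{A}\rightsquigarrow\mathcal{B}$ and $\varphi:\mathcal{B}\rightsquigarrow\mathcal{C}$ given by $(\varphi\otimes\phi)(c,a)=\varphi(c,-)\otimes_{\mathcal{B}}\phi(-,a)$ (the coend/tensor product of functors over $\mathcal{B}$), and identities $1_{\mathcal{B}}(b,b')=\mathcal{B}(b,b')$. If $\mathcal{K}$ is the one-object $K$-category with endomorphism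 ring $K$, then $\mathbf{Bim}(\mathcal{K},\mathcal{A})=[\mathcal{A}^{\mathrm{op}},\mathrm{Mod}_K]$, and $f\otimes-$ is horizontal composition with $f$. For an adjunction with unit $\eta_f:1_{\mathcal{A}}\to f^*\otimes f$ and counit $\varepsilon_f:f\otimes f^*\to1_{\mathcal{B}}$, $S_f=(f^*\otimes f,\ m_f=f^*\otimes\varepsilon_f\otimes f,\ \eta_f)$ (constraints suppressed) is a monoid in $\mathbf{Bim}(\mathcal{A},\mathcal{A})$. $\mathbf{I}^l_{\mathbf{Bim}(\mathcal{A},\mathcal{A})}(S_f)$ is the set of subobjects $(I,i_I:I\to S_f)$ of $S_f$ in $\mathbf{Bim}(\mathcal{A},\mathcal{A})$ such that $m_f\cdot(S_f\otimes i_I):S_f\otimes I\to S_f$ is an isomorphism. For subobjects $I,J$ of $S_f$, $IJ$ denotes the image of the composite $m_f\cdot(i_I\otimes i_J):I\otimes J\to S_f\otimes S_f\to S_f$, and $I\otimes J\to IJ$ is the canonical map onto the image. A functor with a right adjoint is precomonadic if the comparison functor to the Eilenberg–Moore category of coalgebras over the induced comonad is full and faithful; here $f\otimes-$ has right adjoint $f^*\otimes-$. *)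

theory Defs
  imports "HOL-Library.Infinite_Typeclass" "HOL-Algebra.AbelCoset" "HOL-Algebra.Module"
begin

section \<open>Modules\<close>

definition kmod_hom ::
  "('k, 'z) ring_scheme \<Rightarrow> ('k, 'm) module \<Rightarrow> ('k, 'n) module \<Rightarrow> ('m \<Rightarrow> 'n) \<Rightarrow> bool" where
  "kmod_hom K M N h \<longleftrightarrow>
     h \<in> carrier M \<rightarrow> carrier N \<and>
     (\<forall>x\<in>carrier M. \<forall>y\<in>carrier M. h (x \<oplus>\<^bsub>M\<^esub> y) = h x \<oplus>\<^bsub>N\<^esub> h y) \<and>
     (\<forall>k\<in>carrier K. \<forall>x\<in>carrier M. h (k \<odot>\<^bsub>M\<^esub> x) = k \<odot>\<^bsub>N\<^esub> h x)"

text \<open>The library's module record extends the ring record, but the locale \<^locale>\<open>module\<close>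
  ignores the fields \<open>mult\<close> and \<open>one\<close>; they are left undefined below.\<close>

definition self_module :: "('k, 'z) ring_scheme \<Rightarrow> ('k, 'k) module" where
  "self_module K = \<lparr>carrier = carrier K, mult = undefined, one = undefined,
     zero = \<zero>\<^bsub>K\<^esub>, add = add K, smult = mult K\<rparr>"

definition free_module :: "('k, 'z) ring_scheme \<Rightarrow> 't set \<Rightarrow> ('k, 't \<Rightarrow> 'k) module" where
  "free_module K T =
     \<lparr>carrier = {u. (\<forall>t\<in>T. u t \<in> carrier K) \<and> (\<forall>t. t \<notin> T \<longrightarrow> u t = \<zero>\<^bsub>K\<^esub>) \<and>
                    finite {t. u t \<noteq> \<zero>\<^bsub>K\<^esub>}},
      mult = undefined, one = undefined,
      zero = (\<lambda>t. \<zero>\<^bsub>K\<^esub>), add = (\<lambda>u v t. u t \<oplus>\<^bsub>K\<^esub> v t), smult = (\<lambda>k u t. k \<otimes>\<^bsub>K\<^esub> u t)\<rparr>"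

definition free_gen :: "('k, 'z) ring_scheme \<Rightarrow> 't \<Rightarrow> 't \<Rightarrow> 'k" where
  "free_gen K t = (\<lambda>s. if s = t then \<one>\<^bsub>K\<^esub> else \<zero>\<^bsub>K\<^esub>)"

definition submodule_gen :: "('k, 'z) ring_scheme \<Rightarrow> ('k, 'm) module \<Rightarrow> 'm set \<Rightarrow> 'm set" where
  "submodule_gen K M R = \<Inter>{N. submodule N K M \<and> R \<subseteq> N}"

definition quot_module :: "('k, 'm) module \<Rightarrow> 'm set \<Rightarrow> ('k, 'm set) module" where
  "quot_module M N =
     \<lparr>carrier = a_rcosets\<^bsub>M\<^esub> N, mult = undefined, one = undefined,
      zero = N, add = set_add M, smult = (\<lambda>k X. \<Union>x\<in>X. N +>\<^bsub>M\<^esub> (k \<odot>\<^bsub>M\<^esub> x))\<rparr>"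

text \<open>The linear map into \<open>P\<close> induced by \<open>g\<close> on a quotient of a free module. The image is a
  singleton whenever the linear extension of \<open>g\<close> vanishes on the submodule divided out.\<close>

definition lin_lift ::
  "('k, 'z) ring_scheme \<Rightarrow> ('k, 'p) module \<Rightarrow> ('t \<Rightarrow> 'p) \<Rightarrow> ('t \<Rightarrow> 'k) set \<Rightarrow> 'p" where
  "lin_lift K P g X =
     the_elem ((\<lambda>u. \<Oplus>\<^bsub>P\<^esub>t\<in>{t. u t \<noteq> \<zero>\<^bsub>K\<^esub>}. u t \<odot>\<^bsub>P\<^esub> g t) ` X)"


section \<open>K-categories and bimodules\<close>

text \<open>\<open>Comp A a b c g f\<close> is the composite of \<open>f\<close> in \<open>Hom A a b\<close> and \<open>g\<close> in \<open>Hom A b c\<close>. The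
  modules \<open>Hom A a b\<close> need not be disjoint, so operations on arrows carry the objects.\<close>

record ('k, 'o, 'm) kcat =
  Ob :: "'o set"
  Hom :: "'o \<Rightarrow> 'o \<Rightarrow> ('k, 'm) module"
  Comp :: "'o \<Rightarrow> 'o \<Rightarrow> 'o \<Rightarrow> 'm \<Rightarrow> 'm \<Rightarrow> 'm"
  Idt :: "'o \<Rightarrow> 'm"

locale kcategory = cring K for K :: "('k, 'z) ring_scheme" (structure) +
  fixes A :: "('k, 'o, 'm) kcat"
  assumes Hom_module: "\<lbrakk>a \<in> Ob A; b \<in> Ob A\<rbrakk> \<Longrightarrow> module K (Hom A a b)"
    and Idt_closed: "a \<in> Ob A \<Longrightarrow> Idt A a \<in> carrier (Hom A a a)"
    and Comp_linear_left:
      "\<lbrakk>a \<in> Ob A; b \<in> Ob A; c \<in> Ob A; f \<in> carrier (Hom A a b)\<rbrakk>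
        \<Longrightarrow> kmod_hom K (Hom A b c) (Hom A a c) (\<lambda>g. Comp A a b c g f)"
    and Comp_linear_right:
      "\<lbrakk>a \<in> Ob A; b \<in> Ob A; c \<in> Ob A; g \<in> carrier (Hom A b c)\<rbrakk>
        \<Longrightarrow> kmod_hom K (Hom A a b) (Hom A a c) (\<lambda>f. Comp A a b c g f)"
    and Comp_assoc:
      "\<lbrakk>a \<in> Ob A; b \<in> Ob A; c \<in> Ob A; d \<in> Ob A;
        f \<in> carrier (Hom A a b); g \<in> carrier (Hom A b c); h \<in> carrier (Hom A c d)\<rbrakk>
        \<Longrightarrow> Comp A a c d h (Comp A a b c g f) = Comp A a b d (Comp A b c d h g) f"
    and Comp_Idt_left:
      "\<lbrakk>a \<in> Ob A; b \<in> Ob A; f \<in> carrier (Hom A a b)\<rbrakk> \<Longrightarrow> Comp A a b b (Idt A b) f = f"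
    and Comp_Idt_right:
      "\<lbrakk>a \<in> Ob A; b \<in> Ob A; f \<in> carrier (Hom A a b)\<rbrakk> \<Longrightarrow> Comp A a a b f (Idt A a) = f"

definition unit_kcat :: "('k, 'z) ring_scheme \<Rightarrow> ('k, unit, 'k) kcat" where
  "unit_kcat K = \<lparr>Ob = {()}, Hom = (\<lambda>_ _. self_module K),
     Comp = (\<lambda>_ _ _ g f. g \<otimes>\<^bsub>K\<^esub> f), Idt = (\<lambda>_. \<one>\<^bsub>K\<^esub>)\<rparr>"

text \<open>An \<open>A\<close>-\<open>B\<close>-bimodule is a \<open>K\<close>-functor \<open>B\<^sup>o\<^sup>p \<otimes> A \<rightarrow> Mod\<^sub>K\<close>, with source \<open>A\<close> and
  target \<open>B\<close>. The arrows \<open>(b,a) \<rightarrow> (b',a')\<close> of \<open>B\<^sup>o\<^sup>p \<otimes> A\<close> form the tensor product over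
  \<open>K\<close> of \<open>B(b',b)\<close> and \<open>A(a,a')\<close>, so the linear action of arrows is given as the bilinear
  map \<open>(\<beta>,\<alpha>) \<mapsto> Act \<phi> b b' a a' \<beta> \<alpha>\<close>, the image of the arrow \<open>\<beta> \<otimes> \<alpha>\<close>.\<close>

record ('k, 'b, 'n, 'a, 'm, 'x) bimod =
  Src :: "('k, 'a, 'm) kcat"
  Tgt :: "('k, 'b, 'n) kcat"
  Val :: "'b \<Rightarrow> 'a \<Rightarrow> ('k, 'x) module"
  Act :: "'b \<Rightarrow> 'b \<Rightarrow> 'a \<Rightarrow> 'a \<Rightarrow> 'n \<Rightarrow> 'm \<Rightarrow> 'x \<Rightarrow> 'x"

locale bimodule =
  fixes K :: "('k, 'z) ring_scheme"
    and A :: "('k, 'a, 'm) kcat" and B :: "('k, 'b, 'n) kcat"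
    and \<phi> :: "('k, 'b, 'n, 'a, 'm, 'x) bimod"
  assumes Src: "Src \<phi> = A" and Tgt: "Tgt \<phi> = B"
    and Val_module: "\<lbrakk>b \<in> Ob B; a \<in> Ob A\<rbrakk> \<Longrightarrow> module K (Val \<phi> b a)"
    and Act_linear:
      "\<lbrakk>b \<in> Ob B; b' \<in> Ob B; a \<in> Ob A; a' \<in> Ob A;
        \<beta> \<in> carrier (Hom B b' b); \<alpha> \<in> carrier (Hom A a a')\<rbrakk>
        \<Longrightarrow> kmod_hom K (Val \<phi> b a) (Val \<phi> b' a') (Act \<phi> b b' a a' \<beta> \<alpha>)"
    and Act_linear_left:
      "\<lbrakk>b \<in> Ob B; b' \<in> Ob B; a \<in> Ob A; a' \<in> Ob A;
        \<alpha> \<in> carrier (Hom A a a'); x \<in> carrier (Val \<phi> b a)\<rbrakk>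
        \<Longrightarrow> kmod_hom K (Hom B b' b) (Val \<phi> b' a') (\<lambda>\<beta>. Act \<phi> b b' a a' \<beta> \<alpha> x)"
    and Act_linear_right:
      "\<lbrakk>b \<in> Ob B; b' \<in> Ob B; a \<in> Ob A; a' \<in> Ob A;
        \<beta> \<in> carrier (Hom B b' b); x \<in> carrier (Val \<phi> b a)\<rbrakk>
        \<Longrightarrow> kmod_hom K (Hom A a a') (Val \<phi> b' a') (\<lambda>\<alpha>. Act \<phi> b b' a a' \<beta> \<alpha> x)"
    and Act_Idt:
      "\<lbrakk>b \<in> Ob B; a \<in> Ob A; x \<in> carrier (Val \<phi> b a)\<rbrakk>
        \<Longrightarrow> Act \<phi> b b a a (Idt B b) (Idt A a) x = x"
    and Act_Comp:
      "\<lbrakk>b \<in> Ob B; b' \<in> Ob B; b'' \<in> Ob B; a \<in> Ob A; a' \<in> Ob A; a'' \<in> Ob A;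
        \<beta> \<in> carrier (Hom B b' b); \<beta>' \<in> carrier (Hom B b'' b');
        \<alpha> \<in> carrier (Hom A a a'); \<alpha>' \<in> carrier (Hom A a' a''); x \<in> carrier (Val \<phi> b a)\<rbrakk>
        \<Longrightarrow> Act \<phi> b b'' a a'' (Comp B b'' b' b \<beta> \<beta>') (Comp A a a' a'' \<alpha>' \<alpha>) x
            = Act \<phi> b' b'' a' a'' \<beta>' \<alpha>' (Act \<phi> b b' a a' \<beta> \<alpha> x)"

text \<open>A 2-cell is a family of functions that matters only on the carriers of its source;
  \<open>cell_eq\<close> is therefore the equality of 2-cells.\<close>

type_synonym ('b, 'a, 'x, 'y) cell = "'b \<Rightarrow> 'a \<Rightarrow> 'x \<Rightarrow> 'y"

definition two_cell ::
  "('k, 'z) ring_scheme \<Rightarrow> ('k, 'b, 'n, 'a, 'm, 'x) bimod \<Rightarrow> ('k, 'b, 'n, 'a, 'm, 'y) bimod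
    \<Rightarrow> ('b, 'a, 'x, 'y) cell \<Rightarrow> bool" where
  "two_cell K \<phi> \<psi> \<tau> \<longleftrightarrow> Src \<phi> = Src \<psi> \<and> Tgt \<phi> = Tgt \<psi> \<and>
     (\<forall>b\<in>Ob (Tgt \<phi>). \<forall>a\<in>Ob (Src \<phi>). kmod_hom K (Val \<phi> b a) (Val \<psi> b a) (\<tau> b a)) \<and>
     (\<forall>b\<in>Ob (Tgt \<phi>). \<forall>b'\<in>Ob (Tgt \<phi>). \<forall>a\<in>Ob (Src \<phi>). \<forall>a'\<in>Ob (Src \<phi>).
        \<forall>\<beta>\<in>carrier (Hom (Tgt \<phi>) b' b). \<forall>\<alpha>\<in>carrier (Hom (Src \<phi>) a a').
        \<forall>x\<in>carrier (Val \<phi> b a).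
          \<tau> b' a' (Act \<phi> b b' a a' \<beta> \<alpha> x) = Act \<psi> b b' a a' \<beta> \<alpha> (\<tau> b a x))"

definition cell_eq ::
  "('k, 'b, 'n, 'a, 'm, 'x) bimod \<Rightarrow> ('b, 'a, 'x, 'y) cell \<Rightarrow> ('b, 'a, 'x, 'y) cell \<Rightarrow> bool"
  where
  "cell_eq \<phi> \<sigma> \<tau> \<longleftrightarrow>
     (\<forall>b\<in>Ob (Tgt \<phi>). \<forall>a\<in>Ob (Src \<phi>). \<forall>x\<in>carrier (Val \<phi> b a). \<sigma> b a x = \<tau> b a x)"

definition id_cell :: "('b, 'a, 'x, 'x) cell" where
  "id_cell = (\<lambda>b a x. x)"

definition vcomp ::
  "('b, 'a, 'y, 'w) cell \<Rightarrow> ('b, 'a, 'x, 'y) cell \<Rightarrow> ('b, 'a, 'x, 'w) cell"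
  (infixl \<open>\<cdot>\<^sub>v\<close> 65) where
  "\<sigma> \<cdot>\<^sub>v \<tau> = (\<lambda>b a x. \<sigma> b a (\<tau> b a x))"

definition iso_cell ::
  "('k, 'z) ring_scheme \<Rightarrow> ('k, 'b, 'n, 'a, 'm, 'x) bimod \<Rightarrow> ('k, 'b, 'n, 'a, 'm, 'y) bimod
    \<Rightarrow> ('b, 'a, 'x, 'y) cell \<Rightarrow> bool" where
  "iso_cell K \<phi> \<psi> \<tau> \<longleftrightarrow> two_cell K \<phi> \<psi> \<tau> \<and>
     (\<exists>\<sigma>. two_cell K \<psi> \<phi> \<sigma> \<and>
        cell_eq \<phi> (\<sigma> \<cdot>\<^sub>v \<tau>) id_cell \<and> cell_eq \<psi> (\<tau> \<cdot>\<^sub>v \<sigma>) id_cell)"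

text \<open>The test objects \<open>\<theta>\<close> have values in the same type as \<open>\<phi>\<close>; this loses nothing, since
  the kernel of \<open>\<tau>\<close> is among them.\<close>

definition mono_cell ::
  "('k, 'z) ring_scheme \<Rightarrow> ('k, 'b, 'n, 'a, 'm, 'x) bimod \<Rightarrow> ('k, 'b, 'n, 'a, 'm, 'y) bimod
    \<Rightarrow> ('b, 'a, 'x, 'y) cell \<Rightarrow> bool" where
  "mono_cell K \<phi> \<psi> \<tau> \<longleftrightarrow> two_cell K \<phi> \<psi> \<tau> \<and>
     (\<forall>(\<theta> :: ('k, 'b, 'n, 'a, 'm, 'x) bimod) \<rho> \<rho>'.
        bimodule K (Src \<phi>) (Tgt \<phi>) \<theta> \<and> two_cell K \<theta> \<phi> \<rho> \<and> two_cell K \<theta> \<phi> \<rho>' \<and>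
        cell_eq \<theta> (\<tau> \<cdot>\<^sub>v \<rho>) (\<tau> \<cdot>\<^sub>v \<rho>') \<longrightarrow> cell_eq \<theta> \<rho> \<rho>')"

definition image_bimod ::
  "('k, 'b, 'n, 'a, 'm, 'x) bimod \<Rightarrow> ('k, 'b, 'n, 'a, 'm, 'y) bimod
    \<Rightarrow> ('b, 'a, 'x, 'y) cell \<Rightarrow> ('k, 'b, 'n, 'a, 'm, 'y) bimod" where
  "image_bimod \<phi> \<psi> \<tau> =
     \<psi>\<lparr>Val := \<lambda>b a. (Val \<psi> b a)\<lparr>carrier := \<tau> b a ` carrier (Val \<phi> b a)\<rparr>\<rparr>"


section \<open>Horizontal composition\<close>

text \<open>For \<open>\<psi>\<close> from \<open>A\<close> to \<open>B\<close> and \<open>\<phi>\<close> from \<open>B\<close> to \<open>C\<close>, the module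
  \<open>\<phi>(c,-) \<otimes>\<^sub>B \<psi>(-,a)\<close> is generated by the triples \<open>(b,x,y)\<close> with \<open>x\<close> in \<open>\<phi>(c,b)\<close>
  and \<open>y\<close> in \<open>\<psi>(b,a)\<close>, subject to bilinearity and to
  \<open>\<phi>(c,\<beta>) x \<otimes> y = x \<otimes> \<psi>(\<beta>,a) y\<close> for \<open>\<beta>\<close> in \<open>B(b,b')\<close>, \<open>x\<close> in \<open>\<phi>(c,b)\<close>
  and \<open>y\<close> in \<open>\<psi>(b',a)\<close>.\<close>

definition tens_free ::
  "('k, 'z) ring_scheme \<Rightarrow> ('k, 'c, 'l, 'b, 'n, 'x) bimod \<Rightarrow> ('k, 'b, 'n, 'a, 'm, 'y) bimod
    \<Rightarrow> 'c \<Rightarrow> 'a \<Rightarrow> ('k, 'b \<times> 'x \<times> 'y \<Rightarrow> 'k) module" where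
  "tens_free K \<phi> \<psi> c a = free_module K
     {(b, x, y). b \<in> Ob (Src \<phi>) \<and> x \<in> carrier (Val \<phi> c b) \<and> y \<in> carrier (Val \<psi> b a)}"

definition tens_rels ::
  "('k, 'z) ring_scheme \<Rightarrow> ('k, 'c, 'l, 'b, 'n, 'x) bimod \<Rightarrow> ('k, 'b, 'n, 'a, 'm, 'y) bimod
    \<Rightarrow> 'c \<Rightarrow> 'a \<Rightarrow> ('b \<times> 'x \<times> 'y \<Rightarrow> 'k) set" where
  "tens_rels K \<phi> \<psi> c a =
     (let B = Src \<phi>; F = tens_free K \<phi> \<psi> c a; G = free_gen K in
       {G (b, x \<oplus>\<^bsub>Val \<phi> c b\<^esub> x', y) \<ominus>\<^bsub>F\<^esub> (G (b, x, y) \<oplus>\<^bsub>F\<^esub> G (b, x', y)) | b x x' y.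
          b \<in> Ob B \<and> x \<in> carrier (Val \<phi> c b) \<and> x' \<in> carrier (Val \<phi> c b) \<and>
          y \<in> carrier (Val \<psi> b a)} \<union>
       {G (b, x, y \<oplus>\<^bsub>Val \<psi> b a\<^esub> y') \<ominus>\<^bsub>F\<^esub> (G (b, x, y) \<oplus>\<^bsub>F\<^esub> G (b, x, y')) | b x y y'.
          b \<in> Ob B \<and> x \<in> carrier (Val \<phi> c b) \<and>
          y \<in> carrier (Val \<psi> b a) \<and> y' \<in> carrier (Val \<psi> b a)} \<union>
       {G (b, k \<odot>\<^bsub>Val \<phi> c b\<^esub> x, y) \<ominus>\<^bsub>F\<^esub> (k \<odot>\<^bsub>F\<^esub> G (b, x, y)) | k b x y.
          k \<in> carrier K \<and> b \<in> Ob B \<and> x \<in> carrier (Val \<phi> c b) \<and> y \<in> carrier (Val \<psi> b a)} \<union>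
       {G (b, x, k \<odot>\<^bsub>Val \<psi> b a\<^esub> y) \<ominus>\<^bsub>F\<^esub> (k \<odot>\<^bsub>F\<^esub> G (b, x, y)) | k b x y.
          k \<in> carrier K \<and> b \<in> Ob B \<and> x \<in> carrier (Val \<phi> c b) \<and> y \<in> carrier (Val \<psi> b a)} \<union>
       {G (b', Act \<phi> c c b b' (Idt (Tgt \<phi>) c) \<beta> x, y) \<ominus>\<^bsub>F\<^esub>
          G (b, x, Act \<psi> b' b a a \<beta> (Idt (Src \<psi>) a) y) | b b' \<beta> x y.
          b \<in> Ob B \<and> b' \<in> Ob B \<and> \<beta> \<in> carrier (Hom B b b') \<and>
          x \<in> carrier (Val \<phi> c b) \<and> y \<in> carrier (Val \<psi> b' a)})"

definition tens_val ::
  "('k, 'z) ring_scheme \<Rightarrow> ('k, 'c, 'l, 'b, 'n, 'x) bimod \<Rightarrow> ('k, 'b, 'n, 'a, 'm, 'y) bimod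
    \<Rightarrow> 'c \<Rightarrow> 'a \<Rightarrow> ('k, ('b \<times> 'x \<times> 'y \<Rightarrow> 'k) set) module" where
  "tens_val K \<phi> \<psi> c a = quot_module (tens_free K \<phi> \<psi> c a)
     (submodule_gen K (tens_free K \<phi> \<psi> c a) (tens_rels K \<phi> \<psi> c a))"

text \<open>The class \<open>x \<otimes> y\<close> of the generator \<open>(b,x,y)\<close>.\<close>

definition pure_tens ::
  "('k, 'z) ring_scheme \<Rightarrow> ('k, 'c, 'l, 'b, 'n, 'x) bimod \<Rightarrow> ('k, 'b, 'n, 'a, 'm, 'y) bimod
    \<Rightarrow> 'c \<Rightarrow> 'a \<Rightarrow> 'b \<times> 'x \<times> 'y \<Rightarrow> ('b \<times> 'x \<times> 'y \<Rightarrow> 'k) set" where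
  "pure_tens K \<phi> \<psi> c a t =
     submodule_gen K (tens_free K \<phi> \<psi> c a) (tens_rels K \<phi> \<psi> c a)
       +>\<^bsub>tens_free K \<phi> \<psi> c a\<^esub> free_gen K t"

definition tens ::
  "('k, 'z) ring_scheme \<Rightarrow> ('k, 'c, 'l, 'b, 'n, 'x) bimod \<Rightarrow> ('k, 'b, 'n, 'a, 'm, 'y) bimod
    \<Rightarrow> ('k, 'c, 'l, 'a, 'm, ('b \<times> 'x \<times> 'y \<Rightarrow> 'k) set) bimod" where
  "tens K \<phi> \<psi> = \<lparr>Src = Src \<psi>, Tgt = Tgt \<phi>, Val = tens_val K \<phi> \<psi>,
     Act = (\<lambda>c c' a a' \<gamma> \<alpha>. lin_lift K (tens_val K \<phi> \<psi> c' a')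
       (\<lambda>(b, x, y). pure_tens K \<phi> \<psi> c' a'
          (b, Act \<phi> c c' b b \<gamma> (Idt (Src \<phi>) b) x, Act \<psi> b b a a' (Idt (Tgt \<psi>) b) \<alpha> y)))\<rparr>"

text \<open>\<open>hcomp K \<phi>' \<psi>' \<sigma> \<tau>\<close> is \<open>\<sigma> \<otimes> \<tau>\<close>, where \<open>\<phi>'\<close> and \<open>\<psi>'\<close> are the targets of \<open>\<sigma>\<close>
  and \<open>\<tau>\<close>.\<close>

definition hcomp ::
  "('k, 'z) ring_scheme \<Rightarrow> ('k, 'c, 'l, 'b, 'n, 'x2) bimod \<Rightarrow> ('k, 'b, 'n, 'a, 'm, 'y2) bimod
    \<Rightarrow> ('c, 'b, 'x, 'x2) cell \<Rightarrow> ('b, 'a, 'y, 'y2) cell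
    \<Rightarrow> ('c, 'a, ('b \<times> 'x \<times> 'y \<Rightarrow> 'k) set, ('b \<times> 'x2 \<times> 'y2 \<Rightarrow> 'k) set) cell" where
  "hcomp K \<phi>' \<psi>' \<sigma> \<tau> = (\<lambda>c a. lin_lift K (tens_val K \<phi>' \<psi>' c a)
     (\<lambda>(b, x, y). pure_tens K \<phi>' \<psi>' c a (b, \<sigma> c b x, \<tau> b a y)))"

definition id_bimod :: "('k, 'b, 'n) kcat \<Rightarrow> ('k, 'b, 'n, 'b, 'n, 'n) bimod" where
  "id_bimod B = \<lparr>Src = B, Tgt = B, Val = Hom B,
     Act = (\<lambda>b1 b1' b2 b2' \<beta> \<gamma> x. Comp B b1' b2 b2' \<gamma> (Comp B b1' b1 b2 x \<beta>))\<rparr>"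

text \<open>The coherence isomorphisms \<open>1 \<otimes> \<phi> \<rightarrow> \<phi>\<close>, its inverse, \<open>\<phi> \<otimes> 1 \<rightarrow> \<phi>\<close>,
  \<open>(\<chi> \<otimes> \<phi>) \<otimes> \<psi> \<rightarrow> \<chi> \<otimes> (\<phi> \<otimes> \<psi>)\<close> and its inverse.\<close>

definition lunit ::
  "('k, 'z) ring_scheme \<Rightarrow> ('k, 'b, 'n, 'a, 'm, 'x) bimod
    \<Rightarrow> ('b, 'a, ('b \<times> 'n \<times> 'x \<Rightarrow> 'k) set, 'x) cell" where
  "lunit K \<phi> = (\<lambda>b a. lin_lift K (Val \<phi> b a)
     (\<lambda>(b', \<beta>, x). Act \<phi> b' b a a \<beta> (Idt (Src \<phi>) a) x))"

definition lunit_inv ::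
  "('k, 'z) ring_scheme \<Rightarrow> ('k, 'b, 'n, 'a, 'm, 'x) bimod
    \<Rightarrow> ('b, 'a, 'x, ('b \<times> 'n \<times> 'x \<Rightarrow> 'k) set) cell" where
  "lunit_inv K \<phi> = (\<lambda>b a x. pure_tens K (id_bimod (Tgt \<phi>)) \<phi> b a (b, Idt (Tgt \<phi>) b, x))"

definition runit ::
  "('k, 'z) ring_scheme \<Rightarrow> ('k, 'b, 'n, 'a, 'm, 'x) bimod
    \<Rightarrow> ('b, 'a, ('a \<times> 'x \<times> 'm \<Rightarrow> 'k) set, 'x) cell" where
  "runit K \<phi> = (\<lambda>b a. lin_lift K (Val \<phi> b a)
     (\<lambda>(a', x, \<alpha>). Act \<phi> b b a' a (Idt (Tgt \<phi>) b) \<alpha> x))"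

definition assoc ::
  "('k, 'z) ring_scheme \<Rightarrow> ('k, 'd, 'p, 'c, 'l, 'w) bimod
    \<Rightarrow> ('k, 'c, 'l, 'b, 'n, 'x) bimod \<Rightarrow> ('k, 'b, 'n, 'a, 'm, 'y) bimod
    \<Rightarrow> ('d, 'a, ('b \<times> ('c \<times> 'w \<times> 'x \<Rightarrow> 'k) set \<times> 'y \<Rightarrow> 'k) set,
                ('c \<times> 'w \<times> ('b \<times> 'x \<times> 'y \<Rightarrow> 'k) set \<Rightarrow> 'k) set) cell" where
  "assoc K \<chi> \<phi> \<psi> = (\<lambda>d a.
     lin_lift K (tens_val K \<chi> (tens K \<phi> \<psi>) d a) (\<lambda>(b, X, y).
       lin_lift K (tens_val K \<chi> (tens K \<phi> \<psi>) d a) (\<lambda>(c, w, x).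
         pure_tens K \<chi> (tens K \<phi> \<psi>) d a (c, w, pure_tens K \<phi> \<psi> c a (b, x, y))) X))"

definition assoc_inv ::
  "('k, 'z) ring_scheme \<Rightarrow> ('k, 'd, 'p, 'c, 'l, 'w) bimod
    \<Rightarrow> ('k, 'c, 'l, 'b, 'n, 'x) bimod \<Rightarrow> ('k, 'b, 'n, 'a, 'm, 'y) bimod
    \<Rightarrow> ('d, 'a, ('c \<times> 'w \<times> ('b \<times> 'x \<times> 'y \<Rightarrow> 'k) set \<Rightarrow> 'k) set,
                ('b \<times> ('c \<times> 'w \<times> 'x \<Rightarrow> 'k) set \<times> 'y \<Rightarrow> 'k) set) cell" where
  "assoc_inv K \<chi> \<phi> \<psi> = (\<lambda>d a.
     lin_lift K (tens_val K (tens K \<chi> \<phi>) \<psi> d a) (\<lambda>(c, w, Y).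
       lin_lift K (tens_val K (tens K \<chi> \<phi>) \<psi> d a) (\<lambda>(b, x, y).
         pure_tens K (tens K \<chi> \<phi>) \<psi> d a (b, pure_tens K \<chi> \<phi> d b (c, w, x), y)) Y))"


section \<open>Adjunctions\<close>

text \<open>The triangle identities are stated as equalities of 2-cells \<open>f \<otimes> 1 \<rightarrow> f\<close> and
  \<open>1 \<otimes> g \<rightarrow> g\<close>, \<open>g\<close> being the right adjoint of \<open>f\<close>.\<close>

locale bim_adjunction =
  fixes K :: "('k, 'z) ring_scheme"
    and A :: "('k, 'a, 'm) kcat" and B :: "('k, 'b, 'n) kcat"
    and f :: "('k, 'b, 'n, 'a, 'm, 'x) bimod" and g :: "('k, 'a, 'm, 'b, 'n, 'y) bimod"
    and \<eta> :: "('a, 'a, 'm, ('b \<times> 'y \<times> 'x \<Rightarrow> 'k) set) cell"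
    and \<epsilon> :: "('b, 'b, ('a \<times> 'x \<times> 'y \<Rightarrow> 'k) set, 'n) cell"
  assumes left_adjoint: "bimodule K A B f"
    and right_adjoint: "bimodule K B A g"
    and unit: "two_cell K (id_bimod A) (tens K g f) \<eta>"
    and counit: "two_cell K (tens K f g) (id_bimod B) \<epsilon>"
    and triangle_left:
      "cell_eq (tens K f (id_bimod A))
         (lunit K f \<cdot>\<^sub>v hcomp K (id_bimod B) f \<epsilon> id_cell \<cdot>\<^sub>v assoc_inv K f g f
            \<cdot>\<^sub>v hcomp K f (tens K g f) id_cell \<eta>)
         (runit K f)"
    and triangle_right:
      "cell_eq (tens K (id_bimod A) g)
         (runit K g \<cdot>\<^sub>v hcomp K g (id_bimod B) id_cell \<epsilon> \<cdot>\<^sub>v assoc K g f g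
            \<cdot>\<^sub>v hcomp K (tens K g f) g \<eta> id_cell)
         (lunit K g)"

text \<open>The multiplication of the monoid \<open>S\<^sub>f = g \<otimes> f\<close>.\<close>

definition adj_mult ::
  "('k, 'z) ring_scheme \<Rightarrow> ('k, 'b, 'n, 'a, 'm, 'x) bimod \<Rightarrow> ('k, 'a, 'm, 'b, 'n, 'y) bimod
    \<Rightarrow> ('b, 'b, ('a \<times> 'x \<times> 'y \<Rightarrow> 'k) set, 'n) cell
    \<Rightarrow> ('a, 'a, ('a \<times> ('b \<times> 'y \<times> 'x \<Rightarrow> 'k) set \<times> ('b \<times> 'y \<times> 'x \<Rightarrow> 'k) set \<Rightarrow> 'k) set,
                ('b \<times> 'y \<times> 'x \<Rightarrow> 'k) set) cell" where
  "adj_mult K f g \<epsilon> =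
     hcomp K g f id_cell (lunit K f)
     \<cdot>\<^sub>v hcomp K g (tens K (id_bimod (Tgt f)) f) id_cell (hcomp K (id_bimod (Tgt f)) f \<epsilon> id_cell)
     \<cdot>\<^sub>v hcomp K g (tens K (tens K f g) f) id_cell (assoc_inv K f g f)
     \<cdot>\<^sub>v assoc K g f (tens K g f)"

definition left_subobjects ::
  "('k, 'z) ring_scheme \<Rightarrow> ('k, 'b, 'n, 'a, 'm, 'x) bimod \<Rightarrow> ('k, 'a, 'm, 'b, 'n, 'y) bimod
    \<Rightarrow> ('b, 'b, ('a \<times> 'x \<times> 'y \<Rightarrow> 'k) set, 'n) cell
    \<Rightarrow> (('k, 'a, 'm, 'a, 'm, 'i) bimod \<times> ('a, 'a, 'i, ('b \<times> 'y \<times> 'x \<Rightarrow> 'k) set) cell) set"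
  where
  "left_subobjects K f g \<epsilon> = {(I, i). bimodule K (Src f) (Src f) I \<and>
     mono_cell K I (tens K g f) i \<and>
     iso_cell K (tens K (tens K g f) I) (tens K g f)
       (adj_mult K f g \<epsilon> \<cdot>\<^sub>v hcomp K (tens K g f) (tens K g f) id_cell i)}"

definition subobj_mult ::
  "('k, 'z) ring_scheme \<Rightarrow> ('k, 'b, 'n, 'a, 'm, 'x) bimod \<Rightarrow> ('k, 'a, 'm, 'b, 'n, 'y) bimod
    \<Rightarrow> ('b, 'b, ('a \<times> 'x \<times> 'y \<Rightarrow> 'k) set, 'n) cell
    \<Rightarrow> ('a, 'a, 'i, ('b \<times> 'y \<times> 'x \<Rightarrow> 'k) set) cell
    \<Rightarrow> ('a, 'a, 'j, ('b \<times> 'y \<times> 'x \<Rightarrow> 'k) set) cell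
    \<Rightarrow> ('a, 'a, ('a \<times> 'i \<times> 'j \<Rightarrow> 'k) set, ('b \<times> 'y \<times> 'x \<Rightarrow> 'k) set) cell" where
  "subobj_mult K f g \<epsilon> i j = adj_mult K f g \<epsilon> \<cdot>\<^sub>v hcomp K (tens K g f) (tens K g f) i j"

definition subobj_prod ::
  "('k, 'z) ring_scheme \<Rightarrow> ('k, 'b, 'n, 'a, 'm, 'x) bimod \<Rightarrow> ('k, 'a, 'm, 'b, 'n, 'y) bimod
    \<Rightarrow> ('b, 'b, ('a \<times> 'x \<times> 'y \<Rightarrow> 'k) set, 'n) cell
    \<Rightarrow> ('k, 'a, 'm, 'a, 'm, 'i) bimod \<times> ('a, 'a, 'i, ('b \<times> 'y \<times> 'x \<Rightarrow> 'k) set) cell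
    \<Rightarrow> ('k, 'a, 'm, 'a, 'm, 'j) bimod \<times> ('a, 'a, 'j, ('b \<times> 'y \<times> 'x \<Rightarrow> 'k) set) cell
    \<Rightarrow> ('k, 'a, 'm, 'a, 'm, ('b \<times> 'y \<times> 'x \<Rightarrow> 'k) set) bimod" where
  "subobj_prod K f g \<epsilon> = (\<lambda>(I, i) (J, j).
     image_bimod (tens K I J) (tens K g f) (subobj_mult K f g \<epsilon> i j))"


section \<open>Precomonadicity\<close>

text \<open>\<open>[A\<^sup>o\<^sup>p, Mod\<^sub>K]\<close> is the category of bimodules from \<open>unit_kcat K\<close> to \<open>A\<close>. Below are the
  unit \<open>M \<rightarrow> g \<otimes> (f \<otimes> M)\<close> and the counit \<open>f \<otimes> (g \<otimes> X) \<rightarrow> X\<close> of the adjunction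
  \<open>f \<otimes> - \<turnstile> g \<otimes> -\<close>, then the coalgebras over the comonad that it induces.\<close>

definition tens_unit ::
  "('k, 'z) ring_scheme \<Rightarrow> ('k, 'b, 'n, 'a, 'm, 'x) bimod \<Rightarrow> ('k, 'a, 'm, 'b, 'n, 'y) bimod
    \<Rightarrow> ('a, 'a, 'm, ('b \<times> 'y \<times> 'x \<Rightarrow> 'k) set) cell
    \<Rightarrow> ('k, 'a, 'm, unit, 'k, 'u) bimod
    \<Rightarrow> ('a, unit, 'u, ('b \<times> 'y \<times> ('a \<times> 'x \<times> 'u \<Rightarrow> 'k) set \<Rightarrow> 'k) set) cell" where
  "tens_unit K f g \<eta> M = assoc K g f M \<cdot>\<^sub>v hcomp K (tens K g f) M \<eta> id_cell \<cdot>\<^sub>v lunit_inv K M"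

definition tens_counit ::
  "('k, 'z) ring_scheme \<Rightarrow> ('k, 'b, 'n, 'a, 'm, 'x) bimod \<Rightarrow> ('k, 'a, 'm, 'b, 'n, 'y) bimod
    \<Rightarrow> ('b, 'b, ('a \<times> 'x \<times> 'y \<Rightarrow> 'k) set, 'n) cell
    \<Rightarrow> ('k, 'b, 'n, unit, 'k, 'v) bimod
    \<Rightarrow> ('b, unit, ('a \<times> 'x \<times> ('b \<times> 'y \<times> 'v \<Rightarrow> 'k) set \<Rightarrow> 'k) set, 'v) cell" where
  "tens_counit K f g \<epsilon> X =
     lunit K X \<cdot>\<^sub>v hcomp K (id_bimod (Tgt f)) X \<epsilon> id_cell \<cdot>\<^sub>v assoc_inv K f g X"

definition comonad_obj ::
  "('k, 'z) ring_scheme \<Rightarrow> ('k, 'b, 'n, 'a, 'm, 'x) bimod \<Rightarrow> ('k, 'a, 'm, 'b, 'n, 'y) bimod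
    \<Rightarrow> ('k, 'b, 'n, unit, 'k, 'v) bimod
    \<Rightarrow> ('k, 'b, 'n, unit, 'k, ('a \<times> 'x \<times> ('b \<times> 'y \<times> 'v \<Rightarrow> 'k) set \<Rightarrow> 'k) set) bimod" where
  "comonad_obj K f g X = tens K f (tens K g X)"

text \<open>The comonad applied to a morphism with target \<open>Y\<close>.\<close>

definition comonad_map ::
  "('k, 'z) ring_scheme \<Rightarrow> ('k, 'b, 'n, 'a, 'm, 'x) bimod \<Rightarrow> ('k, 'a, 'm, 'b, 'n, 'y) bimod
    \<Rightarrow> ('k, 'b, 'n, unit, 'k, 'w) bimod \<Rightarrow> ('b, unit, 'v, 'w) cell
    \<Rightarrow> ('b, unit, ('a \<times> 'x \<times> ('b \<times> 'y \<times> 'v \<Rightarrow> 'k) set \<Rightarrow> 'k) set,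
                  ('a \<times> 'x \<times> ('b \<times> 'y \<times> 'w \<Rightarrow> 'k) set \<Rightarrow> 'k) set) cell" where
  "comonad_map K f g Y h = hcomp K f (tens K g Y) id_cell (hcomp K g Y id_cell h)"

definition comonad_comult ::
  "('k, 'z) ring_scheme \<Rightarrow> ('k, 'b, 'n, 'a, 'm, 'x) bimod \<Rightarrow> ('k, 'a, 'm, 'b, 'n, 'y) bimod
    \<Rightarrow> ('a, 'a, 'm, ('b \<times> 'y \<times> 'x \<Rightarrow> 'k) set) cell
    \<Rightarrow> ('k, 'b, 'n, unit, 'k, 'v) bimod
    \<Rightarrow> ('b, unit, ('a \<times> 'x \<times> ('b \<times> 'y \<times> 'v \<Rightarrow> 'k) set \<Rightarrow> 'k) set,
         ('a \<times> 'x \<times> ('b \<times> 'y \<times> ('a \<times> 'x \<times> ('b \<times> 'y \<times> 'v \<Rightarrow> 'k) set \<Rightarrow> 'k) set \<Rightarrow> 'k) set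
            \<Rightarrow> 'k) set) cell" where
  "comonad_comult K f g \<eta> X =
     hcomp K f (tens K g (comonad_obj K f g X)) id_cell (tens_unit K f g \<eta> (tens K g X))"

definition coalgebra ::
  "('k, 'z) ring_scheme \<Rightarrow> ('k, 'b, 'n, 'a, 'm, 'x) bimod \<Rightarrow> ('k, 'a, 'm, 'b, 'n, 'y) bimod
    \<Rightarrow> ('a, 'a, 'm, ('b \<times> 'y \<times> 'x \<Rightarrow> 'k) set) cell
    \<Rightarrow> ('b, 'b, ('a \<times> 'x \<times> 'y \<Rightarrow> 'k) set, 'n) cell
    \<Rightarrow> ('k, 'b, 'n, unit, 'k, 'v) bimod
       \<times> ('b, unit, 'v, ('a \<times> 'x \<times> ('b \<times> 'y \<times> 'v \<Rightarrow> 'k) set \<Rightarrow> 'k) set) cell \<Rightarrow> bool" where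
  "coalgebra K f g \<eta> \<epsilon> = (\<lambda>(X, \<xi>).
     bimodule K (unit_kcat K) (Tgt f) X \<and> two_cell K X (comonad_obj K f g X) \<xi> \<and>
     cell_eq X (tens_counit K f g \<epsilon> X \<cdot>\<^sub>v \<xi>) id_cell \<and>
     cell_eq X (comonad_comult K f g \<eta> X \<cdot>\<^sub>v \<xi>)
       (comonad_map K f g (comonad_obj K f g X) \<xi> \<cdot>\<^sub>v \<xi>))"

definition coalgebra_hom ::
  "('k, 'z) ring_scheme \<Rightarrow> ('k, 'b, 'n, 'a, 'm, 'x) bimod \<Rightarrow> ('k, 'a, 'm, 'b, 'n, 'y) bimod
    \<Rightarrow> ('k, 'b, 'n, unit, 'k, 'v) bimod
       \<times> ('b, unit, 'v, ('a \<times> 'x \<times> ('b \<times> 'y \<times> 'v \<Rightarrow> 'k) set \<Rightarrow> 'k) set) cell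
    \<Rightarrow> ('k, 'b, 'n, unit, 'k, 'w) bimod
       \<times> ('b, unit, 'w, ('a \<times> 'x \<times> ('b \<times> 'y \<times> 'w \<Rightarrow> 'k) set \<Rightarrow> 'k) set) cell
    \<Rightarrow> ('b, unit, 'v, 'w) cell \<Rightarrow> bool" where
  "coalgebra_hom K f g = (\<lambda>(X, \<xi>) (Y, \<zeta>) h. two_cell K X Y h \<and>
     cell_eq X (\<zeta> \<cdot>\<^sub>v h) (comonad_map K f g Y h \<cdot>\<^sub>v \<xi>))"

definition comparison_obj ::
  "('k, 'z) ring_scheme \<Rightarrow> ('k, 'b, 'n, 'a, 'm, 'x) bimod \<Rightarrow> ('k, 'a, 'm, 'b, 'n, 'y) bimod
    \<Rightarrow> ('a, 'a, 'm, ('b \<times> 'y \<times> 'x \<Rightarrow> 'k) set) cell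
    \<Rightarrow> ('k, 'a, 'm, unit, 'k, 'u) bimod
    \<Rightarrow> ('k, 'b, 'n, unit, 'k, ('a \<times> 'x \<times> 'u \<Rightarrow> 'k) set) bimod
       \<times> ('b, unit, ('a \<times> 'x \<times> 'u \<Rightarrow> 'k) set,
           ('a \<times> 'x \<times> ('b \<times> 'y \<times> ('a \<times> 'x \<times> 'u \<Rightarrow> 'k) set \<Rightarrow> 'k) set \<Rightarrow> 'k) set) cell" where
  "comparison_obj K f g \<eta> M =
     (tens K f M, hcomp K f (tens K g (tens K f M)) id_cell (tens_unit K f g \<eta> M))"

text \<open>The comparison functor applied to a morphism with target \<open>N\<close>.\<close>

definition comparison_map ::
  "('k, 'z) ring_scheme \<Rightarrow> ('k, 'b, 'n, 'a, 'm, 'x) bimod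
    \<Rightarrow> ('k, 'a, 'm, unit, 'k, 'v) bimod \<Rightarrow> ('a, unit, 'u, 'v) cell
    \<Rightarrow> ('b, unit, ('a \<times> 'x \<times> 'u \<Rightarrow> 'k) set, ('a \<times> 'x \<times> 'v \<Rightarrow> 'k) set) cell" where
  "comparison_map K f N h = hcomp K f N id_cell h"

text \<open>An infinite type \<open>'u\<close> plays the role of the universe: \<open>Mod\<^sub>K\<close> consists of the modules
  whose carrier lies in \<open>'u\<close>, and \<open>K\<close>, the objects and arrows of small categories and the
  values of bimodules are elements of \<open>'u\<close>. Since \<open>'u\<close> is infinite, tensor products of such
  bimodules are, up to isomorphism, again of this form, although \<open>tens\<close> constructs them in a
  type of quotients. The definition says that the comparison functor is faithful and full
  between any two objects \<open>M\<close> and \<open>N\<close> of \<open>[A\<^sup>o\<^sup>p, Mod\<^sub>K]\<close>; this is the weaker as a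
  hypothesis the smaller \<open>'u\<close> is.\<close>

definition precomonadic ::
  "'u itself \<Rightarrow> ('k, 'z) ring_scheme \<Rightarrow> ('k, 'b, 'n, 'a, 'm, 'x) bimod
    \<Rightarrow> ('k, 'a, 'm, 'b, 'n, 'y) bimod
    \<Rightarrow> ('a, 'a, 'm, ('b \<times> 'y \<times> 'x \<Rightarrow> 'k) set) cell
    \<Rightarrow> ('b, 'b, ('a \<times> 'x \<times> 'y \<Rightarrow> 'k) set, 'n) cell \<Rightarrow> bool" where
  "precomonadic (TYPE('u)) K f g \<eta> \<epsilon> \<longleftrightarrow>
     (\<forall>(M :: ('k, 'a, 'm, unit, 'k, 'u) bimod) (N :: ('k, 'a, 'm, unit, 'k, 'u) bimod).
        bimodule K (unit_kcat K) (Src f) M \<longrightarrow> bimodule K (unit_kcat K) (Src f) N \<longrightarrow>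
          \<comment> \<open>faithful\<close>
          (\<forall>h h'. two_cell K M N h \<longrightarrow> two_cell K M N h' \<longrightarrow>
             cell_eq (tens K f M) (comparison_map K f N h) (comparison_map K f N h') \<longrightarrow>
             cell_eq M h h') \<and>
          \<comment> \<open>full\<close>
          (\<forall>p. coalgebra K f g \<eta> \<epsilon> (comparison_obj K f g \<eta> M) \<longrightarrow>
             coalgebra K f g \<eta> \<epsilon> (comparison_obj K f g \<eta> N) \<longrightarrow>
             coalgebra_hom K f g (comparison_obj K f g \<eta> M) (comparison_obj K f g \<eta> N) p \<longrightarrow>
             (\<exists>h. two_cell K M N h \<and> cell_eq (tens K f M) (comparison_map K f N h) p)))"

end

theory Submission
  imports Defs
begin

text \<open>Write \<open>S = g \<otimes> f\<close> for the monoid of the adjunction, \<open>m\<close> for its multiplication, and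
  \<open>\<kappa> = m \<cdot> (i \<otimes> j) : I \<otimes> J \<rightarrow> S\<close> for the product map, whose image is \<open>IJ\<close>. The canonical map
  onto the image is an isomorphism as soon as \<open>\<kappa>\<close> has trivial kernel.

  By associativity of \<open>m\<close>, the map \<open>m \<cdot> (S \<otimes> \<kappa>)\<close> is the composite
  \<open>S \<otimes> (I \<otimes> J) \<cong> (S \<otimes> I) \<otimes> J \<rightarrow> S \<otimes> J \<rightarrow> S\<close> of \<open>(m \<cdot> (S \<otimes> i)) \<otimes> J\<close> and
  \<open>m \<cdot> (S \<otimes> j)\<close>, which are isomorphisms since \<open>I\<close> and \<open>J\<close> are left subobjects. So
  \<open>S \<otimes> \<kappa>\<close> is injective. Let \<open>\<kappa> X = 0\<close>. Then \<open>S \<otimes> \<kappa>\<close> kills \<open>\<eta>(1) \<otimes> X\<close>, hence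
  \<open>\<eta>(1) \<otimes> X = 0\<close> (the core of \<open>tens_zero_of_prod_map_zero\<close>). By the triangle identity for
  \<open>f\<close>, the unit becomes a split monomorphism after tensoring with \<open>f\<close>, so \<open>v \<otimes> X = 0\<close> in
  \<open>f \<otimes> (I \<otimes> J)\<close> for every \<open>v\<close> (\<open>tens_unit_zero_imp_tens_zero\<close>). In other words, \<open>f \<otimes> -\<close>
  annihilates the map from a representable presheaf to a column of \<open>I \<otimes> J\<close> that corresponds to
  \<open>X\<close> by the Yoneda lemma. Faithfulness of the comparison functor is faithfulness of \<open>f \<otimes> -\<close>,
  whence \<open>X = 0\<close> (\<open>precomonadic_detects_zero\<close>).

  Faithfulness is assumed for presheaves whose values are sets of elements of the infinite type
  \<open>'u\<close>, whereas the elements of \<open>I \<otimes> J\<close> are cosets of finitely supported functions. As every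
  tensor is a finite sum of pure tensors, the values of \<open>I \<otimes> J\<close> embed into \<open>'u\<close>
  (\<open>tens_val_injection\<close>), and the presheaf structure is transported along the embeddings.

  The computations with tensor products rest on their universal property (\<open>tens_lift_hom\<close>,
  \<open>tens_lift_pure\<close>) and on the principle that linear maps which agree on pure tensors are equal
  (\<open>tens_hom_eqI\<close>); the coherence 2-cells and horizontal composites enter through their values
  on pure tensors.\<close>

section \<open>Modules presented by generators and relations\<close>

lemma kmod_homI:
  assumes "\<And>x. x \<in> carrier M \<Longrightarrow> h x \<in> carrier N"
    and "\<And>x y. \<lbrakk>x \<in> carrier M; y \<in> carrier M\<rbrakk> \<Longrightarrow> h (x \<oplus>\<^bsub>M\<^esub> y) = h x \<oplus>\<^bsub>N\<^esub> h y"
    and "\<And>k x. \<lbrakk>k \<in> carrier K; x \<in> carrier M\<rbrakk> \<Longrightarrow> h (k \<odot>\<^bsub>M\<^esub> x) = k \<odot>\<^bsub>N\<^esub> h x"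
  shows "kmod_hom K M N h"
  using assms unfolding kmod_hom_def by auto

lemma kmod_hom_closed: "\<lbrakk>kmod_hom K M N h; x \<in> carrier M\<rbrakk> \<Longrightarrow> h x \<in> carrier N"
  unfolding kmod_hom_def by auto

lemma kmod_hom_add:
  "\<lbrakk>kmod_hom K M N h; x \<in> carrier M; y \<in> carrier M\<rbrakk> \<Longrightarrow> h (x \<oplus>\<^bsub>M\<^esub> y) = h x \<oplus>\<^bsub>N\<^esub> h y"
  unfolding kmod_hom_def by auto

lemma kmod_hom_smult:
  "\<lbrakk>kmod_hom K M N h; k \<in> carrier K; x \<in> carrier M\<rbrakk> \<Longrightarrow> h (k \<odot>\<^bsub>M\<^esub> x) = k \<odot>\<^bsub>N\<^esub> h x"
  unfolding kmod_hom_def by auto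

lemma kmod_hom_zero:
  assumes "kmod_hom K M N h" and "module K M" and "module K N"
  shows "h \<zero>\<^bsub>M\<^esub> = \<zero>\<^bsub>N\<^esub>"
proof -
  interpret M: module K M by fact
  interpret N: module K N by fact
  have "h (\<zero>\<^bsub>K\<^esub> \<odot>\<^bsub>M\<^esub> \<zero>\<^bsub>M\<^esub>) = \<zero>\<^bsub>K\<^esub> \<odot>\<^bsub>N\<^esub> h \<zero>\<^bsub>M\<^esub>"
    using assms(1) by (intro kmod_hom_smult) auto
  then show ?thesis
    using kmod_hom_closed[OF assms(1) M.M.zero_closed] by simp
qed

lemma kmod_hom_comp:
  "\<lbrakk>kmod_hom K M N h; kmod_hom K N P h'\<rbrakk> \<Longrightarrow> kmod_hom K M P (\<lambda>x. h' (h x))"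
  by (rule kmod_homI) (simp_all add: kmod_hom_closed kmod_hom_add kmod_hom_smult)

lemma kmod_hom_minus:
  assumes "kmod_hom K M N h" and "module K M" and "module K N"
    and "x \<in> carrier M" and "y \<in> carrier M"
  shows "h (x \<ominus>\<^bsub>M\<^esub> y) = h x \<ominus>\<^bsub>N\<^esub> h y"
proof -
  interpret M: module K M by fact
  interpret N: module K N by fact
  have "h (\<ominus>\<^bsub>M\<^esub> y) \<oplus>\<^bsub>N\<^esub> h y = \<zero>\<^bsub>N\<^esub>"
    using kmod_hom_add[OF assms(1), of "\<ominus>\<^bsub>M\<^esub> y" y] kmod_hom_zero[OF assms(1-3)] assms(5)
    by (simp add: M.M.l_neg)
  then have "h (\<ominus>\<^bsub>M\<^esub> y) = \<ominus>\<^bsub>N\<^esub> h y"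
    using kmod_hom_closed[OF assms(1)] assms(5) by (metis M.M.a_inv_closed N.M.minus_equality)
  then show ?thesis
    using kmod_hom_add[OF assms(1), of x "\<ominus>\<^bsub>M\<^esub> y"] assms(4,5) by (simp add: a_minus_def)
qed

lemma kmod_hom_cong:
  assumes "kmod_hom K M N h" and "module K M" and "\<And>x. x \<in> carrier M \<Longrightarrow> h' x = h x"
  shows "kmod_hom K M N h'"
proof -
  interpret module K M by fact
  show ?thesis using assms(1,3) by (auto simp: kmod_hom_def)
qed

lemma kmod_hom_sum:
  assumes "kmod_hom K M N h" and "kmod_hom K M N h'" and "module K N"
  shows "kmod_hom K M N (\<lambda>x. h x \<oplus>\<^bsub>N\<^esub> h' x)"
proof -
  interpret module K N by fact
  show ?thesis using kmod_hom_closed[OF assms(1)] kmod_hom_closed[OF assms(2)]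
    by (intro kmod_homI)
      (simp_all add: kmod_hom_add[OF assms(1)] kmod_hom_add[OF assms(2)] kmod_hom_smult[OF assms(1)]
        kmod_hom_smult[OF assms(2)] M.a_ac smult_r_distr)
qed

lemma kmod_hom_const_zero:
  assumes "module K N"
  shows "kmod_hom K M N (\<lambda>x. \<zero>\<^bsub>N\<^esub>)"
proof -
  interpret module K N by fact
  show ?thesis by (intro kmod_homI) auto
qed

lemma free_module_zero [simp]: "\<zero>\<^bsub>free_module K T\<^esub> = (\<lambda>t. \<zero>\<^bsub>K\<^esub>)"
  and free_module_add [simp]: "u \<oplus>\<^bsub>free_module K T\<^esub> v = (\<lambda>t. u t \<oplus>\<^bsub>K\<^esub> v t)"
  and free_module_smult [simp]: "k \<odot>\<^bsub>free_module K T\<^esub> u = (\<lambda>t. k \<otimes>\<^bsub>K\<^esub> u t)"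
  by (simp_all add: free_module_def)

lemma free_module_carrier:
  "u \<in> carrier (free_module K T) \<longleftrightarrow> (\<forall>t\<in>T. u t \<in> carrier K) \<and> (\<forall>t. t \<notin> T \<longrightarrow> u t = \<zero>\<^bsub>K\<^esub>) \<and>
     finite {t. u t \<noteq> \<zero>\<^bsub>K\<^esub>}"
  by (simp add: free_module_def)

lemma free_module_val:
  assumes "cring K" and "u \<in> carrier (free_module K T)"
  shows "u t \<in> carrier K"
proof -
  interpret cring K by fact
  show ?thesis using assms(2) by (cases "t \<in> T") (auto simp: free_module_carrier)
qed

lemma free_gen_closed:
  assumes "cring K" and "t \<in> T"
  shows "free_gen K t \<in> carrier (free_module K T)"
proof -
  interpret cring K by fact
  have "finite {s. free_gen K t s \<noteq> \<zero>\<^bsub>K\<^esub>}"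
    by (rule finite_subset[of _ "{t}"]) (auto simp: free_gen_def)
  with assms(2) show ?thesis by (auto simp: free_module_carrier free_gen_def)
qed

lemma free_module_module:
  assumes "cring K"
  shows "module K (free_module K T)"
proof -
  interpret cring K by fact
  let ?F = "free_module K T"
  have val: "u t \<in> carrier K" if "u \<in> carrier ?F" for u t
    using free_module_val[OF assms that] .
  have add: "(\<lambda>t. u t \<oplus>\<^bsub>K\<^esub> v t) \<in> carrier ?F" if "u \<in> carrier ?F" "v \<in> carrier ?F" for u v
  proof -
    have "finite {t. u t \<oplus>\<^bsub>K\<^esub> v t \<noteq> \<zero>\<^bsub>K\<^esub>}"
      by (rule finite_subset[of _ "{t. u t \<noteq> \<zero>\<^bsub>K\<^esub>} \<union> {t. v t \<noteq> \<zero>\<^bsub>K\<^esub>}"])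
        (use that in \<open>auto simp: free_module_carrier\<close>)
    with that show ?thesis by (auto simp: free_module_carrier)
  qed
  have smult: "(\<lambda>t. k \<otimes>\<^bsub>K\<^esub> u t) \<in> carrier ?F" if "k \<in> carrier K" "u \<in> carrier ?F" for k u
  proof -
    have "finite {t. k \<otimes>\<^bsub>K\<^esub> u t \<noteq> \<zero>\<^bsub>K\<^esub>}"
      by (rule finite_subset[of _ "{t. u t \<noteq> \<zero>\<^bsub>K\<^esub>}"])
        (use that in \<open>auto simp: free_module_carrier\<close>)
    with that show ?thesis by (auto simp: free_module_carrier)
  qed
  show ?thesis
  proof (rule moduleI)
    show "abelian_group ?F"
    proof (rule abelian_groupI)
      fix u assume u: "u \<in> carrier ?F"
      show "\<exists>v\<in>carrier ?F. v \<oplus>\<^bsub>?F\<^esub> u = \<zero>\<^bsub>?F\<^esub>"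
        by (rule bexI[OF _ smult[of "\<ominus>\<^bsub>K\<^esub> \<one>\<^bsub>K\<^esub>" u]]) (use u val[OF u] in \<open>auto simp: l_minus l_neg\<close>)
    qed (use add val in \<open>auto simp: a_assoc a_comm a_lcomm free_module_carrier fun_eq_iff\<close>)
  qed (use assms smult val in \<open>auto simp: l_distr r_distr m_assoc fun_eq_iff\<close>)
qed

text \<open>Induction on the support, removing one generator at a time.\<close>

lemma free_module_induct [consumes 2, case_names zero step]:
  assumes "cring K" and "u \<in> carrier (free_module K T)"
    and zero: "P (\<lambda>t. \<zero>\<^bsub>K\<^esub>)"
    and step: "\<And>u t k. \<lbrakk>u \<in> carrier (free_module K T); P u; t \<in> T; k \<in> carrier K\<rbrakk>
      \<Longrightarrow> P (u \<oplus>\<^bsub>free_module K T\<^esub> k \<odot>\<^bsub>free_module K T\<^esub> free_gen K t)"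
  shows "P u"
proof -
  interpret cring K by fact
  have "u \<in> carrier (free_module K T) \<Longrightarrow> {t. u t \<noteq> \<zero>\<^bsub>K\<^esub>} \<subseteq> S \<Longrightarrow> P u" if "finite S" for S u
    using that
  proof (induction S arbitrary: u)
    case empty
    then have "u = (\<lambda>t. \<zero>\<^bsub>K\<^esub>)" by auto
    with zero show ?case by simp
  next
    case (insert t S)
    show ?case
    proof (cases "u t = \<zero>\<^bsub>K\<^esub>")
      case True
      with insert.prems have "{t. u t \<noteq> \<zero>\<^bsub>K\<^esub>} \<subseteq> S" by auto
      with insert show ?thesis by blast
    next
      case False
      let ?u = "u(t := \<zero>\<^bsub>K\<^esub>)"
      have val: "u s \<in> carrier K" for s by (rule free_module_val[OF assms(1) insert.prems(1)])
      have t: "t \<in> T" using False insert.prems(1) by (auto simp: free_module_carrier)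
      have "finite {s. ?u s \<noteq> \<zero>\<^bsub>K\<^esub>}"
        by (rule finite_subset[of _ "{t. u t \<noteq> \<zero>\<^bsub>K\<^esub>}"])
          (use insert.prems(1) in \<open>auto simp: free_module_carrier\<close>)
      with insert.prems(1) have u: "?u \<in> carrier (free_module K T)"
        by (auto simp: free_module_carrier)
      have "P ?u" by (rule insert.IH[OF u]) (use insert.prems(2) in auto)
      from step[OF u this t val] have "P (?u \<oplus>\<^bsub>free_module K T\<^esub> u t \<odot>\<^bsub>free_module K T\<^esub> free_gen K t)" .
      moreover have "?u \<oplus>\<^bsub>free_module K T\<^esub> u t \<odot>\<^bsub>free_module K T\<^esub> free_gen K t = u"
        using val by (auto simp: free_gen_def fun_eq_iff)
      ultimately show ?thesis by simp
    qed
  qed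
  with assms(2) show ?thesis by (auto simp: free_module_carrier)
qed

definition linear_extension ::
  "('k, 'z) ring_scheme \<Rightarrow> ('k, 'p) module \<Rightarrow> ('t \<Rightarrow> 'p) \<Rightarrow> ('t \<Rightarrow> 'k) \<Rightarrow> 'p" where
  "linear_extension K P g u = (\<Oplus>\<^bsub>P\<^esub>t\<in>{t. u t \<noteq> \<zero>\<^bsub>K\<^esub>}. u t \<odot>\<^bsub>P\<^esub> g t)"

text \<open>Two vectors have different supports, so additivity of the linear extension compares sums over
  a common finite set of generators.\<close>

lemma linear_extension_superset:
  assumes "module K P" and "g \<in> T \<rightarrow> carrier P" and "u \<in> carrier (free_module K T)"
    and "finite S" and "S \<subseteq> T" and "{t. u t \<noteq> \<zero>\<^bsub>K\<^esub>} \<subseteq> S"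
  shows "linear_extension K P g u = (\<Oplus>\<^bsub>P\<^esub>t\<in>S. u t \<odot>\<^bsub>P\<^esub> g t)"
proof -
  interpret module K P by fact
  have "u t \<in> carrier K" for t by (rule free_module_val[OF R.is_cring assms(3)])
  moreover have "g t \<in> carrier P" if "t \<in> S" for t using assms(2,5) that by auto
  ultimately show ?thesis unfolding linear_extension_def
    using assms by (intro M.add.finprod_mono_neutral_cong_left) auto
qed

lemma linear_extension_hom:
  assumes "module K P" and "g \<in> T \<rightarrow> carrier P"
  shows "kmod_hom K (free_module K T) P (linear_extension K P g)"
proof -
  interpret module K P by fact
  have val: "u t \<in> carrier K" if "u \<in> carrier (free_module K T)" for u t
    using free_module_val[OF R.is_cring that] .
  have F: "module K (free_module K T)" by (rule free_module_module) (rule R.is_cring)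
  interpret F: module K "free_module K T" by fact
  have sub: "finite {t. u t \<noteq> \<zero>\<^bsub>K\<^esub>}" "{t. u t \<noteq> \<zero>\<^bsub>K\<^esub>} \<subseteq> T"
    if "u \<in> carrier (free_module K T)" for u
    using that by (auto simp: free_module_carrier)
  have g: "g t \<in> carrier P" if "t \<in> T" for t using assms(2) that by auto
  show ?thesis
  proof (rule kmod_homI)
    fix u assume u: "u \<in> carrier (free_module K T)"
    show "linear_extension K P g u \<in> carrier P"
      unfolding linear_extension_def using sub[OF u] val[OF u] g
      by (intro M.finsum_closed) auto
    fix v assume v: "v \<in> carrier (free_module K T)"
    let ?S = "{t. u t \<noteq> \<zero>\<^bsub>K\<^esub>} \<union> {t. v t \<noteq> \<zero>\<^bsub>K\<^esub>}"
    have S: "finite ?S" "?S \<subseteq> T" using sub[OF u] sub[OF v] by auto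
    have "linear_extension K P g (u \<oplus>\<^bsub>free_module K T\<^esub> v)
        = (\<Oplus>\<^bsub>P\<^esub>t\<in>?S. (u t \<oplus>\<^bsub>K\<^esub> v t) \<odot>\<^bsub>P\<^esub> g t)"
      using F.M.a_closed[OF u v]
      by (subst linear_extension_superset[OF assms(1,2) _ S]) auto
    also have "\<dots> = (\<Oplus>\<^bsub>P\<^esub>t\<in>?S. u t \<odot>\<^bsub>P\<^esub> g t \<oplus>\<^bsub>P\<^esub> v t \<odot>\<^bsub>P\<^esub> g t)"
      using S val[OF u] val[OF v] g by (intro M.finsum_cong') (auto simp: smult_l_distr)
    also have "\<dots> = (\<Oplus>\<^bsub>P\<^esub>t\<in>?S. u t \<odot>\<^bsub>P\<^esub> g t) \<oplus>\<^bsub>P\<^esub> (\<Oplus>\<^bsub>P\<^esub>t\<in>?S. v t \<odot>\<^bsub>P\<^esub> g t)"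
      using S val[OF u] val[OF v] g by (intro M.finsum_addf) auto
    also have "(\<Oplus>\<^bsub>P\<^esub>t\<in>?S. u t \<odot>\<^bsub>P\<^esub> g t) = linear_extension K P g u"
      by (rule linear_extension_superset[OF assms(1,2) u S, symmetric]) auto
    also have "(\<Oplus>\<^bsub>P\<^esub>t\<in>?S. v t \<odot>\<^bsub>P\<^esub> g t) = linear_extension K P g v"
      by (rule linear_extension_superset[OF assms(1,2) v S, symmetric]) auto
    finally show "linear_extension K P g (u \<oplus>\<^bsub>free_module K T\<^esub> v)
        = linear_extension K P g u \<oplus>\<^bsub>P\<^esub> linear_extension K P g v" .
  next
    fix k u assume k: "k \<in> carrier K" and u: "u \<in> carrier (free_module K T)"
    have "linear_extension K P g (k \<odot>\<^bsub>free_module K T\<^esub> u)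
        = (\<Oplus>\<^bsub>P\<^esub>t\<in>{t. u t \<noteq> \<zero>\<^bsub>K\<^esub>}. (k \<otimes>\<^bsub>K\<^esub> u t) \<odot>\<^bsub>P\<^esub> g t)"
      using F.smult_closed[OF k u] k
      by (subst linear_extension_superset[OF assms(1,2) _ sub[OF u]]) auto
    also have "\<dots> = (\<Oplus>\<^bsub>P\<^esub>t\<in>{t. u t \<noteq> \<zero>\<^bsub>K\<^esub>}. k \<odot>\<^bsub>P\<^esub> (u t \<odot>\<^bsub>P\<^esub> g t))"
      using sub[OF u] val[OF u] g k by (intro M.finsum_cong') (auto simp: smult_assoc1)
    also have "\<dots> = k \<odot>\<^bsub>P\<^esub> linear_extension K P g u"
      unfolding linear_extension_def using sub[OF u] val[OF u] g k
      by (intro finsum_smult_ldistr[symmetric]) auto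
    finally show "linear_extension K P g (k \<odot>\<^bsub>free_module K T\<^esub> u)
        = k \<odot>\<^bsub>P\<^esub> linear_extension K P g u" .
  qed
qed

lemma linear_extension_gen:
  assumes "module K P" and "g \<in> T \<rightarrow> carrier P" and "t \<in> T"
  shows "linear_extension K P g (free_gen K t) = g t"
proof -
  interpret module K P by fact
  have g: "g t \<in> carrier P" using assms by auto
  have "linear_extension K P g (free_gen K t) = (\<Oplus>\<^bsub>P\<^esub>s\<in>{t}. free_gen K t s \<odot>\<^bsub>P\<^esub> g s)"
    using assms(3) free_gen_closed[OF R.is_cring assms(3)]
    by (intro linear_extension_superset[OF assms(1,2)]) (auto simp: free_gen_def)
  also have "\<dots> = g t" using g by (simp add: free_gen_def)
  finally show ?thesis .
qed

lemma submodule_gen_submodule: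
  assumes "module K M" and "R \<subseteq> carrier M"
  shows "submodule (submodule_gen K M R) K M" and "R \<subseteq> submodule_gen K M R"
proof -
  interpret module K M by fact
  have car: "submodule (carrier M) K M" by (rule carrier_is_submodule)
  show "R \<subseteq> submodule_gen K M R" by (auto simp: submodule_gen_def)
  show "submodule (submodule_gen K M R) K M"
  proof (rule submoduleI)
    show "submodule_gen K M R \<subseteq> carrier M" using car assms(2) by (auto simp: submodule_gen_def)
    have "\<zero>\<^bsub>M\<^esub> \<in> N" if "submodule N K M" for N
      using subgroup.one_closed[OF submodule.axioms(1)[OF that]] by simp
    then show "\<zero>\<^bsub>M\<^esub> \<in> submodule_gen K M R" by (auto simp: submodule_gen_def)
  qed (auto simp: submodule_gen_def submoduleE)
qed

lemma submodule_gen_least: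
  assumes "submodule N K M" and "R \<subseteq> N"
  shows "submodule_gen K M R \<subseteq> N"
  using assms by (auto simp: submodule_gen_def)

text \<open>The kernel is a submodule that contains the generators.\<close>

lemma kmod_hom_vanishes_on_submodule_gen:
  assumes "kmod_hom K M P h" and "module K M" and "module K P" and "R \<subseteq> carrier M"
    and "\<And>r. r \<in> R \<Longrightarrow> h r = \<zero>\<^bsub>P\<^esub>" and "x \<in> submodule_gen K M R"
  shows "h x = \<zero>\<^bsub>P\<^esub>"
proof -
  interpret M: module K M by fact
  interpret P: module K P by fact
  have "submodule {x \<in> carrier M. h x = \<zero>\<^bsub>P\<^esub>} K M"
  proof (rule M.submoduleI)
    fix a assume "a \<in> {x \<in> carrier M. h x = \<zero>\<^bsub>P\<^esub>}"
    then show "\<ominus>\<^bsub>M\<^esub> a \<in> {x \<in> carrier M. h x = \<zero>\<^bsub>P\<^esub>}"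
      using kmod_hom_minus[OF assms(1-3) M.M.zero_closed, of a] kmod_hom_zero[OF assms(1-3)]
      by (simp add: a_minus_def)
  qed (use assms in \<open>auto simp: kmod_hom_zero kmod_hom_add kmod_hom_smult\<close>)
  from submodule_gen_least[OF this, of R] assms(4-6) show ?thesis by blast
qed

context
  fixes K :: "('k, 'z) ring_scheme" and M :: "('k, 'm) module" and N
  assumes M: "module K M" and N: "submodule N K M"
begin

interpretation module K M by (rule M)
interpretation N: submodule N K M by (rule N)
interpretation N: abelian_subgroup N M
  by (rule abelian_subgroupI3)
    (auto intro: additive_subgroupI N.subgroup_axioms M.abelian_group_axioms)

lemma quot_module_carrier: "carrier (quot_module M N) = (\<lambda>x. N +>\<^bsub>M\<^esub> x) ` carrier M"
  by (auto simp: quot_module_def A_RCOSETS_def')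

lemma quot_module_zero: "\<zero>\<^bsub>quot_module M N\<^esub> = N +>\<^bsub>M\<^esub> \<zero>\<^bsub>M\<^esub>"
  using N.a_subset by (simp add: quot_module_def)

lemma quot_module_add:
  assumes "x \<in> carrier M" and "y \<in> carrier M"
  shows "(N +>\<^bsub>M\<^esub> x) \<oplus>\<^bsub>quot_module M N\<^esub> (N +>\<^bsub>M\<^esub> y) = N +>\<^bsub>M\<^esub> (x \<oplus>\<^bsub>M\<^esub> y)"
  using N.a_rcos_sum[OF assms] by (simp add: quot_module_def)

lemma quot_module_coset_cong:
  assumes "x \<in> carrier M" and "y \<in> N +>\<^bsub>M\<^esub> x"
  shows "N +>\<^bsub>M\<^esub> y = N +>\<^bsub>M\<^esub> x"
  using a_repr_independence[OF assms(2,1) N.subgroup_axioms] by simp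

lemma quot_module_smult:
  assumes k: "k \<in> carrier K" and x: "x \<in> carrier M"
  shows "k \<odot>\<^bsub>quot_module M N\<^esub> (N +>\<^bsub>M\<^esub> x) = N +>\<^bsub>M\<^esub> (k \<odot>\<^bsub>M\<^esub> x)"
proof -
  have "N +>\<^bsub>M\<^esub> (k \<odot>\<^bsub>M\<^esub> y) = N +>\<^bsub>M\<^esub> (k \<odot>\<^bsub>M\<^esub> x)" if y: "y \<in> N +>\<^bsub>M\<^esub> x" for y
  proof (rule quot_module_coset_cong)
    from y obtain n where n: "n \<in> N" "y = n \<oplus>\<^bsub>M\<^esub> x" by (auto simp: a_r_coset_def')
    then have "k \<odot>\<^bsub>M\<^esub> y = k \<odot>\<^bsub>M\<^esub> n \<oplus>\<^bsub>M\<^esub> k \<odot>\<^bsub>M\<^esub> x"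
      using k x N.a_subset by (auto simp: smult_r_distr)
    with n(1) k show "k \<odot>\<^bsub>M\<^esub> y \<in> N +>\<^bsub>M\<^esub> (k \<odot>\<^bsub>M\<^esub> x)" by (auto simp: a_r_coset_def')
  qed (use k x in auto)
  moreover have "x \<in> N +>\<^bsub>M\<^esub> x" by (rule N.a_rcos_self) (rule x)
  ultimately have "(\<Union>y\<in>N +>\<^bsub>M\<^esub> x. N +>\<^bsub>M\<^esub> (k \<odot>\<^bsub>M\<^esub> y)) = N +>\<^bsub>M\<^esub> (k \<odot>\<^bsub>M\<^esub> x)" by blast
  then show ?thesis by (simp add: quot_module_def)
qed

lemma quot_module_module: "module K (quot_module M N)"
proof (rule moduleI)
  show "cring K" by (rule R.is_cring)
  show "abelian_group (quot_module M N)"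
  proof (rule abelian_groupI)
    fix X assume "X \<in> carrier (quot_module M N)"
    then obtain x where x: "x \<in> carrier M" "X = N +>\<^bsub>M\<^esub> x" by (auto simp: quot_module_carrier)
    then have "(N +>\<^bsub>M\<^esub> \<ominus>\<^bsub>M\<^esub> x) \<oplus>\<^bsub>quot_module M N\<^esub> X = \<zero>\<^bsub>quot_module M N\<^esub>"
      by (simp add: quot_module_add quot_module_zero M.l_neg)
    with x show "\<exists>Y\<in>carrier (quot_module M N). Y \<oplus>\<^bsub>quot_module M N\<^esub> X = \<zero>\<^bsub>quot_module M N\<^esub>"
      by (auto simp: quot_module_carrier)
  qed (auto simp: quot_module_carrier quot_module_add quot_module_zero M.a_ac)
  show "(a \<otimes>\<^bsub>K\<^esub> b) \<odot>\<^bsub>quot_module M N\<^esub> X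
      = a \<odot>\<^bsub>quot_module M N\<^esub> (b \<odot>\<^bsub>quot_module M N\<^esub> X)"
    if "a \<in> carrier K" "b \<in> carrier K" "X \<in> carrier (quot_module M N)" for a b X
    using that by (auto simp: quot_module_carrier quot_module_smult smult_assoc1)
qed (auto simp: quot_module_carrier quot_module_add quot_module_smult smult_l_distr smult_r_distr)

lemma quot_module_proj_hom: "kmod_hom K M (quot_module M N) (\<lambda>x. N +>\<^bsub>M\<^esub> x)"
  by (rule kmod_homI) (auto simp: quot_module_carrier quot_module_add quot_module_smult)

lemma quot_module_proj_zero: "x \<in> N \<Longrightarrow> N +>\<^bsub>M\<^esub> x = \<zero>\<^bsub>quot_module M N\<^esub>"
  using a_coset_join2[of x N] N.a_subset N.subgroup_axioms by (auto simp: quot_module_def)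

end

text \<open>The linear extension of \<open>g\<close> is constant on every coset of the submodule of relations as
  soon as it kills the relations, and \<^const>\<open>lin_lift\<close> picks this constant.\<close>

context
  fixes K :: "('k, 'z) ring_scheme" and T :: "'t set" and R and P :: "('k, 'p) module" and g
  assumes P: "module K P" and R: "R \<subseteq> carrier (free_module K T)" and g: "g \<in> T \<rightarrow> carrier P"
    and kill: "\<And>r. r \<in> R \<Longrightarrow> linear_extension K P g r = \<zero>\<^bsub>P\<^esub>"
begin

interpretation P: module K P by (rule P)

private abbreviation "F \<equiv> free_module K T"
private abbreviation "N \<equiv> submodule_gen K F R"

private lemma FM: "module K F" by (rule free_module_module) (rule P.R.is_cring)
interpretation F: module K F by (rule FM)
private lemma NS: "submodule N K F" by (rule submodule_gen_submodule(1)[OF FM R])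

lemma lin_lift_coset:
  assumes u: "u \<in> carrier F"
  shows "lin_lift K P g (N +>\<^bsub>F\<^esub> u) = linear_extension K P g u"
proof -
  note hom = linear_extension_hom[OF P g]
  have N: "N \<subseteq> carrier F" by (rule F.submoduleE(1)[OF NS])
  have eq: "linear_extension K P g v = linear_extension K P g u" if v: "v \<in> N +>\<^bsub>F\<^esub> u" for v
  proof -
    from v obtain n where n: "n \<in> N" "v = n \<oplus>\<^bsub>F\<^esub> u" by (auto simp: a_r_coset_def')
    have "linear_extension K P g n = \<zero>\<^bsub>P\<^esub>"
      using kmod_hom_vanishes_on_submodule_gen[OF hom FM P R kill n(1)] by simp
    moreover have "linear_extension K P g v
        = linear_extension K P g n \<oplus>\<^bsub>P\<^esub> linear_extension K P g u"
      using n N u kmod_hom_add[OF hom, of n u] by auto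
    ultimately show ?thesis using kmod_hom_closed[OF hom u] by simp
  qed
  have "\<zero>\<^bsub>F\<^esub> \<in> N" using submodule.axioms(1)[OF NS] subgroup.one_closed by fastforce
  then have "u \<in> N +>\<^bsub>F\<^esub> u"
    using F.M.l_zero[OF u] unfolding a_r_coset_def' by (metis UN_I singletonI)
  with eq have "linear_extension K P g ` (N +>\<^bsub>F\<^esub> u) = {linear_extension K P g u}" by blast
  then show ?thesis unfolding lin_lift_def linear_extension_def by simp
qed

lemma lin_lift_hom: "kmod_hom K (quot_module F N) P (lin_lift K P g)"
  using linear_extension_hom[OF P g]
  by (intro kmod_homI)
    (auto simp: quot_module_carrier[OF FM NS] quot_module_add[OF FM NS] quot_module_smult[OF FM NS]
       lin_lift_coset kmod_hom_closed kmod_hom_add kmod_hom_smult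
       simp del: free_module_add free_module_smult)

lemma lin_lift_gen:
  assumes "t \<in> T"
  shows "lin_lift K P g (N +>\<^bsub>F\<^esub> free_gen K t) = g t"
  using lin_lift_coset[OF free_gen_closed[OF P.R.is_cring assms]] linear_extension_gen[OF P g assms]
  by simp

end

section \<open>The tensor product of bimodules\<close>

text \<open>The locale \<^locale>\<open>bimodule\<close> does not say that source and target are
  \<open>K\<close>-categories; their unit laws split the action into a left and a right action that
  commute.\<close>

locale kcat_bimodule =
  source: kcategory K A + target: kcategory K B + bimodule K A B \<phi>
  for K :: "('k, 'z) ring_scheme" (structure) and A :: "('k, 'a, 'm) kcat"
    and B :: "('k, 'b, 'n) kcat" and \<phi> :: "('k, 'b, 'n, 'a, 'm, 'x) bimod"
begin

lemma Act_closed: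
  "\<lbrakk>b \<in> Ob B; b' \<in> Ob B; a \<in> Ob A; a' \<in> Ob A; \<beta> \<in> carrier (Hom B b' b);
    \<alpha> \<in> carrier (Hom A a a'); x \<in> carrier (Val \<phi> b a)\<rbrakk>
    \<Longrightarrow> Act \<phi> b b' a a' \<beta> \<alpha> x \<in> carrier (Val \<phi> b' a')"
  using kmod_hom_closed[OF Act_linear] .

lemma Act_left_then_right:
  "\<lbrakk>b \<in> Ob B; b' \<in> Ob B; a \<in> Ob A; a' \<in> Ob A; \<beta> \<in> carrier (Hom B b' b);
    \<alpha> \<in> carrier (Hom A a a'); x \<in> carrier (Val \<phi> b a)\<rbrakk>
    \<Longrightarrow> Act \<phi> b' b' a a' (Idt B b') \<alpha> (Act \<phi> b b' a a \<beta> (Idt A a) x) = Act \<phi> b b' a a' \<beta> \<alpha> x"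
  using Act_Comp[of b b' b' a a a' \<beta> "Idt B b'" "Idt A a" \<alpha> x]
  by (simp add: source.Idt_closed target.Idt_closed source.Comp_Idt_right target.Comp_Idt_right)

lemma Act_right_then_left:
  "\<lbrakk>b \<in> Ob B; b' \<in> Ob B; a \<in> Ob A; a' \<in> Ob A; \<beta> \<in> carrier (Hom B b' b);
    \<alpha> \<in> carrier (Hom A a a'); x \<in> carrier (Val \<phi> b a)\<rbrakk>
    \<Longrightarrow> Act \<phi> b b' a' a' \<beta> (Idt A a') (Act \<phi> b b a a' (Idt B b) \<alpha> x) = Act \<phi> b b' a a' \<beta> \<alpha> x"
  using Act_Comp[of b b b' a a' a' "Idt B b" \<beta> \<alpha> "Idt A a'" x]
  by (simp add: source.Idt_closed target.Idt_closed source.Comp_Idt_left target.Comp_Idt_left)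

lemma Act_left_left:
  "\<lbrakk>b \<in> Ob B; b' \<in> Ob B; b'' \<in> Ob B; a \<in> Ob A; \<beta> \<in> carrier (Hom B b' b);
    \<beta>' \<in> carrier (Hom B b'' b'); x \<in> carrier (Val \<phi> b a)\<rbrakk>
    \<Longrightarrow> Act \<phi> b' b'' a a \<beta>' (Idt A a) (Act \<phi> b b' a a \<beta> (Idt A a) x)
      = Act \<phi> b b'' a a (Comp B b'' b' b \<beta> \<beta>') (Idt A a) x"
  using Act_Comp[of b b' b'' a a a \<beta> \<beta>' "Idt A a" "Idt A a" x]
  by (simp add: source.Idt_closed source.Comp_Idt_left)

lemma Act_right_right:
  "\<lbrakk>b \<in> Ob B; a \<in> Ob A; a' \<in> Ob A; a'' \<in> Ob A; \<alpha> \<in> carrier (Hom A a a');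
    \<alpha>' \<in> carrier (Hom A a' a''); x \<in> carrier (Val \<phi> b a)\<rbrakk>
    \<Longrightarrow> Act \<phi> b b a' a'' (Idt B b) \<alpha>' (Act \<phi> b b a a' (Idt B b) \<alpha> x)
      = Act \<phi> b b a a'' (Idt B b) (Comp A a a' a'' \<alpha>' \<alpha>) x"
  using Act_Comp[of b b b a a' a'' "Idt B b" "Idt B b" \<alpha> \<alpha>' x]
  by (simp add: target.Idt_closed target.Comp_Idt_left)

end

text \<open>Maps that are bilinear and compatible with the action of the middle category: these are the
  maps that factor through the tensor product.\<close>

definition balanced ::
  "('k, 'z) ring_scheme \<Rightarrow> ('k, 'c, 'l, 'b, 'n, 'x) bimod \<Rightarrow> ('k, 'b, 'n, 'a, 'm, 'y) bimod
    \<Rightarrow> 'c \<Rightarrow> 'a \<Rightarrow> ('k, 'p) module \<Rightarrow> ('b \<Rightarrow> 'x \<Rightarrow> 'y \<Rightarrow> 'p) \<Rightarrow> bool" where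
  "balanced K \<phi> \<psi> c a P h \<longleftrightarrow>
     (\<forall>b\<in>Ob (Src \<phi>). \<forall>y\<in>carrier (Val \<psi> b a). kmod_hom K (Val \<phi> c b) P (\<lambda>x. h b x y)) \<and>
     (\<forall>b\<in>Ob (Src \<phi>). \<forall>x\<in>carrier (Val \<phi> c b). kmod_hom K (Val \<psi> b a) P (h b x)) \<and>
     (\<forall>b\<in>Ob (Src \<phi>). \<forall>b'\<in>Ob (Src \<phi>). \<forall>\<beta>\<in>carrier (Hom (Src \<phi>) b b').
        \<forall>x\<in>carrier (Val \<phi> c b). \<forall>y\<in>carrier (Val \<psi> b' a).
          h b' (Act \<phi> c c b b' (Idt (Tgt \<phi>) c) \<beta> x) y
          = h b x (Act \<psi> b' b a a \<beta> (Idt (Src \<psi>) a) y))"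

locale composable = \<phi>: kcat_bimodule K B C \<phi> + \<psi>: kcat_bimodule K A B \<psi>
  for K :: "('k, 'z) ring_scheme" (structure) and A :: "('k, 'a, 'm) kcat"
    and B :: "('k, 'b, 'n) kcat" and C :: "('k, 'c, 'l) kcat"
    and \<phi> :: "('k, 'c, 'l, 'b, 'n, 'x) bimod" and \<psi> :: "('k, 'b, 'n, 'a, 'm, 'y) bimod"
begin

lemma balancedI:
  assumes "\<And>b y. \<lbrakk>b \<in> Ob B; y \<in> carrier (Val \<psi> b a)\<rbrakk> \<Longrightarrow> kmod_hom K (Val \<phi> c b) P (\<lambda>x. h b x y)"
    and "\<And>b x. \<lbrakk>b \<in> Ob B; x \<in> carrier (Val \<phi> c b)\<rbrakk> \<Longrightarrow> kmod_hom K (Val \<psi> b a) P (h b x)"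
    and "\<And>b b' \<beta> x y. \<lbrakk>b \<in> Ob B; b' \<in> Ob B; \<beta> \<in> carrier (Hom B b b'); x \<in> carrier (Val \<phi> c b);
      y \<in> carrier (Val \<psi> b' a)\<rbrakk>
      \<Longrightarrow> h b' (Act \<phi> c c b b' (Idt C c) \<beta> x) y = h b x (Act \<psi> b' b a a \<beta> (Idt A a) y)"
  shows "balanced K \<phi> \<psi> c a P h"
  using assms unfolding balanced_def by (simp add: \<phi>.Src \<phi>.Tgt \<psi>.Src)

lemma balancedD:
  assumes "balanced K \<phi> \<psi> c a P h"
  shows "\<And>b y. \<lbrakk>b \<in> Ob B; y \<in> carrier (Val \<psi> b a)\<rbrakk> \<Longrightarrow> kmod_hom K (Val \<phi> c b) P (\<lambda>x. h b x y)"
    and "\<And>b x. \<lbrakk>b \<in> Ob B; x \<in> carrier (Val \<phi> c b)\<rbrakk> \<Longrightarrow> kmod_hom K (Val \<psi> b a) P (h b x)"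
    and "\<And>b b' \<beta> x y. \<lbrakk>b \<in> Ob B; b' \<in> Ob B; \<beta> \<in> carrier (Hom B b b'); x \<in> carrier (Val \<phi> c b);
      y \<in> carrier (Val \<psi> b' a)\<rbrakk>
      \<Longrightarrow> h b' (Act \<phi> c c b b' (Idt C c) \<beta> x) y = h b x (Act \<psi> b' b a a \<beta> (Idt A a) y)"
  using assms unfolding balanced_def by (simp_all add: \<phi>.Src \<phi>.Tgt \<psi>.Src)

context
  fixes c a
  assumes c: "c \<in> Ob C" and a: "a \<in> Ob A"
begin

private definition "T = {(b, x, y). b \<in> Ob B \<and> x \<in> carrier (Val \<phi> c b) \<and> y \<in> carrier (Val \<psi> b a)}"
private abbreviation "F \<equiv> tens_free K \<phi> \<psi> c a"
private abbreviation "R \<equiv> tens_rels K \<phi> \<psi> c a"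
private abbreviation "N \<equiv> submodule_gen K F R"

private lemma F_eq: "F = free_module K T" by (simp add: tens_free_def T_def \<phi>.Src)

private lemma F_module: "module K F"
  unfolding F_eq by (rule free_module_module) (rule \<phi>.source.is_cring)

interpretation F: module K F by (rule F_module)

private lemma G_closed:
  "\<lbrakk>b \<in> Ob B; x \<in> carrier (Val \<phi> c b); y \<in> carrier (Val \<psi> b a)\<rbrakk> \<Longrightarrow> free_gen K (b, x, y) \<in> carrier F"
  unfolding F_eq by (rule free_gen_closed[OF \<phi>.source.is_cring]) (simp add: T_def)

private lemmas closed =
  \<phi>.Act_closed[OF c c _ _ \<phi>.target.Idt_closed[OF c]]
  \<psi>.Act_closed[OF _ _ a a _ \<psi>.source.Idt_closed[OF a]]
  module.smult_closed[OF \<phi>.Val_module[OF c]] module.smult_closed[OF \<psi>.Val_module[OF _ a]]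
  abelian_monoid.a_closed[OF abelian_group.axioms(1)[OF module.axioms(2)[OF \<phi>.Val_module[OF c]]]]
  abelian_monoid.a_closed[OF abelian_group.axioms(1)[OF module.axioms(2)[OF \<psi>.Val_module[OF _ a]]]]

private lemma R_cases:
  assumes "r \<in> R"
  obtains (add_left) b x x' y where "r = free_gen K (b, x \<oplus>\<^bsub>Val \<phi> c b\<^esub> x', y)
        \<ominus>\<^bsub>F\<^esub> (free_gen K (b, x, y) \<oplus>\<^bsub>F\<^esub> free_gen K (b, x', y))"
      "b \<in> Ob B" "x \<in> carrier (Val \<phi> c b)" "x' \<in> carrier (Val \<phi> c b)" "y \<in> carrier (Val \<psi> b a)"
  | (add_right) b x y y' where "r = free_gen K (b, x, y \<oplus>\<^bsub>Val \<psi> b a\<^esub> y')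
        \<ominus>\<^bsub>F\<^esub> (free_gen K (b, x, y) \<oplus>\<^bsub>F\<^esub> free_gen K (b, x, y'))"
      "b \<in> Ob B" "x \<in> carrier (Val \<phi> c b)" "y \<in> carrier (Val \<psi> b a)" "y' \<in> carrier (Val \<psi> b a)"
  | (smult_left) k b x y where
      "r = free_gen K (b, k \<odot>\<^bsub>Val \<phi> c b\<^esub> x, y) \<ominus>\<^bsub>F\<^esub> (k \<odot>\<^bsub>F\<^esub> free_gen K (b, x, y))"
      "k \<in> carrier K" "b \<in> Ob B" "x \<in> carrier (Val \<phi> c b)" "y \<in> carrier (Val \<psi> b a)"
  | (smult_right) k b x y where
      "r = free_gen K (b, x, k \<odot>\<^bsub>Val \<psi> b a\<^esub> y) \<ominus>\<^bsub>F\<^esub> (k \<odot>\<^bsub>F\<^esub> free_gen K (b, x, y))"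
      "k \<in> carrier K" "b \<in> Ob B" "x \<in> carrier (Val \<phi> c b)" "y \<in> carrier (Val \<psi> b a)"
  | (slide) b b' \<beta> x y where "r = free_gen K (b', Act \<phi> c c b b' (Idt C c) \<beta> x, y)
        \<ominus>\<^bsub>F\<^esub> free_gen K (b, x, Act \<psi> b' b a a \<beta> (Idt A a) y)"
      "b \<in> Ob B" "b' \<in> Ob B" "\<beta> \<in> carrier (Hom B b b')"
      "x \<in> carrier (Val \<phi> c b)" "y \<in> carrier (Val \<psi> b' a)"
  using assms unfolding tens_rels_def Let_def \<phi>.Src \<phi>.Tgt \<psi>.Src
  apply (elim UnE CollectE exE conjE)
  subgoal by (rule add_left)
  subgoal by (rule add_right)
  subgoal by (rule smult_left)
  subgoal by (rule smult_right)
  subgoal by (rule slide)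
  done

private lemma R_closed: "R \<subseteq> carrier F"
proof
  fix r assume "r \<in> R"
  then show "r \<in> carrier F"
    by (cases rule: R_cases) (simp_all add: G_closed closed)
qed

private lemma N_submodule: "submodule N K F" and R_N: "R \<subseteq> N"
  by (rule submodule_gen_submodule[OF F_module R_closed])+

lemma tens_val_module: "module K (tens_val K \<phi> \<psi> c a)"
  unfolding tens_val_def by (rule quot_module_module[OF F_module N_submodule])

interpretation Q: module K "tens_val K \<phi> \<psi> c a" by (rule tens_val_module)

private lemma proj: "kmod_hom K F (tens_val K \<phi> \<psi> c a) (\<lambda>u. N +>\<^bsub>F\<^esub> u)"
  unfolding tens_val_def by (rule quot_module_proj_hom[OF F_module N_submodule])

private lemma relation:
  assumes "u \<ominus>\<^bsub>F\<^esub> v \<in> R" and "u \<in> carrier F" and "v \<in> carrier F"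
  shows "N +>\<^bsub>F\<^esub> u = N +>\<^bsub>F\<^esub> v"
proof -
  have "N +>\<^bsub>F\<^esub> (u \<ominus>\<^bsub>F\<^esub> v) = \<zero>\<^bsub>tens_val K \<phi> \<psi> c a\<^esub>"
    unfolding tens_val_def using quot_module_proj_zero[OF F_module N_submodule] R_N assms(1) by blast
  then show ?thesis
    using kmod_hom_minus[OF proj F_module tens_val_module assms(2,3)]
      kmod_hom_closed[OF proj] assms(2,3) by (metis Q.M.minus_eq Q.M.minus_equality Q.M.minus_minus Q.M.a_inv_closed)
qed

text \<open>The five families of relations say exactly that \<open>(b, x, y) \<mapsto> x \<otimes> y\<close> is balanced.\<close>

lemma pure_tens_balanced:
  "balanced K \<phi> \<psi> c a (tens_val K \<phi> \<psi> c a) (\<lambda>b x y. pure_tens K \<phi> \<psi> c a (b, x, y))"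
proof (rule balancedI)
  fix b y assume "b \<in> Ob B" "y \<in> carrier (Val \<psi> b a)"
  note * = this
  show "kmod_hom K (Val \<phi> c b) (tens_val K \<phi> \<psi> c a) (\<lambda>x. pure_tens K \<phi> \<psi> c a (b, x, y))"
  proof (rule kmod_homI)
    fix x x' assume "x \<in> carrier (Val \<phi> c b)" "x' \<in> carrier (Val \<phi> c b)"
    note ** = * this
    have "free_gen K (b, x \<oplus>\<^bsub>Val \<phi> c b\<^esub> x', y)
        \<ominus>\<^bsub>F\<^esub> (free_gen K (b, x, y) \<oplus>\<^bsub>F\<^esub> free_gen K (b, x', y)) \<in> R"
      unfolding tens_rels_def Let_def \<phi>.Src \<phi>.Tgt \<psi>.Src using ** by fast
    from relation[OF this] ** kmod_hom_add[OF proj]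
    show "pure_tens K \<phi> \<psi> c a (b, x \<oplus>\<^bsub>Val \<phi> c b\<^esub> x', y)
        = pure_tens K \<phi> \<psi> c a (b, x, y) \<oplus>\<^bsub>tens_val K \<phi> \<psi> c a\<^esub> pure_tens K \<phi> \<psi> c a (b, x', y)"
      unfolding pure_tens_def by (simp add: G_closed closed)
  next
    fix k x assume "k \<in> carrier K" "x \<in> carrier (Val \<phi> c b)"
    note ** = * this
    have "free_gen K (b, k \<odot>\<^bsub>Val \<phi> c b\<^esub> x, y) \<ominus>\<^bsub>F\<^esub> (k \<odot>\<^bsub>F\<^esub> free_gen K (b, x, y)) \<in> R"
      unfolding tens_rels_def Let_def \<phi>.Src \<phi>.Tgt \<psi>.Src using ** by fast
    from relation[OF this] ** kmod_hom_smult[OF proj]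
    show "pure_tens K \<phi> \<psi> c a (b, k \<odot>\<^bsub>Val \<phi> c b\<^esub> x, y)
        = k \<odot>\<^bsub>tens_val K \<phi> \<psi> c a\<^esub> pure_tens K \<phi> \<psi> c a (b, x, y)"
      unfolding pure_tens_def by (simp add: G_closed closed)
  qed (use * in \<open>simp add: pure_tens_def kmod_hom_closed[OF proj] G_closed\<close>)
next
  fix b x assume "b \<in> Ob B" "x \<in> carrier (Val \<phi> c b)"
  note * = this
  show "kmod_hom K (Val \<psi> b a) (tens_val K \<phi> \<psi> c a) (\<lambda>y. pure_tens K \<phi> \<psi> c a (b, x, y))"
  proof (rule kmod_homI)
    fix y y' assume "y \<in> carrier (Val \<psi> b a)" "y' \<in> carrier (Val \<psi> b a)"
    note ** = * this
    have "free_gen K (b, x, y \<oplus>\<^bsub>Val \<psi> b a\<^esub> y')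
        \<ominus>\<^bsub>F\<^esub> (free_gen K (b, x, y) \<oplus>\<^bsub>F\<^esub> free_gen K (b, x, y')) \<in> R"
      unfolding tens_rels_def Let_def \<phi>.Src \<phi>.Tgt \<psi>.Src using ** by fast
    from relation[OF this] ** kmod_hom_add[OF proj]
    show "pure_tens K \<phi> \<psi> c a (b, x, y \<oplus>\<^bsub>Val \<psi> b a\<^esub> y')
        = pure_tens K \<phi> \<psi> c a (b, x, y) \<oplus>\<^bsub>tens_val K \<phi> \<psi> c a\<^esub> pure_tens K \<phi> \<psi> c a (b, x, y')"
      unfolding pure_tens_def by (simp add: G_closed closed)
  next
    fix k y assume "k \<in> carrier K" "y \<in> carrier (Val \<psi> b a)"
    note ** = * this
    have "free_gen K (b, x, k \<odot>\<^bsub>Val \<psi> b a\<^esub> y) \<ominus>\<^bsub>F\<^esub> (k \<odot>\<^bsub>F\<^esub> free_gen K (b, x, y)) \<in> R"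
      unfolding tens_rels_def Let_def \<phi>.Src \<phi>.Tgt \<psi>.Src using ** by fast
    from relation[OF this] ** kmod_hom_smult[OF proj]
    show "pure_tens K \<phi> \<psi> c a (b, x, k \<odot>\<^bsub>Val \<psi> b a\<^esub> y)
        = k \<odot>\<^bsub>tens_val K \<phi> \<psi> c a\<^esub> pure_tens K \<phi> \<psi> c a (b, x, y)"
      unfolding pure_tens_def by (simp add: G_closed closed)
  qed (use * in \<open>simp add: pure_tens_def kmod_hom_closed[OF proj] G_closed\<close>)
next
  fix b b' \<beta> x y
  assume *: "b \<in> Ob B" "b' \<in> Ob B" "\<beta> \<in> carrier (Hom B b b')" "x \<in> carrier (Val \<phi> c b)"
    "y \<in> carrier (Val \<psi> b' a)"
  have "free_gen K (b', Act \<phi> c c b b' (Idt C c) \<beta> x, y)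
        \<ominus>\<^bsub>F\<^esub> free_gen K (b, x, Act \<psi> b' b a a \<beta> (Idt A a) y) \<in> R"
    unfolding tens_rels_def Let_def \<phi>.Src \<phi>.Tgt \<psi>.Src using * by fast
  from relation[OF this] *
  show "pure_tens K \<phi> \<psi> c a (b', Act \<phi> c c b b' (Idt C c) \<beta> x, y)
      = pure_tens K \<phi> \<psi> c a (b, x, Act \<psi> b' b a a \<beta> (Idt A a) y)"
    unfolding pure_tens_def by (simp add: G_closed closed)
qed

lemmas pure_tens_left = balancedD(1)[OF pure_tens_balanced]
  and pure_tens_right = balancedD(2)[OF pure_tens_balanced]
  and pure_tens_slide = balancedD(3)[OF pure_tens_balanced]

lemma pure_tens_closed:
  "\<lbrakk>b \<in> Ob B; x \<in> carrier (Val \<phi> c b); y \<in> carrier (Val \<psi> b a)\<rbrakk>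
    \<Longrightarrow> pure_tens K \<phi> \<psi> c a (b, x, y) \<in> carrier (tens_val K \<phi> \<psi> c a)"
  using kmod_hom_closed[OF pure_tens_right] .

text \<open>Scalars can be absorbed into the left factor, so every element is a finite sum of pure
  tensors.\<close>

lemma tens_induct [consumes 1, case_names zero add]:
  assumes "X \<in> carrier (tens_val K \<phi> \<psi> c a)"
    and zeroI: "P \<zero>\<^bsub>tens_val K \<phi> \<psi> c a\<^esub>"
    and addI: "\<And>X b x y. \<lbrakk>X \<in> carrier (tens_val K \<phi> \<psi> c a); P X; b \<in> Ob B; x \<in> carrier (Val \<phi> c b);
      y \<in> carrier (Val \<psi> b a)\<rbrakk> \<Longrightarrow> P (X \<oplus>\<^bsub>tens_val K \<phi> \<psi> c a\<^esub> pure_tens K \<phi> \<psi> c a (b, x, y))"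
  shows "P X"
proof -
  let ?Q = "tens_val K \<phi> \<psi> c a"
  have "P (N +>\<^bsub>F\<^esub> u)" if "u \<in> carrier F" for u
    using \<phi>.source.is_cring that[unfolded F_eq]
  proof (induction rule: free_module_induct)
    case zero
    have "N +>\<^bsub>F\<^esub> \<zero>\<^bsub>F\<^esub> = \<zero>\<^bsub>?Q\<^esub>" by (rule kmod_hom_zero[OF proj F_module tens_val_module])
    then show ?case using zeroI by (simp add: F_eq)
  next
    case (step u t k)
    then obtain b x y where t: "t = (b, x, y)" "b \<in> Ob B" "x \<in> carrier (Val \<phi> c b)"
      "y \<in> carrier (Val \<psi> b a)" by (auto simp: T_def)
    from step.hyps(1) have u: "u \<in> carrier F" by (simp add: F_eq)
    have "N +>\<^bsub>F\<^esub> (u \<oplus>\<^bsub>F\<^esub> k \<odot>\<^bsub>F\<^esub> free_gen K t)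
        = (N +>\<^bsub>F\<^esub> u) \<oplus>\<^bsub>?Q\<^esub> (N +>\<^bsub>F\<^esub> (k \<odot>\<^bsub>F\<^esub> free_gen K t))"
      using t step.hyps(3) by (intro kmod_hom_add[OF proj] u) (simp add: G_closed)
    also have "N +>\<^bsub>F\<^esub> (k \<odot>\<^bsub>F\<^esub> free_gen K t) = k \<odot>\<^bsub>?Q\<^esub> pure_tens K \<phi> \<psi> c a (b, x, y)"
      unfolding t pure_tens_def using t step.hyps(3) by (intro kmod_hom_smult[OF proj]) (simp_all add: G_closed)
    also have "\<dots> = pure_tens K \<phi> \<psi> c a (b, k \<odot>\<^bsub>Val \<phi> c b\<^esub> x, y)"
      using t step.hyps(3) by (intro kmod_hom_smult[OF pure_tens_left, symmetric])
    finally show ?case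
      using addI[OF kmod_hom_closed[OF proj u] step.IH t(2) _ t(4), of "k \<odot>\<^bsub>Val \<phi> c b\<^esub> x"] t step.hyps(3)
      by (simp add: closed F_eq)
  qed
  then show ?thesis using assms(1) unfolding tens_val_def
    by (auto simp: quot_module_carrier[OF F_module N_submodule])
qed

text \<open>The usual way to prove an equation between linear maps below: compare them on pure tensors.\<close>

lemma tens_hom_eqI:
  assumes "kmod_hom K (tens_val K \<phi> \<psi> c a) P h" and "kmod_hom K (tens_val K \<phi> \<psi> c a) P h'"
    and "module K P" and "X \<in> carrier (tens_val K \<phi> \<psi> c a)"
    and "\<And>b x y. \<lbrakk>b \<in> Ob B; x \<in> carrier (Val \<phi> c b); y \<in> carrier (Val \<psi> b a)\<rbrakk>
      \<Longrightarrow> h (pure_tens K \<phi> \<psi> c a (b, x, y)) = h' (pure_tens K \<phi> \<psi> c a (b, x, y))"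
  shows "h X = h' X"
  using assms(4)
proof (induction X rule: tens_induct)
  case zero
  show ?case
    using kmod_hom_zero[OF assms(1) tens_val_module assms(3)]
      kmod_hom_zero[OF assms(2) tens_val_module assms(3)] by simp
next
  case (add X b x y)
  then show ?case
    by (simp add: kmod_hom_add[OF assms(1)] kmod_hom_add[OF assms(2)] pure_tens_closed assms(5))
qed

text \<open>The universal property. The linear extension of a balanced map kills each of the five families
  of relations, by the clause of balancedness that corresponds to it.\<close>

lemma
  assumes P: "module K P" and h: "balanced K \<phi> \<psi> c a P h"
  shows tens_lift_hom: "kmod_hom K (tens_val K \<phi> \<psi> c a) P (lin_lift K P (\<lambda>(b, x, y). h b x y))"
    and tens_lift_pure: "\<And>b x y. \<lbrakk>b \<in> Ob B; x \<in> carrier (Val \<phi> c b); y \<in> carrier (Val \<psi> b a)\<rbrakk>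
      \<Longrightarrow> lin_lift K P (\<lambda>(b, x, y). h b x y) (pure_tens K \<phi> \<psi> c a (b, x, y)) = h b x y"
proof -
  interpret P: module K P by (rule P)
  let ?g = "\<lambda>(b, x, y). h b x y"
  have diff: "x \<ominus>\<^bsub>P\<^esub> x = \<zero>\<^bsub>P\<^esub>" if "x \<in> carrier P" for x
    using that by (simp add: P.M.minus_eq P.M.r_neg)
  have hc: "h b x y \<in> carrier P"
    if "b \<in> Ob B" "x \<in> carrier (Val \<phi> c b)" "y \<in> carrier (Val \<psi> b a)" for b x y
    using kmod_hom_closed[OF balancedD(1)[OF h]] that by blast
  have g: "?g \<in> T \<rightarrow> carrier P" by (auto simp: T_def hc)
  have ext: "kmod_hom K F P (linear_extension K P ?g)"
    unfolding F_eq by (rule linear_extension_hom[OF P g])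
  have gen: "linear_extension K P ?g (free_gen K (b, x, y)) = h b x y"
    if "b \<in> Ob B" "x \<in> carrier (Val \<phi> c b)" "y \<in> carrier (Val \<psi> b a)" for b x y
    using linear_extension_gen[OF P g, of "(b, x, y)"] that by (simp add: T_def)
  note simps = kmod_hom_minus[OF ext F_module P] kmod_hom_add[OF ext] kmod_hom_smult[OF ext]
    gen G_closed closed hc diff
  have kill: "linear_extension K P ?g r = \<zero>\<^bsub>P\<^esub>" if "r \<in> R" for r
    using that
  proof (cases rule: R_cases)
    case (add_left b x x' y)
    with kmod_hom_add[OF balancedD(1)[OF h]] show ?thesis by (simp add: simps)
  next
    case (add_right b x y y')
    with kmod_hom_add[OF balancedD(2)[OF h]] show ?thesis by (simp add: simps)
  next
    case (smult_left k b x y)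
    with kmod_hom_smult[OF balancedD(1)[OF h]] show ?thesis by (simp add: simps)
  next
    case (smult_right k b x y)
    with kmod_hom_smult[OF balancedD(2)[OF h]] show ?thesis by (simp add: simps)
  next
    case (slide b b' \<beta> x y)
    with balancedD(3)[OF h] show ?thesis by (simp add: simps)
  qed
  note lift = P R_closed[unfolded F_eq] g kill
  show "kmod_hom K (tens_val K \<phi> \<psi> c a) P (lin_lift K P ?g)"
    unfolding tens_val_def using lin_lift_hom[OF lift] by (simp add: F_eq)
  show "lin_lift K P ?g (pure_tens K \<phi> \<psi> c a (b, x, y)) = h b x y"
    if "b \<in> Ob B" "x \<in> carrier (Val \<phi> c b)" "y \<in> carrier (Val \<psi> b a)" for b x y
    unfolding pure_tens_def using lin_lift_gen[OF lift, of "(b, x, y)"] that by (simp add: F_eq T_def)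
qed

end

(* Outside the context above the rule has the two object memberships as further major premises. *)
lemmas tens_sum_induct [consumes 3, case_names zero add] = tens_induct

end

section \<open>Bimodules and 2-cells\<close>

lemma tens_simps [simp]:
  "Src (tens K \<phi> \<psi>) = Src \<psi>" "Tgt (tens K \<phi> \<psi>) = Tgt \<phi>" "Val (tens K \<phi> \<psi>) = tens_val K \<phi> \<psi>"
  by (simp_all add: tens_def)

lemma two_cellI:
  assumes "bimodule K A B \<phi>" and "bimodule K A B \<psi>"
    and "\<And>b a. \<lbrakk>b \<in> Ob B; a \<in> Ob A\<rbrakk> \<Longrightarrow> kmod_hom K (Val \<phi> b a) (Val \<psi> b a) (\<tau> b a)"
    and "\<And>b b' a a' \<beta> \<alpha> x. \<lbrakk>b \<in> Ob B; b' \<in> Ob B; a \<in> Ob A; a' \<in> Ob A; \<beta> \<in> carrier (Hom B b' b);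
      \<alpha> \<in> carrier (Hom A a a'); x \<in> carrier (Val \<phi> b a)\<rbrakk>
      \<Longrightarrow> \<tau> b' a' (Act \<phi> b b' a a' \<beta> \<alpha> x) = Act \<psi> b b' a a' \<beta> \<alpha> (\<tau> b a x)"
  shows "two_cell K \<phi> \<psi> \<tau>"
  using assms(3,4) unfolding two_cell_def
  by (simp add: bimodule.Src[OF assms(1)] bimodule.Src[OF assms(2)] bimodule.Tgt[OF assms(1)]
      bimodule.Tgt[OF assms(2)])

lemma two_cellD:
  assumes "bimodule K A B \<phi>" and "two_cell K \<phi> \<psi> \<tau>"
  shows "\<And>b a. \<lbrakk>b \<in> Ob B; a \<in> Ob A\<rbrakk> \<Longrightarrow> kmod_hom K (Val \<phi> b a) (Val \<psi> b a) (\<tau> b a)"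
    and "\<And>b b' a a' \<beta> \<alpha> x. \<lbrakk>b \<in> Ob B; b' \<in> Ob B; a \<in> Ob A; a' \<in> Ob A; \<beta> \<in> carrier (Hom B b' b);
      \<alpha> \<in> carrier (Hom A a a'); x \<in> carrier (Val \<phi> b a)\<rbrakk>
      \<Longrightarrow> \<tau> b' a' (Act \<phi> b b' a a' \<beta> \<alpha> x) = Act \<psi> b b' a a' \<beta> \<alpha> (\<tau> b a x)"
  using assms(2) unfolding two_cell_def
  by (simp_all add: bimodule.Src[OF assms(1)] bimodule.Tgt[OF assms(1)])

lemma two_cell_closed:
  "\<lbrakk>bimodule K A B \<phi>; two_cell K \<phi> \<psi> \<tau>; b \<in> Ob B; a \<in> Ob A; x \<in> carrier (Val \<phi> b a)\<rbrakk>
    \<Longrightarrow> \<tau> b a x \<in> carrier (Val \<psi> b a)"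
  using kmod_hom_closed[OF two_cellD(1)] .

lemma cell_eqD:
  assumes "bimodule K A B \<phi>" and "cell_eq \<phi> \<sigma> \<tau>"
    and "b \<in> Ob B" and "a \<in> Ob A" and "x \<in> carrier (Val \<phi> b a)"
  shows "\<sigma> b a x = \<tau> b a x"
  using assms unfolding cell_eq_def by (simp add: bimodule.Src bimodule.Tgt)

lemma id_cell_apply: "id_cell b a x = x"
  by (simp add: id_cell_def)

lemma two_cell_id: "bimodule K A B \<phi> \<Longrightarrow> two_cell K \<phi> \<phi> id_cell"
  by (rule two_cellI) (auto simp: id_cell_def intro: kmod_homI)

lemma two_cell_vcomp:
  assumes "bimodule K A B \<phi>" and "bimodule K A B \<psi>" and "bimodule K A B \<chi>"
    and "two_cell K \<psi> \<chi> \<sigma>" and "two_cell K \<phi> \<psi> \<tau>"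
  shows "two_cell K \<phi> \<chi> (\<sigma> \<cdot>\<^sub>v \<tau>)"
  unfolding vcomp_def
  by (rule two_cellI[OF assms(1,3)])
    (simp_all add: kmod_hom_comp[OF two_cellD(1)[OF assms(1,5)] two_cellD(1)[OF assms(2,4)]]
      two_cellD(2)[OF assms(1,5)] two_cellD(2)[OF assms(2,4)] two_cell_closed[OF assms(1,5)])

text \<open>An additive map with trivial kernel is injective, and the inverse of an injective 2-cell is
  again linear and natural.\<close>

lemma iso_cell_onto_image:
  assumes \<phi>: "bimodule K A B \<phi>" and \<psi>: "bimodule K A B \<psi>" and \<tau>: "two_cell K \<phi> \<psi> \<tau>"
    and kernel: "\<And>b a x. \<lbrakk>b \<in> Ob B; a \<in> Ob A; x \<in> carrier (Val \<phi> b a); \<tau> b a x = \<zero>\<^bsub>Val \<psi> b a\<^esub>\<rbrakk>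
      \<Longrightarrow> x = \<zero>\<^bsub>Val \<phi> b a\<^esub>"
  shows "iso_cell K \<phi> (image_bimod \<phi> \<psi> \<tau>) \<tau>"
proof -
  interpret \<phi>: bimodule K A B \<phi> by (rule \<phi>)
  interpret \<psi>: bimodule K A B \<psi> by (rule \<psi>)
  note hom = two_cellD(1)[OF \<phi> \<tau>] and natural = two_cellD(2)[OF \<phi> \<tau>]
  let ?I = "image_bimod \<phi> \<psi> \<tau>"
  let ?\<sigma> = "\<lambda>b a. inv_into (carrier (Val \<phi> b a)) (\<tau> b a)"
  have inj: "inj_on (\<tau> b a) (carrier (Val \<phi> b a))" if "b \<in> Ob B" "a \<in> Ob A" for b a
  proof (rule inj_onI)
    interpret V: module K "Val \<phi> b a" by (rule \<phi>.Val_module[OF that])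
    interpret W: module K "Val \<psi> b a" by (rule \<psi>.Val_module[OF that])
    fix x y assume xy: "x \<in> carrier (Val \<phi> b a)" "y \<in> carrier (Val \<phi> b a)" "\<tau> b a x = \<tau> b a y"
    then have "\<tau> b a (x \<ominus>\<^bsub>Val \<phi> b a\<^esub> y) = \<zero>\<^bsub>Val \<psi> b a\<^esub>"
      using kmod_hom_minus[OF hom[OF that] V.module_axioms W.module_axioms xy(1,2)]
        kmod_hom_closed[OF hom[OF that] xy(2)] by (simp add: W.M.minus_eq W.M.r_neg)
    then have "x \<ominus>\<^bsub>Val \<phi> b a\<^esub> y = \<zero>\<^bsub>Val \<phi> b a\<^esub>" using kernel[OF that] xy by simp
    then show "x = y" using xy
      by (metis V.M.minus_eq V.M.minus_equality V.M.minus_minus V.M.a_inv_closed)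
  qed
  have inv: "?\<sigma> b a (\<tau> b a x) = x" if "b \<in> Ob B" "a \<in> Ob A" "x \<in> carrier (Val \<phi> b a)" for b a x
    using inv_into_f_f[OF inj] that by blast
  have car: "carrier (Val ?I b a) = \<tau> b a ` carrier (Val \<phi> b a)"
    and add: "x \<oplus>\<^bsub>Val ?I b a\<^esub> y = x \<oplus>\<^bsub>Val \<psi> b a\<^esub> y"
    and smult: "k \<odot>\<^bsub>Val ?I b a\<^esub> x = k \<odot>\<^bsub>Val \<psi> b a\<^esub> x" for b a x y k
    by (simp_all add: image_bimod_def)
  have rest: "Src ?I = A" "Tgt ?I = B" "Act ?I = Act \<psi>"
    by (simp_all add: image_bimod_def \<psi>.Src \<psi>.Tgt)
  have closed: "x \<oplus>\<^bsub>Val \<phi> b a\<^esub> y \<in> carrier (Val \<phi> b a)" "k \<in> carrier K \<Longrightarrow> k \<odot>\<^bsub>Val \<phi> b a\<^esub> x \<in> carrier (Val \<phi> b a)"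
    if "b \<in> Ob B" "a \<in> Ob A" "x \<in> carrier (Val \<phi> b a)" "y \<in> carrier (Val \<phi> b a)" for b a x y k
  proof -
    interpret V: module K "Val \<phi> b a" by (rule \<phi>.Val_module[OF that(1,2)])
    show "x \<oplus>\<^bsub>Val \<phi> b a\<^esub> y \<in> carrier (Val \<phi> b a)"
      "k \<in> carrier K \<Longrightarrow> k \<odot>\<^bsub>Val \<phi> b a\<^esub> x \<in> carrier (Val \<phi> b a)" using that by simp_all
  qed
  have "two_cell K \<phi> ?I \<tau>"
    unfolding two_cell_def rest \<phi>.Src \<phi>.Tgt
    using hom natural by (auto intro!: kmod_homI simp: car add smult kmod_hom_add[OF hom] kmod_hom_smult[OF hom])
  moreover have "two_cell K ?I \<phi> ?\<sigma>"
    unfolding two_cell_def rest \<phi>.Src \<phi>.Tgt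
  proof (intro conjI ballI refl)
    fix b a assume ba: "b \<in> Ob B" "a \<in> Ob A"
    show "kmod_hom K (Val ?I b a) (Val \<phi> b a) (?\<sigma> b a)"
      by (rule kmod_homI)
        (auto simp: car add smult inv ba closed kmod_hom_add[OF hom[OF ba], symmetric]
          kmod_hom_smult[OF hom[OF ba], symmetric])
  next
    fix b b' a a' \<beta> \<alpha> x
    assume *: "b \<in> Ob B" "b' \<in> Ob B" "a \<in> Ob A" "a' \<in> Ob A" "\<beta> \<in> carrier (Hom B b' b)"
      "\<alpha> \<in> carrier (Hom A a a')" and "x \<in> carrier (Val ?I b a)"
    then obtain y where y: "y \<in> carrier (Val \<phi> b a)" "x = \<tau> b a y" by (auto simp: car)
    with * show "?\<sigma> b' a' (Act \<psi> b b' a a' \<beta> \<alpha> x) = Act \<phi> b b' a a' \<beta> \<alpha> (?\<sigma> b a x)"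
      using kmod_hom_closed[OF \<phi>.Act_linear[OF *] y(1)] by (simp add: natural[symmetric] inv)
  qed
  moreover have "cell_eq \<phi> (?\<sigma> \<cdot>\<^sub>v \<tau>) id_cell" "cell_eq ?I (\<tau> \<cdot>\<^sub>v ?\<sigma>) id_cell"
    by (auto simp: cell_eq_def rest \<phi>.Src \<phi>.Tgt car vcomp_def id_cell_def inv)
  ultimately show ?thesis unfolding iso_cell_def by blast
qed

context composable
begin

text \<open>Linearity in a parameter is inherited by sums, hence passes from pure tensors to all tensors.
  This gives the linearity of the action on a tensor product in the acting arrow, and that of the
  associativity maps in the factor that the inner lift holds fixed.\<close>

lemma tens_parameter_hom:
  assumes c: "c \<in> Ob C" and a: "a \<in> Ob A" and P: "module K P" and Y: "module K Y"
    and h: "\<And>y. y \<in> carrier Y \<Longrightarrow> kmod_hom K (tens_val K \<phi> \<psi> c a) P (h y)"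
    and pure: "\<And>b x z. \<lbrakk>b \<in> Ob B; x \<in> carrier (Val \<phi> c b); z \<in> carrier (Val \<psi> b a)\<rbrakk>
      \<Longrightarrow> kmod_hom K Y P (\<lambda>y. h y (pure_tens K \<phi> \<psi> c a (b, x, z)))"
    and X: "X \<in> carrier (tens_val K \<phi> \<psi> c a)"
  shows "kmod_hom K Y P (\<lambda>y. h y X)"
  using c a X
proof (induction X rule: tens_sum_induct)
  case zero
  show ?case
    by (rule kmod_hom_cong[OF kmod_hom_const_zero[OF P] Y])
      (rule kmod_hom_zero[OF h tens_val_module[OF c a] P])
next
  case (add X b x z)
  show ?case
    by (rule kmod_hom_cong[OF kmod_hom_sum[OF add.IH pure[OF add.hyps(2-4)] P] Y])
      (intro kmod_hom_add[OF h] add.hyps(1) pure_tens_closed[OF c a add.hyps(2-4)])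
qed

text \<open>The action of \<open>\<gamma>\<close> on the left and of \<open>\<alpha>\<close> on the right both commute with the action of
  the middle category, because the two actions on a bimodule commute with each other.\<close>

lemma Act_tens_balanced:
  assumes "c \<in> Ob C" "c' \<in> Ob C" "a \<in> Ob A" "a' \<in> Ob A" "\<gamma> \<in> carrier (Hom C c' c)"
    "\<alpha> \<in> carrier (Hom A a a')"
  shows "balanced K \<phi> \<psi> c a (tens_val K \<phi> \<psi> c' a') (\<lambda>b x y. pure_tens K \<phi> \<psi> c' a'
    (b, Act \<phi> c c' b b \<gamma> (Idt B b) x, Act \<psi> b b a a' (Idt B b) \<alpha> y))"
proof (rule balancedI)
  fix b y assume "b \<in> Ob B" "y \<in> carrier (Val \<psi> b a)"
  with assms show "kmod_hom K (Val \<phi> c b) (tens_val K \<phi> \<psi> c' a') (\<lambda>x. pure_tens K \<phi> \<psi> c' a'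
      (b, Act \<phi> c c' b b \<gamma> (Idt B b) x, Act \<psi> b b a a' (Idt B b) \<alpha> y))"
    by (intro kmod_hom_comp[OF \<phi>.Act_linear pure_tens_left] \<psi>.Act_closed \<phi>.source.Idt_closed)
next
  fix b x assume "b \<in> Ob B" "x \<in> carrier (Val \<phi> c b)"
  with assms show "kmod_hom K (Val \<psi> b a) (tens_val K \<phi> \<psi> c' a') (\<lambda>y. pure_tens K \<phi> \<psi> c' a'
      (b, Act \<phi> c c' b b \<gamma> (Idt B b) x, Act \<psi> b b a a' (Idt B b) \<alpha> y))"
    by (intro kmod_hom_comp[OF \<psi>.Act_linear pure_tens_right] \<phi>.Act_closed \<phi>.source.Idt_closed)
next
  fix b b' \<beta> x y
  assume "b \<in> Ob B" "b' \<in> Ob B" "\<beta> \<in> carrier (Hom B b b')" "x \<in> carrier (Val \<phi> c b)"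
    "y \<in> carrier (Val \<psi> b' a)"
  note * = this assms
  have "pure_tens K \<phi> \<psi> c' a' (b', Act \<phi> c c' b' b' \<gamma> (Idt B b') (Act \<phi> c c b b' (Idt C c) \<beta> x),
        Act \<psi> b' b' a a' (Idt B b') \<alpha> y)
      = pure_tens K \<phi> \<psi> c' a' (b', Act \<phi> c' c' b b' (Idt C c') \<beta> (Act \<phi> c c' b b \<gamma> (Idt B b) x),
        Act \<psi> b' b' a a' (Idt B b') \<alpha> y)"
    using * by (simp add: \<phi>.Act_left_then_right \<phi>.Act_right_then_left)
  also have "\<dots> = pure_tens K \<phi> \<psi> c' a' (b, Act \<phi> c c' b b \<gamma> (Idt B b) x,
        Act \<psi> b' b a' a' \<beta> (Idt A a') (Act \<psi> b' b' a a' (Idt B b') \<alpha> y))"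
    using * by (intro pure_tens_slide \<phi>.Act_closed \<psi>.Act_closed \<phi>.source.Idt_closed)
  also have "\<dots> = pure_tens K \<phi> \<psi> c' a' (b, Act \<phi> c c' b b \<gamma> (Idt B b) x,
        Act \<psi> b b a a' (Idt B b) \<alpha> (Act \<psi> b' b a a \<beta> (Idt A a) y))"
    using * by (simp add: \<psi>.Act_left_then_right \<psi>.Act_right_then_left)
  finally show "pure_tens K \<phi> \<psi> c' a' (b', Act \<phi> c c' b' b' \<gamma> (Idt B b')
        (Act \<phi> c c b b' (Idt C c) \<beta> x), Act \<psi> b' b' a a' (Idt B b') \<alpha> y)
      = pure_tens K \<phi> \<psi> c' a' (b, Act \<phi> c c' b b \<gamma> (Idt B b) x,
        Act \<psi> b b a a' (Idt B b) \<alpha> (Act \<psi> b' b a a \<beta> (Idt A a) y))" .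
qed

lemma Act_tens:
  "Act (tens K \<phi> \<psi>) c c' a a' \<gamma> \<alpha> = lin_lift K (tens_val K \<phi> \<psi> c' a') (\<lambda>(b, x, y).
     pure_tens K \<phi> \<psi> c' a' (b, Act \<phi> c c' b b \<gamma> (Idt B b) x, Act \<psi> b b a a' (Idt B b) \<alpha> y))"
  by (simp add: tens_def \<phi>.Src \<psi>.Tgt)

lemma Act_tens_hom:
  assumes "c \<in> Ob C" "c' \<in> Ob C" "a \<in> Ob A" "a' \<in> Ob A" "\<gamma> \<in> carrier (Hom C c' c)"
    "\<alpha> \<in> carrier (Hom A a a')"
  shows "kmod_hom K (tens_val K \<phi> \<psi> c a) (tens_val K \<phi> \<psi> c' a') (Act (tens K \<phi> \<psi>) c c' a a' \<gamma> \<alpha>)"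
  unfolding Act_tens
  by (rule tens_lift_hom[OF assms(1,3) tens_val_module[OF assms(2,4)] Act_tens_balanced[OF assms]])

lemma Act_tens_pure:
  assumes "c \<in> Ob C" "c' \<in> Ob C" "a \<in> Ob A" "a' \<in> Ob A" "\<gamma> \<in> carrier (Hom C c' c)"
    "\<alpha> \<in> carrier (Hom A a a')"
    and "b \<in> Ob B" "x \<in> carrier (Val \<phi> c b)" "y \<in> carrier (Val \<psi> b a)"
  shows "Act (tens K \<phi> \<psi>) c c' a a' \<gamma> \<alpha> (pure_tens K \<phi> \<psi> c a (b, x, y)) = pure_tens K \<phi> \<psi> c' a'
    (b, Act \<phi> c c' b b \<gamma> (Idt B b) x, Act \<psi> b b a a' (Idt B b) \<alpha> y)"
  unfolding Act_tens
  by (rule tens_lift_pure[OF assms(1,3) tens_val_module[OF assms(2,4)] Act_tens_balanced[OF assms(1-6)]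
        assms(7-9)])

lemma tens_bimodule: "bimodule K A C (tens K \<phi> \<psi>)"
proof (rule bimodule.intro)
  show "Src (tens K \<phi> \<psi>) = A" by (simp add: \<psi>.Src)
  show "Tgt (tens K \<phi> \<psi>) = C" by (simp add: \<phi>.Tgt)
  show "module K (Val (tens K \<phi> \<psi>) c a)" if "c \<in> Ob C" "a \<in> Ob A" for c a
    using tens_val_module[OF that] by simp
  show "kmod_hom K (Val (tens K \<phi> \<psi>) c a) (Val (tens K \<phi> \<psi>) c' a') (Act (tens K \<phi> \<psi>) c c' a a' \<gamma> \<alpha>)"
    if "c \<in> Ob C" "c' \<in> Ob C" "a \<in> Ob A" "a' \<in> Ob A" "\<gamma> \<in> carrier (Hom C c' c)"
      "\<alpha> \<in> carrier (Hom A a a')" for c c' a a' \<gamma> \<alpha>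
    using Act_tens_hom[OF that] by simp
next
  fix c c' a a' \<alpha> X
  assume *: "c \<in> Ob C" "c' \<in> Ob C" "a \<in> Ob A" "a' \<in> Ob A" "\<alpha> \<in> carrier (Hom A a a')"
    "X \<in> carrier (Val (tens K \<phi> \<psi>) c a)"
  show "kmod_hom K (Hom C c' c) (Val (tens K \<phi> \<psi>) c' a') (\<lambda>\<gamma>. Act (tens K \<phi> \<psi>) c c' a a' \<gamma> \<alpha> X)"
    unfolding tens_simps
  proof (rule tens_parameter_hom[OF *(1,3)])
    fix b x z assume **: "b \<in> Ob B" "x \<in> carrier (Val \<phi> c b)" "z \<in> carrier (Val \<psi> b a)"
    have "kmod_hom K (Hom C c' c) (tens_val K \<phi> \<psi> c' a') (\<lambda>\<gamma>. pure_tens K \<phi> \<psi> c' a'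
        (b, Act \<phi> c c' b b \<gamma> (Idt B b) x, Act \<psi> b b a a' (Idt B b) \<alpha> z))"
      using * ** by (intro kmod_hom_comp[OF \<phi>.Act_linear_left pure_tens_left] \<psi>.Act_closed
        \<phi>.source.Idt_closed)
    then show "kmod_hom K (Hom C c' c) (tens_val K \<phi> \<psi> c' a')
        (\<lambda>\<gamma>. Act (tens K \<phi> \<psi>) c c' a a' \<gamma> \<alpha> (pure_tens K \<phi> \<psi> c a (b, x, z)))"
      by (rule kmod_hom_cong) (use * ** in \<open>auto simp: \<phi>.target.Hom_module Act_tens_pure\<close>)
  qed (use * in \<open>auto intro: tens_val_module \<phi>.target.Hom_module Act_tens_hom\<close>)
next
  fix c c' a a' \<gamma> X
  assume *: "c \<in> Ob C" "c' \<in> Ob C" "a \<in> Ob A" "a' \<in> Ob A" "\<gamma> \<in> carrier (Hom C c' c)"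
    "X \<in> carrier (Val (tens K \<phi> \<psi>) c a)"
  show "kmod_hom K (Hom A a a') (Val (tens K \<phi> \<psi>) c' a') (\<lambda>\<alpha>. Act (tens K \<phi> \<psi>) c c' a a' \<gamma> \<alpha> X)"
    unfolding tens_simps
  proof (rule tens_parameter_hom[OF *(1,3)])
    fix b x z assume **: "b \<in> Ob B" "x \<in> carrier (Val \<phi> c b)" "z \<in> carrier (Val \<psi> b a)"
    have "kmod_hom K (Hom A a a') (tens_val K \<phi> \<psi> c' a') (\<lambda>\<alpha>. pure_tens K \<phi> \<psi> c' a'
        (b, Act \<phi> c c' b b \<gamma> (Idt B b) x, Act \<psi> b b a a' (Idt B b) \<alpha> z))"
      using * ** by (intro kmod_hom_comp[OF \<psi>.Act_linear_right pure_tens_right] \<phi>.Act_closed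
        \<phi>.source.Idt_closed)
    then show "kmod_hom K (Hom A a a') (tens_val K \<phi> \<psi> c' a')
        (\<lambda>\<alpha>. Act (tens K \<phi> \<psi>) c c' a a' \<gamma> \<alpha> (pure_tens K \<phi> \<psi> c a (b, x, z)))"
      by (rule kmod_hom_cong) (use * ** in \<open>auto simp: \<psi>.source.Hom_module Act_tens_pure\<close>)
  qed (use * in \<open>auto intro: tens_val_module \<psi>.source.Hom_module Act_tens_hom\<close>)
next
  fix c a X assume *: "c \<in> Ob C" "a \<in> Ob A" "X \<in> carrier (Val (tens K \<phi> \<psi>) c a)"
  show "Act (tens K \<phi> \<psi>) c c a a (Idt C c) (Idt A a) X = X"
    by (rule tens_hom_eqI[OF *(1,2) Act_tens_hom _ tens_val_module *(3)[unfolded tens_simps]])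
      (use * in \<open>auto simp: Act_tens_pure \<phi>.target.Idt_closed \<psi>.source.Idt_closed \<phi>.Act_Idt \<psi>.Act_Idt
        intro: kmod_homI\<close>)
next
  fix c c' c'' a a' a'' \<gamma> \<gamma>' \<alpha> \<alpha>' X
  assume *: "c \<in> Ob C" "c' \<in> Ob C" "c'' \<in> Ob C" "a \<in> Ob A" "a' \<in> Ob A" "a'' \<in> Ob A"
    "\<gamma> \<in> carrier (Hom C c' c)" "\<gamma>' \<in> carrier (Hom C c'' c')"
    "\<alpha> \<in> carrier (Hom A a a')" "\<alpha>' \<in> carrier (Hom A a' a'')" "X \<in> carrier (Val (tens K \<phi> \<psi>) c a)"
  have cl: "Comp C c'' c' c \<gamma> \<gamma>' \<in> carrier (Hom C c'' c)" "Comp A a a' a'' \<alpha>' \<alpha> \<in> carrier (Hom A a a'')"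
    using kmod_hom_closed[OF \<phi>.target.Comp_linear_left] kmod_hom_closed[OF \<psi>.source.Comp_linear_left] *
    by blast+
  show "Act (tens K \<phi> \<psi>) c c'' a a'' (Comp C c'' c' c \<gamma> \<gamma>') (Comp A a a' a'' \<alpha>' \<alpha>) X
      = Act (tens K \<phi> \<psi>) c' c'' a' a'' \<gamma>' \<alpha>' (Act (tens K \<phi> \<psi>) c c' a a' \<gamma> \<alpha> X)"
  proof (rule tens_hom_eqI[OF *(1,4) Act_tens_hom kmod_hom_comp[OF Act_tens_hom Act_tens_hom]
        tens_val_module *(11)[unfolded tens_simps]])
    fix b x y assume **: "b \<in> Ob B" "x \<in> carrier (Val \<phi> c b)" "y \<in> carrier (Val \<psi> b a)"
    show "Act (tens K \<phi> \<psi>) c c'' a a'' (Comp C c'' c' c \<gamma> \<gamma>') (Comp A a a' a'' \<alpha>' \<alpha>)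
          (pure_tens K \<phi> \<psi> c a (b, x, y))
        = Act (tens K \<phi> \<psi>) c' c'' a' a'' \<gamma>' \<alpha>'
          (Act (tens K \<phi> \<psi>) c c' a a' \<gamma> \<alpha> (pure_tens K \<phi> \<psi> c a (b, x, y)))"
      using * ** cl by (simp add: Act_tens_pure \<phi>.Act_closed \<psi>.Act_closed \<phi>.source.Idt_closed
        \<phi>.Act_left_left \<psi>.Act_right_right)
  qed (use * cl in auto)
qed

lemma tens_kcat_bimodule: "kcat_bimodule K A C (tens K \<phi> \<psi>)"
  by (intro kcat_bimodule.intro tens_bimodule \<psi>.source.kcategory_axioms \<phi>.target.kcategory_axioms)

text \<open>Since linear maps on a tensor product are determined by pure tensors, naturality need only be
  checked on them. The 2-cells \<^const>\<open>hcomp\<close> and \<^const>\<open>lunit\<close> arise in this way.\<close>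

lemma tens_lift_two_cell:
  assumes \<chi>: "bimodule K A C \<chi>"
    and bal: "\<And>c a. \<lbrakk>c \<in> Ob C; a \<in> Ob A\<rbrakk> \<Longrightarrow> balanced K \<phi> \<psi> c a (Val \<chi> c a) (h c a)"
    and nat: "\<And>c c' a a' \<gamma> \<alpha> b x y. \<lbrakk>c \<in> Ob C; c' \<in> Ob C; a \<in> Ob A; a' \<in> Ob A;
      \<gamma> \<in> carrier (Hom C c' c); \<alpha> \<in> carrier (Hom A a a'); b \<in> Ob B; x \<in> carrier (Val \<phi> c b);
      y \<in> carrier (Val \<psi> b a)\<rbrakk>
      \<Longrightarrow> h c' a' b (Act \<phi> c c' b b \<gamma> (Idt B b) x) (Act \<psi> b b a a' (Idt B b) \<alpha> y)
        = Act \<chi> c c' a a' \<gamma> \<alpha> (h c a b x y)"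
  shows "two_cell K (tens K \<phi> \<psi>) \<chi> (\<lambda>c a. lin_lift K (Val \<chi> c a) (\<lambda>(b, x, y). h c a b x y))"
proof -
  note mod = bimodule.Val_module[OF \<chi>]
  note hom = tens_lift_hom[OF _ _ mod bal]
  note pure = tens_lift_pure[OF _ _ mod bal]
  show ?thesis
  proof (rule two_cellI[OF tens_bimodule \<chi>])
    show "kmod_hom K (Val (tens K \<phi> \<psi>) c a) (Val \<chi> c a)
        (lin_lift K (Val \<chi> c a) (\<lambda>(b, x, y). h c a b x y))" if "c \<in> Ob C" "a \<in> Ob A" for c a
      using hom that by simp
  next
    fix c c' a a' \<gamma> \<alpha> X
    assume *: "c \<in> Ob C" "c' \<in> Ob C" "a \<in> Ob A" "a' \<in> Ob A" "\<gamma> \<in> carrier (Hom C c' c)"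
      "\<alpha> \<in> carrier (Hom A a a')" "X \<in> carrier (Val (tens K \<phi> \<psi>) c a)"
    show "lin_lift K (Val \<chi> c' a') (\<lambda>(b, x, y). h c' a' b x y) (Act (tens K \<phi> \<psi>) c c' a a' \<gamma> \<alpha> X)
        = Act \<chi> c c' a a' \<gamma> \<alpha> (lin_lift K (Val \<chi> c a) (\<lambda>(b, x, y). h c a b x y) X)"
      by (rule tens_hom_eqI[OF *(1,3) kmod_hom_comp[OF Act_tens_hom hom]
            kmod_hom_comp[OF hom bimodule.Act_linear[OF \<chi>]] mod *(7)[unfolded tens_simps]])
        (use * in \<open>simp_all add: Act_tens_pure pure nat \<phi>.Act_closed \<psi>.Act_closed \<phi>.source.Idt_closed\<close>)
  qed
qed

end

locale parallel_composable =
  dom: composable K A B C \<phi> \<psi> + cod: composable K A B C \<phi>' \<psi>'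
  for K :: "('k, 'z) ring_scheme" (structure) and A :: "('k, 'a, 'm) kcat"
    and B :: "('k, 'b, 'n) kcat" and C :: "('k, 'c, 'l) kcat"
    and \<phi> :: "('k, 'c, 'l, 'b, 'n, 'x) bimod" and \<psi> :: "('k, 'b, 'n, 'a, 'm, 'y) bimod"
    and \<phi>' :: "('k, 'c, 'l, 'b, 'n, 'x2) bimod" and \<psi>' :: "('k, 'b, 'n, 'a, 'm, 'y2) bimod" +
  fixes \<sigma> \<tau>
  assumes \<sigma>: "two_cell K \<phi> \<phi>' \<sigma>" and \<tau>: "two_cell K \<psi> \<psi>' \<tau>"
begin

lemmas cell_hom = two_cellD(1)[OF dom.\<phi>.bimodule_axioms \<sigma>] two_cellD(1)[OF dom.\<psi>.bimodule_axioms \<tau>]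
lemmas cell_natural = two_cellD(2)[OF dom.\<phi>.bimodule_axioms \<sigma>]
  two_cellD(2)[OF dom.\<psi>.bimodule_axioms \<tau>]
lemmas cell_closed = kmod_hom_closed[OF cell_hom(1)] kmod_hom_closed[OF cell_hom(2)]

lemma hcomp_balanced:
  assumes "c \<in> Ob C" and "a \<in> Ob A"
  shows "balanced K \<phi> \<psi> c a (tens_val K \<phi>' \<psi>' c a)
    (\<lambda>b x y. pure_tens K \<phi>' \<psi>' c a (b, \<sigma> c b x, \<tau> b a y))"
proof (rule dom.balancedI)
  show "kmod_hom K (Val \<phi> c b) (tens_val K \<phi>' \<psi>' c a)
      (\<lambda>x. pure_tens K \<phi>' \<psi>' c a (b, \<sigma> c b x, \<tau> b a y))"
    if "b \<in> Ob B" "y \<in> carrier (Val \<psi> b a)" for b y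
    using assms that by (intro kmod_hom_comp[OF cell_hom(1) cod.pure_tens_left] cell_closed)
  show "kmod_hom K (Val \<psi> b a) (tens_val K \<phi>' \<psi>' c a)
      (\<lambda>y. pure_tens K \<phi>' \<psi>' c a (b, \<sigma> c b x, \<tau> b a y))"
    if "b \<in> Ob B" "x \<in> carrier (Val \<phi> c b)" for b x
    using assms that by (intro kmod_hom_comp[OF cell_hom(2) cod.pure_tens_right] cell_closed)
qed (use assms in \<open>simp add: cell_natural dom.\<phi>.target.Idt_closed dom.\<psi>.source.Idt_closed
  cod.pure_tens_slide cell_closed\<close>)

lemma hcomp_hom:
  "\<lbrakk>c \<in> Ob C; a \<in> Ob A\<rbrakk>
    \<Longrightarrow> kmod_hom K (tens_val K \<phi> \<psi> c a) (tens_val K \<phi>' \<psi>' c a) (hcomp K \<phi>' \<psi>' \<sigma> \<tau> c a)"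
  unfolding hcomp_def by (intro dom.tens_lift_hom cod.tens_val_module hcomp_balanced)

lemma hcomp_pure:
  "\<lbrakk>c \<in> Ob C; a \<in> Ob A; b \<in> Ob B; x \<in> carrier (Val \<phi> c b); y \<in> carrier (Val \<psi> b a)\<rbrakk>
    \<Longrightarrow> hcomp K \<phi>' \<psi>' \<sigma> \<tau> c a (pure_tens K \<phi> \<psi> c a (b, x, y))
      = pure_tens K \<phi>' \<psi>' c a (b, \<sigma> c b x, \<tau> b a y)"
  unfolding hcomp_def
  using dom.tens_lift_pure[OF _ _ cod.tens_val_module hcomp_balanced] by simp

lemma hcomp_two_cell: "two_cell K (tens K \<phi> \<psi>) (tens K \<phi>' \<psi>') (hcomp K \<phi>' \<psi>' \<sigma> \<tau>)"
  unfolding hcomp_def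
  by (rule dom.tens_lift_two_cell[OF cod.tens_bimodule, unfolded tens_simps, OF hcomp_balanced])
    (simp_all add: cod.Act_tens_pure cell_closed cell_natural dom.\<phi>.source.Idt_closed)

end

section \<open>Units and associativity of the tensor product\<close>

context kcategory
begin

lemma Comp_closed:
  "\<lbrakk>a \<in> Ob A; b \<in> Ob A; c \<in> Ob A; f \<in> carrier (Hom A a b); g \<in> carrier (Hom A b c)\<rbrakk>
    \<Longrightarrow> Comp A a b c g f \<in> carrier (Hom A a c)"
  using kmod_hom_closed[OF Comp_linear_left] .

lemma id_bimod_simps [simp]:
  "Src (id_bimod A) = A" "Tgt (id_bimod A) = A" "Val (id_bimod A) = Hom A"
  "Act (id_bimod A) b b' c c' \<beta> \<gamma> x = Comp A b' c c' \<gamma> (Comp A b' b c x \<beta>)"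
  by (simp_all add: id_bimod_def)

lemma id_bimod_bimodule: "bimodule K A A (id_bimod A)"
proof (rule bimodule.intro)
  fix b b' c c' \<beta> \<gamma>
  assume "b \<in> Ob A" "b' \<in> Ob A" "c \<in> Ob A" "c' \<in> Ob A" "\<beta> \<in> carrier (Hom A b' b)"
    "\<gamma> \<in> carrier (Hom A c c')"
  then show "kmod_hom K (Val (id_bimod A) b c) (Val (id_bimod A) b' c')
      (Act (id_bimod A) b b' c c' \<beta> \<gamma>)"
    unfolding id_bimod_def by (simp add: kmod_hom_comp[OF Comp_linear_left Comp_linear_right])
next
  fix b b' c c' \<gamma> x
  assume "b \<in> Ob A" "b' \<in> Ob A" "c \<in> Ob A" "c' \<in> Ob A" "\<gamma> \<in> carrier (Hom A c c')"
    "x \<in> carrier (Val (id_bimod A) b c)"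
  then show "kmod_hom K (Hom A b' b) (Val (id_bimod A) b' c')
      (\<lambda>\<beta>. Act (id_bimod A) b b' c c' \<beta> \<gamma> x)"
    by (simp add: kmod_hom_comp[OF Comp_linear_right Comp_linear_right])
next
  fix b b' c c' \<beta> x
  assume "b \<in> Ob A" "b' \<in> Ob A" "c \<in> Ob A" "c' \<in> Ob A" "\<beta> \<in> carrier (Hom A b' b)"
    "x \<in> carrier (Val (id_bimod A) b c)"
  then show "kmod_hom K (Hom A c c') (Val (id_bimod A) b' c')
      (\<lambda>\<gamma>. Act (id_bimod A) b b' c c' \<beta> \<gamma> x)"
    by (simp add: Comp_linear_left Comp_closed)
qed (simp_all add: Hom_module Comp_Idt_left Comp_Idt_right Comp_assoc Comp_closed)

lemma id_bimod_kcat_bimodule: "kcat_bimodule K A A (id_bimod A)"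
  by (intro kcat_bimodule.intro id_bimod_bimodule kcategory_axioms)

end

context kcat_bimodule
begin

sublocale left_unit: composable K A B B "id_bimod B" \<phi>
  by (intro composable.intro target.id_bimod_kcat_bimodule kcat_bimodule_axioms)

sublocale right_unit: composable K A A B \<phi> "id_bimod A"
  by (intro composable.intro source.id_bimod_kcat_bimodule kcat_bimodule_axioms)

lemma lunit_balanced:
  assumes "b \<in> Ob B" and "a \<in> Ob A"
  shows "balanced K (id_bimod B) \<phi> b a (Val \<phi> b a) (\<lambda>b' \<beta> x. Act \<phi> b' b a a \<beta> (Idt A a) x)"
  by (rule left_unit.balancedI)
    (use assms in \<open>auto simp: Act_linear Act_linear_left source.Idt_closed target.Idt_closed
      target.Comp_Idt_right Act_left_left\<close>)

lemma lunit_eq: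
  "lunit K \<phi> = (\<lambda>b a. lin_lift K (Val \<phi> b a) (\<lambda>(b', \<beta>, x). Act \<phi> b' b a a \<beta> (Idt A a) x))"
  by (simp add: lunit_def Src)

lemma lunit_pure:
  "\<lbrakk>b \<in> Ob B; a \<in> Ob A; b' \<in> Ob B; \<beta> \<in> carrier (Hom B b b'); x \<in> carrier (Val \<phi> b' a)\<rbrakk>
    \<Longrightarrow> lunit K \<phi> b a (pure_tens K (id_bimod B) \<phi> b a (b', \<beta>, x)) = Act \<phi> b' b a a \<beta> (Idt A a) x"
  unfolding lunit_eq using left_unit.tens_lift_pure[OF _ _ Val_module lunit_balanced] by simp

lemma lunit_two_cell: "two_cell K (tens K (id_bimod B) \<phi>) \<phi> (lunit K \<phi>)"
  unfolding lunit_eq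
proof (rule left_unit.tens_lift_two_cell[OF bimodule_axioms lunit_balanced])
  fix c c' a a' \<gamma> \<alpha> b \<beta> x
  assume "c \<in> Ob B" "c' \<in> Ob B" "a \<in> Ob A" "a' \<in> Ob A" "\<gamma> \<in> carrier (Hom B c' c)"
    "\<alpha> \<in> carrier (Hom A a a')" "b \<in> Ob B" "\<beta> \<in> carrier (Val (id_bimod B) c b)"
    "x \<in> carrier (Val \<phi> b a)"
  then show "Act \<phi> b c' a' a' (Act (id_bimod B) c c' b b \<gamma> (Idt B b) \<beta>) (Idt A a')
        (Act \<phi> b b a a' (Idt B b) \<alpha> x)
      = Act \<phi> c c' a a' \<gamma> \<alpha> (Act \<phi> b c a a \<beta> (Idt A a) x)"
    using Act_Comp[of b c c' a a a' \<beta> \<gamma> "Idt A a" \<alpha> x]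
    by (simp add: target.Comp_Idt_left target.Comp_closed Act_right_then_left source.Idt_closed
        source.Comp_Idt_right)
qed

lemma runit_balanced:
  assumes "b \<in> Ob B" and "a \<in> Ob A"
  shows "balanced K \<phi> (id_bimod A) b a (Val \<phi> b a) (\<lambda>a' x \<alpha>. Act \<phi> b b a' a (Idt B b) \<alpha> x)"
  by (rule right_unit.balancedI)
    (use assms in \<open>auto simp: Act_linear Act_linear_right source.Idt_closed target.Idt_closed
      source.Comp_Idt_left source.Comp_closed Act_right_right\<close>)

lemma runit_pure:
  "\<lbrakk>b \<in> Ob B; a \<in> Ob A; a' \<in> Ob A; x \<in> carrier (Val \<phi> b a'); \<alpha> \<in> carrier (Hom A a' a)\<rbrakk>
    \<Longrightarrow> runit K \<phi> b a (pure_tens K \<phi> (id_bimod A) b a (a', x, \<alpha>)) = Act \<phi> b b a' a (Idt B b) \<alpha> x"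
  unfolding runit_def Tgt using right_unit.tens_lift_pure[OF _ _ Val_module runit_balanced] by simp

end

locale composable3 = left: composable K B C D \<chi> \<phi> + right: composable K A B C \<phi> \<psi>
  for K :: "('k, 'z) ring_scheme" (structure) and A :: "('k, 'a, 'm) kcat"
    and B :: "('k, 'b, 'n) kcat" and C :: "('k, 'c, 'l) kcat" and D :: "('k, 'd, 'p) kcat"
    and \<chi> :: "('k, 'd, 'p, 'c, 'l, 'w) bimod" and \<phi> :: "('k, 'c, 'l, 'b, 'n, 'x) bimod"
    and \<psi> :: "('k, 'b, 'n, 'a, 'm, 'y) bimod"
begin

sublocale left_assoc: composable K A B D "tens K \<chi> \<phi>" \<psi>
  by (intro composable.intro left.tens_kcat_bimodule right.\<psi>.kcat_bimodule_axioms)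

sublocale right_assoc: composable K A C D \<chi> "tens K \<phi> \<psi>"
  by (intro composable.intro right.tens_kcat_bimodule left.\<phi>.kcat_bimodule_axioms)

lemmas Idt_closed = left.\<phi>.target.Idt_closed left.\<phi>.source.Idt_closed left.\<psi>.source.Idt_closed
  right.\<psi>.source.Idt_closed

lemmas left_assoc_hom_eqI = left_assoc.tens_hom_eqI[unfolded tens_simps]
lemmas right_assoc_hom_eqI = right_assoc.tens_hom_eqI[unfolded tens_simps]

text \<open>The threefold tensor product is generated by the threefold pure tensors, in either bracketing;
  this lemma and the next one reduce an equation of linear maps to them.\<close>

lemma left_assoc_eqI:
  assumes d: "d \<in> Ob D" and a: "a \<in> Ob A" and P: "module K P"
    and h: "kmod_hom K (tens_val K (tens K \<chi> \<phi>) \<psi> d a) P h"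
    and h': "kmod_hom K (tens_val K (tens K \<chi> \<phi>) \<psi> d a) P h'"
    and X: "X \<in> carrier (tens_val K (tens K \<chi> \<phi>) \<psi> d a)"
    and pure: "\<And>b c w x y. \<lbrakk>b \<in> Ob B; c \<in> Ob C; w \<in> carrier (Val \<chi> d c); x \<in> carrier (Val \<phi> c b);
      y \<in> carrier (Val \<psi> b a)\<rbrakk>
      \<Longrightarrow> h (pure_tens K (tens K \<chi> \<phi>) \<psi> d a (b, pure_tens K \<chi> \<phi> d b (c, w, x), y))
        = h' (pure_tens K (tens K \<chi> \<phi>) \<psi> d a (b, pure_tens K \<chi> \<phi> d b (c, w, x), y))"
  shows "h X = h' X"
proof (rule left_assoc_hom_eqI[OF d a h h' P X])
  fix b Y y assume *: "b \<in> Ob B" "Y \<in> carrier (tens_val K \<chi> \<phi> d b)" "y \<in> carrier (Val \<psi> b a)"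
  note t = left_assoc.pure_tens_left[OF d a *(1,3), unfolded tens_simps]
  show "h (pure_tens K (tens K \<chi> \<phi>) \<psi> d a (b, Y, y)) = h' (pure_tens K (tens K \<chi> \<phi>) \<psi> d a (b, Y, y))"
    by (rule left.tens_hom_eqI[OF d *(1) kmod_hom_comp[OF t h] kmod_hom_comp[OF t h'] P *(2)])
      (rule pure[OF *(1) _ _ _ *(3)])
qed

lemma right_assoc_eqI:
  assumes d: "d \<in> Ob D" and a: "a \<in> Ob A" and P: "module K P"
    and h: "kmod_hom K (tens_val K \<chi> (tens K \<phi> \<psi>) d a) P h"
    and h': "kmod_hom K (tens_val K \<chi> (tens K \<phi> \<psi>) d a) P h'"
    and X: "X \<in> carrier (tens_val K \<chi> (tens K \<phi> \<psi>) d a)"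
    and pure: "\<And>b c w x y. \<lbrakk>b \<in> Ob B; c \<in> Ob C; w \<in> carrier (Val \<chi> d c); x \<in> carrier (Val \<phi> c b);
      y \<in> carrier (Val \<psi> b a)\<rbrakk>
      \<Longrightarrow> h (pure_tens K \<chi> (tens K \<phi> \<psi>) d a (c, w, pure_tens K \<phi> \<psi> c a (b, x, y)))
        = h' (pure_tens K \<chi> (tens K \<phi> \<psi>) d a (c, w, pure_tens K \<phi> \<psi> c a (b, x, y)))"
  shows "h X = h' X"
proof (rule right_assoc_hom_eqI[OF d a h h' P X])
  fix c w Y assume *: "c \<in> Ob C" "w \<in> carrier (Val \<chi> d c)" "Y \<in> carrier (tens_val K \<phi> \<psi> c a)"
  note t = right_assoc.pure_tens_right[OF d a *(1,2), unfolded tens_simps]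
  show "h (pure_tens K \<chi> (tens K \<phi> \<psi>) d a (c, w, Y)) = h' (pure_tens K \<chi> (tens K \<phi> \<psi>) d a (c, w, Y))"
    by (rule right.tens_hom_eqI[OF *(1) a kmod_hom_comp[OF t h] kmod_hom_comp[OF t h'] P *(3)])
      (rule pure[OF _ *(1,2)])
qed

text \<open>The associativity map is a lift of a lift: for fixed \<open>y\<close> the map
  \<open>(w, x) \<mapsto> w \<otimes> (x \<otimes> y)\<close> is balanced, and then the resulting map is balanced in
  \<open>(w \<otimes> x, y)\<close>. The inverse is treated in the same way.\<close>

lemma assoc_inner_balanced:
  assumes d: "d \<in> Ob D" and a: "a \<in> Ob A" and b: "b \<in> Ob B" and y: "y \<in> carrier (Val \<psi> b a)"
  shows "balanced K \<chi> \<phi> d b (tens_val K \<chi> (tens K \<phi> \<psi>) d a)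
    (\<lambda>c w x. pure_tens K \<chi> (tens K \<phi> \<psi>) d a (c, w, pure_tens K \<phi> \<psi> c a (b, x, y)))"
proof (rule left.balancedI)
  fix c x assume "c \<in> Ob C" "x \<in> carrier (Val \<phi> c b)"
  with assms show "kmod_hom K (Val \<chi> d c) (tens_val K \<chi> (tens K \<phi> \<psi>) d a)
      (\<lambda>w. pure_tens K \<chi> (tens K \<phi> \<psi>) d a (c, w, pure_tens K \<phi> \<psi> c a (b, x, y)))"
    by (intro right_assoc.pure_tens_left) (simp_all add: right.pure_tens_closed)
next
  fix c w assume "c \<in> Ob C" "w \<in> carrier (Val \<chi> d c)"
  with assms show "kmod_hom K (Val \<phi> c b) (tens_val K \<chi> (tens K \<phi> \<psi>) d a)
      (\<lambda>x. pure_tens K \<chi> (tens K \<phi> \<psi>) d a (c, w, pure_tens K \<phi> \<psi> c a (b, x, y)))"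
    by (intro kmod_hom_comp[OF right.pure_tens_left right_assoc.pure_tens_right[unfolded tens_simps]])
next
  fix c c' \<gamma> w x
  assume "c \<in> Ob C" "c' \<in> Ob C" "\<gamma> \<in> carrier (Hom C c c')" "w \<in> carrier (Val \<chi> d c)"
    "x \<in> carrier (Val \<phi> c' b)"
  with assms show "pure_tens K \<chi> (tens K \<phi> \<psi>) d a
        (c', Act \<chi> d d c c' (Idt D d) \<gamma> w, pure_tens K \<phi> \<psi> c' a (b, x, y))
      = pure_tens K \<chi> (tens K \<phi> \<psi>) d a
        (c, w, pure_tens K \<phi> \<psi> c a (b, Act \<phi> c' c b b \<gamma> (Idt B b) x, y))"
    by (simp add: right_assoc.pure_tens_slide right.pure_tens_closed right.Act_tens_pure Idt_closed
        right.\<psi>.Act_Idt)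
qed

lemmas assoc_inner_hom =
  left.tens_lift_hom[OF _ _ right_assoc.tens_val_module assoc_inner_balanced]
lemmas assoc_inner_pure =
  left.tens_lift_pure[OF _ _ right_assoc.tens_val_module assoc_inner_balanced]

lemma assoc_balanced:
  assumes d: "d \<in> Ob D" and a: "a \<in> Ob A"
  shows "balanced K (tens K \<chi> \<phi>) \<psi> d a (tens_val K \<chi> (tens K \<phi> \<psi>) d a)
    (\<lambda>b X y. lin_lift K (tens_val K \<chi> (tens K \<phi> \<psi>) d a) (\<lambda>(c, w, x).
      pure_tens K \<chi> (tens K \<phi> \<psi>) d a (c, w, pure_tens K \<phi> \<psi> c a (b, x, y))) X)"
    (is "balanced K _ \<psi> d a ?P ?h")
proof (rule left_assoc.balancedI)
  show "kmod_hom K (Val (tens K \<chi> \<phi>) d b) ?P (\<lambda>X. ?h b X y)"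
    if "b \<in> Ob B" "y \<in> carrier (Val \<psi> b a)" for b y
    using assoc_inner_hom[OF d that(1) d a d a that] by simp
next
  fix b X assume b: "b \<in> Ob B" and X: "X \<in> carrier (Val (tens K \<chi> \<phi>) d b)"
  show "kmod_hom K (Val \<psi> b a) ?P (?h b X)"
  proof (rule left.tens_parameter_hom[OF d b right_assoc.tens_val_module[OF d a] _ _ _ X[unfolded tens_simps]])
    show "kmod_hom K (tens_val K \<chi> \<phi> d b) ?P (\<lambda>X. ?h b X y)" if "y \<in> carrier (Val \<psi> b a)" for y
      using assoc_inner_hom[OF d b d a d a b that] .
  next
    fix c w x assume *: "c \<in> Ob C" "w \<in> carrier (Val \<chi> d c)" "x \<in> carrier (Val \<phi> c b)"
    show "kmod_hom K (Val \<psi> b a) ?P (\<lambda>y. ?h b (pure_tens K \<chi> \<phi> d b (c, w, x)) y)"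
      by (rule kmod_hom_cong[OF kmod_hom_comp[OF right.pure_tens_right[OF *(1) a b *(3)]
            right_assoc.pure_tens_right[OF d a *(1,2), unfolded tens_simps]]])
        (use * a b d in \<open>simp_all add: assoc_inner_pure right.\<psi>.Val_module\<close>)
  qed (rule right.\<psi>.Val_module[OF b a])
next
  fix b b' \<beta> X y
  assume *: "b \<in> Ob B" "b' \<in> Ob B" "\<beta> \<in> carrier (Hom B b b')" "X \<in> carrier (Val (tens K \<chi> \<phi>) d b)"
    "y \<in> carrier (Val \<psi> b' a)"
  have y': "Act \<psi> b' b a a \<beta> (Idt A a) y \<in> carrier (Val \<psi> b a)"
    using * a by (simp add: right.\<psi>.Act_closed Idt_closed)
  show "?h b' (Act (tens K \<chi> \<phi>) d d b b' (Idt D d) \<beta> X) y = ?h b X (Act \<psi> b' b a a \<beta> (Idt A a) y)"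
    by (rule left.tens_hom_eqI[OF d *(1)
        kmod_hom_comp[OF left.Act_tens_hom assoc_inner_hom[OF d *(2) d a d a *(2,5)]]
        assoc_inner_hom[OF d *(1) d a d a *(1) y'] right_assoc.tens_val_module[OF d a]
        *(4)[unfolded tens_simps]])
      (use * d a y' in \<open>simp_all add: left.Act_tens_pure Idt_closed assoc_inner_pure left.\<phi>.Act_Idt
        left.\<psi>.Act_closed right.pure_tens_slide\<close>)
qed

lemma assoc_hom:
  "\<lbrakk>d \<in> Ob D; a \<in> Ob A\<rbrakk> \<Longrightarrow> kmod_hom K (tens_val K (tens K \<chi> \<phi>) \<psi> d a)
    (tens_val K \<chi> (tens K \<phi> \<psi>) d a) (assoc K \<chi> \<phi> \<psi> d a)"
  unfolding assoc_def by (intro left_assoc.tens_lift_hom right_assoc.tens_val_module assoc_balanced)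

lemma assoc_pure:
  assumes "d \<in> Ob D" "a \<in> Ob A" "b \<in> Ob B" "c \<in> Ob C" "w \<in> carrier (Val \<chi> d c)"
    "x \<in> carrier (Val \<phi> c b)" "y \<in> carrier (Val \<psi> b a)"
  shows "assoc K \<chi> \<phi> \<psi> d a (pure_tens K (tens K \<chi> \<phi>) \<psi> d a (b, pure_tens K \<chi> \<phi> d b (c, w, x), y))
    = pure_tens K \<chi> (tens K \<phi> \<psi>) d a (c, w, pure_tens K \<phi> \<psi> c a (b, x, y))"
  unfolding assoc_def
  using left_assoc.tens_lift_pure[OF assms(1,2) right_assoc.tens_val_module[OF assms(1,2)]
      assoc_balanced[OF assms(1,2)] assms(3), unfolded tens_simps,
      OF left.pure_tens_closed[OF assms(1,3-6)] assms(7)]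
  by (simp add: assms assoc_inner_pure)

lemma assoc_two_cell:
  "two_cell K (tens K (tens K \<chi> \<phi>) \<psi>) (tens K \<chi> (tens K \<phi> \<psi>)) (assoc K \<chi> \<phi> \<psi>)"
proof (rule two_cellI[OF left_assoc.tens_bimodule right_assoc.tens_bimodule])
  fix d d' a a' \<delta> \<alpha> X
  assume *: "d \<in> Ob D" "d' \<in> Ob D" "a \<in> Ob A" "a' \<in> Ob A" "\<delta> \<in> carrier (Hom D d' d)"
    "\<alpha> \<in> carrier (Hom A a a')" "X \<in> carrier (Val (tens K (tens K \<chi> \<phi>) \<psi>) d a)"
  show "assoc K \<chi> \<phi> \<psi> d' a' (Act (tens K (tens K \<chi> \<phi>) \<psi>) d d' a a' \<delta> \<alpha> X)
      = Act (tens K \<chi> (tens K \<phi> \<psi>)) d d' a a' \<delta> \<alpha> (assoc K \<chi> \<phi> \<psi> d a X)"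
    by (rule left_assoc_eqI[OF *(1,3) right_assoc.tens_val_module[OF *(2,4)]
        kmod_hom_comp[OF left_assoc.Act_tens_hom[OF *(1-6)] assoc_hom[OF *(2,4)]]
        kmod_hom_comp[OF assoc_hom[OF *(1,3)] right_assoc.Act_tens_hom[OF *(1-6)]]
        *(7)[unfolded tens_simps]])
      (use * in \<open>simp add: left_assoc.Act_tens_pure right_assoc.Act_tens_pure left.Act_tens_pure
        right.Act_tens_pure left.pure_tens_closed right.pure_tens_closed assoc_pure Idt_closed
        left.\<phi>.Act_closed left.\<psi>.Act_closed right.\<psi>.Act_closed\<close>)
qed (simp add: assoc_hom)

lemma assoc_inv_inner_balanced:
  assumes d: "d \<in> Ob D" and a: "a \<in> Ob A" and c: "c \<in> Ob C" and w: "w \<in> carrier (Val \<chi> d c)"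
  shows "balanced K \<phi> \<psi> c a (tens_val K (tens K \<chi> \<phi>) \<psi> d a)
    (\<lambda>b x y. pure_tens K (tens K \<chi> \<phi>) \<psi> d a (b, pure_tens K \<chi> \<phi> d b (c, w, x), y))"
proof (rule right.balancedI)
  fix b y assume "b \<in> Ob B" "y \<in> carrier (Val \<psi> b a)"
  with assms show "kmod_hom K (Val \<phi> c b) (tens_val K (tens K \<chi> \<phi>) \<psi> d a)
      (\<lambda>x. pure_tens K (tens K \<chi> \<phi>) \<psi> d a (b, pure_tens K \<chi> \<phi> d b (c, w, x), y))"
    by (intro kmod_hom_comp[OF left.pure_tens_right left_assoc.pure_tens_left[unfolded tens_simps]])
next
  fix b x assume "b \<in> Ob B" "x \<in> carrier (Val \<phi> c b)"
  with assms show "kmod_hom K (Val \<psi> b a) (tens_val K (tens K \<chi> \<phi>) \<psi> d a)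
      (\<lambda>y. pure_tens K (tens K \<chi> \<phi>) \<psi> d a (b, pure_tens K \<chi> \<phi> d b (c, w, x), y))"
    by (intro left_assoc.pure_tens_right) (simp_all add: left.pure_tens_closed)
next
  fix b b' \<beta> x y
  assume "b \<in> Ob B" "b' \<in> Ob B" "\<beta> \<in> carrier (Hom B b b')" "x \<in> carrier (Val \<phi> c b)"
    "y \<in> carrier (Val \<psi> b' a)"
  with assms show "pure_tens K (tens K \<chi> \<phi>) \<psi> d a
        (b', pure_tens K \<chi> \<phi> d b' (c, w, Act \<phi> c c b b' (Idt C c) \<beta> x), y)
      = pure_tens K (tens K \<chi> \<phi>) \<psi> d a
        (b, pure_tens K \<chi> \<phi> d b (c, w, x), Act \<psi> b' b a a \<beta> (Idt A a) y)"
    by (simp add: left_assoc.pure_tens_slide[symmetric] left.pure_tens_closed left.Act_tens_pure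
        Idt_closed left.\<phi>.Act_Idt)
qed

lemmas assoc_inv_inner_hom =
  right.tens_lift_hom[OF _ _ left_assoc.tens_val_module assoc_inv_inner_balanced]
lemmas assoc_inv_inner_pure =
  right.tens_lift_pure[OF _ _ left_assoc.tens_val_module assoc_inv_inner_balanced]

lemma assoc_inv_balanced:
  assumes d: "d \<in> Ob D" and a: "a \<in> Ob A"
  shows "balanced K \<chi> (tens K \<phi> \<psi>) d a (tens_val K (tens K \<chi> \<phi>) \<psi> d a)
    (\<lambda>c w Y. lin_lift K (tens_val K (tens K \<chi> \<phi>) \<psi> d a) (\<lambda>(b, x, y).
      pure_tens K (tens K \<chi> \<phi>) \<psi> d a (b, pure_tens K \<chi> \<phi> d b (c, w, x), y)) Y)"
    (is "balanced K \<chi> _ d a ?P ?h")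
proof (rule right_assoc.balancedI)
  show "kmod_hom K (Val (tens K \<phi> \<psi>) c a) ?P (?h c w)"
    if "c \<in> Ob C" "w \<in> carrier (Val \<chi> d c)" for c w
    using assoc_inv_inner_hom[OF that(1) a d a d a that] by simp
next
  fix c Y assume c: "c \<in> Ob C" and Y: "Y \<in> carrier (Val (tens K \<phi> \<psi>) c a)"
  show "kmod_hom K (Val \<chi> d c) ?P (\<lambda>w. ?h c w Y)"
  proof (rule right.tens_parameter_hom[OF c a left_assoc.tens_val_module[OF d a] _ _ _ Y[unfolded tens_simps]])
    show "kmod_hom K (tens_val K \<phi> \<psi> c a) ?P (?h c w)" if "w \<in> carrier (Val \<chi> d c)" for w
      using assoc_inv_inner_hom[OF c a d a d a c that] .
  next
    fix b x y assume *: "b \<in> Ob B" "x \<in> carrier (Val \<phi> c b)" "y \<in> carrier (Val \<psi> b a)"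
    show "kmod_hom K (Val \<chi> d c) ?P (\<lambda>w. ?h c w (pure_tens K \<phi> \<psi> c a (b, x, y)))"
      by (rule kmod_hom_cong[OF kmod_hom_comp[OF left.pure_tens_left[OF d *(1) c *(2)]
            left_assoc.pure_tens_left[OF d a *(1,3), unfolded tens_simps]]])
        (use * a c d in \<open>simp_all add: assoc_inv_inner_pure left.\<phi>.Val_module\<close>)
  qed (rule left.\<phi>.Val_module[OF d c])
next
  fix c c' \<gamma> w Y
  assume *: "c \<in> Ob C" "c' \<in> Ob C" "\<gamma> \<in> carrier (Hom C c c')" "w \<in> carrier (Val \<chi> d c)"
    "Y \<in> carrier (Val (tens K \<phi> \<psi>) c' a)"
  have w': "Act \<chi> d d c c' (Idt D d) \<gamma> w \<in> carrier (Val \<chi> d c')"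
    using * d by (simp add: left.\<phi>.Act_closed Idt_closed)
  show "?h c' (Act \<chi> d d c c' (Idt D d) \<gamma> w) Y = ?h c w (Act (tens K \<phi> \<psi>) c' c a a \<gamma> (Idt A a) Y)"
    by (rule right.tens_hom_eqI[OF *(2) a assoc_inv_inner_hom[OF *(2) a d a d a *(2) w']
        kmod_hom_comp[OF right.Act_tens_hom assoc_inv_inner_hom[OF *(1) a d a d a *(1,4)]]
        left_assoc.tens_val_module[OF d a] *(5)[unfolded tens_simps]])
      (use * d a w' in \<open>simp_all add: right.Act_tens_pure Idt_closed assoc_inv_inner_pure
        right.\<psi>.Act_Idt left.\<psi>.Act_closed left.pure_tens_slide\<close>)
qed

lemma assoc_inv_hom:
  "\<lbrakk>d \<in> Ob D; a \<in> Ob A\<rbrakk> \<Longrightarrow> kmod_hom K (tens_val K \<chi> (tens K \<phi> \<psi>) d a)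
    (tens_val K (tens K \<chi> \<phi>) \<psi> d a) (assoc_inv K \<chi> \<phi> \<psi> d a)"
  unfolding assoc_inv_def
  by (intro right_assoc.tens_lift_hom left_assoc.tens_val_module assoc_inv_balanced)

lemma assoc_inv_pure:
  assumes "d \<in> Ob D" "a \<in> Ob A" "b \<in> Ob B" "c \<in> Ob C" "w \<in> carrier (Val \<chi> d c)"
    "x \<in> carrier (Val \<phi> c b)" "y \<in> carrier (Val \<psi> b a)"
  shows "assoc_inv K \<chi> \<phi> \<psi> d a (pure_tens K \<chi> (tens K \<phi> \<psi>) d a (c, w, pure_tens K \<phi> \<psi> c a (b, x, y)))
    = pure_tens K (tens K \<chi> \<phi>) \<psi> d a (b, pure_tens K \<chi> \<phi> d b (c, w, x), y)"
  unfolding assoc_inv_def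
  using right_assoc.tens_lift_pure[OF assms(1,2) left_assoc.tens_val_module[OF assms(1,2)]
      assoc_inv_balanced[OF assms(1,2)] assms(4,5), unfolded tens_simps,
      OF right.pure_tens_closed[OF assms(4,2,3,6,7)]]
  by (simp add: assms assoc_inv_inner_pure)

lemma assoc_inv_two_cell:
  "two_cell K (tens K \<chi> (tens K \<phi> \<psi>)) (tens K (tens K \<chi> \<phi>) \<psi>) (assoc_inv K \<chi> \<phi> \<psi>)"
proof (rule two_cellI[OF right_assoc.tens_bimodule left_assoc.tens_bimodule])
  fix d d' a a' \<delta> \<alpha> X
  assume *: "d \<in> Ob D" "d' \<in> Ob D" "a \<in> Ob A" "a' \<in> Ob A" "\<delta> \<in> carrier (Hom D d' d)"
    "\<alpha> \<in> carrier (Hom A a a')" "X \<in> carrier (Val (tens K \<chi> (tens K \<phi> \<psi>)) d a)"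
  show "assoc_inv K \<chi> \<phi> \<psi> d' a' (Act (tens K \<chi> (tens K \<phi> \<psi>)) d d' a a' \<delta> \<alpha> X)
      = Act (tens K (tens K \<chi> \<phi>) \<psi>) d d' a a' \<delta> \<alpha> (assoc_inv K \<chi> \<phi> \<psi> d a X)"
    by (rule right_assoc_eqI[OF *(1,3) left_assoc.tens_val_module[OF *(2,4)]
        kmod_hom_comp[OF right_assoc.Act_tens_hom[OF *(1-6)] assoc_inv_hom[OF *(2,4)]]
        kmod_hom_comp[OF assoc_inv_hom[OF *(1,3)] left_assoc.Act_tens_hom[OF *(1-6)]]
        *(7)[unfolded tens_simps]])
      (use * in \<open>simp add: left_assoc.Act_tens_pure right_assoc.Act_tens_pure left.Act_tens_pure
        right.Act_tens_pure left.pure_tens_closed right.pure_tens_closed assoc_inv_pure Idt_closed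
        left.\<phi>.Act_closed left.\<psi>.Act_closed right.\<psi>.Act_closed\<close>)
qed (simp add: assoc_inv_hom)

lemma assoc_assoc_inv:
  assumes "d \<in> Ob D" and "a \<in> Ob A" and "X \<in> carrier (tens_val K \<chi> (tens K \<phi> \<psi>) d a)"
  shows "assoc K \<chi> \<phi> \<psi> d a (assoc_inv K \<chi> \<phi> \<psi> d a X) = X"
  by (rule right_assoc_eqI[OF assms(1,2) right_assoc.tens_val_module
        kmod_hom_comp[OF assoc_inv_hom assoc_hom] _ assms(3)])
    (use assms in \<open>auto simp: assoc_inv_pure assoc_pure intro: kmod_homI\<close>)

end

section \<open>The monoid of an adjunction\<close>

locale kcat_adjunction = source: kcategory K A + target: kcategory K B + bim_adjunction K A B f g \<eta> \<epsilon>
  for K :: "('k, 'z) ring_scheme" (structure) and A :: "('k, 'a, 'm) kcat"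
    and B :: "('k, 'b, 'n) kcat" and f :: "('k, 'b, 'n, 'a, 'm, 'x) bimod"
    and g :: "('k, 'a, 'm, 'b, 'n, 'y) bimod"
    and \<eta> :: "('a, 'a, 'm, ('b \<times> 'y \<times> 'x \<Rightarrow> 'k) set) cell"
    and \<epsilon> :: "('b, 'b, ('a \<times> 'x \<times> 'y \<Rightarrow> 'k) set, 'n) cell"
begin

sublocale f: kcat_bimodule K A B f
  by (intro kcat_bimodule.intro source.kcategory_axioms target.kcategory_axioms left_adjoint)

sublocale g: kcat_bimodule K B A g
  by (intro kcat_bimodule.intro source.kcategory_axioms target.kcategory_axioms right_adjoint)

sublocale gf: composable K A B A g f
  by (intro composable.intro f.kcat_bimodule_axioms g.kcat_bimodule_axioms)

sublocale fg: composable K B A B f g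
  by (intro composable.intro f.kcat_bimodule_axioms g.kcat_bimodule_axioms)

abbreviation "S \<equiv> tens K g f"

sublocale S: kcat_bimodule K A A S
  by (rule gf.tens_kcat_bimodule)

sublocale SS: composable K A A A S S
  by (intro composable.intro S.kcat_bimodule_axioms)

sublocale fS: composable K A A B f S
  by (intro composable.intro f.kcat_bimodule_axioms S.kcat_bimodule_axioms)

sublocale fg_f: composable K A B B "tens K f g" f
  by (intro composable.intro f.kcat_bimodule_axioms fg.tens_kcat_bimodule)

sublocale fgf: composable3 K A B A B f g f
  by (intro composable3.intro gf.composable_axioms fg.composable_axioms)

sublocale gfS: composable3 K A A B A g f S
  by (intro composable3.intro gf.composable_axioms fS.composable_axioms)

sublocale \<epsilon>f: parallel_composable K A B B "tens K f g" f "id_bimod B" f \<epsilon> id_cell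
  by (intro parallel_composable.intro parallel_composable_axioms.intro fg_f.composable_axioms
      f.left_unit.composable_axioms counit two_cell_id[OF f.bimodule_axioms])

text \<open>Written \<open>L\<close> in the comments below: the action \<open>f \<otimes> S \<rightarrow> f\<close> of the monoid
  \<open>S = g \<otimes> f\<close> on \<open>f\<close>, which sends \<open>v \<otimes> (u \<otimes> w)\<close> to \<open>\<epsilon>(v \<otimes> u) w\<close>. The multiplication
  of \<open>S\<close> is \<open>g \<otimes> L\<close> up to the associativity constraint, so its
  associativity reduces to that of this action.\<close>

definition "counit_action =
  lunit K f \<cdot>\<^sub>v hcomp K (id_bimod B) f \<epsilon> id_cell \<cdot>\<^sub>v assoc_inv K f g f"

lemma counit_action_two_cell: "two_cell K (tens K f S) f counit_action"
  unfolding counit_action_def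
  by (rule two_cell_vcomp[OF fS.tens_bimodule fg_f.tens_bimodule f.bimodule_axioms
        two_cell_vcomp[OF fg_f.tens_bimodule f.left_unit.tens_bimodule f.bimodule_axioms
          f.lunit_two_cell \<epsilon>f.hcomp_two_cell] fgf.assoc_inv_two_cell])

lemmas counit_action_hom =
  two_cellD(1)[OF fS.tens_bimodule counit_action_two_cell, unfolded tens_simps]
lemmas counit_action_natural =
  two_cellD(2)[OF fS.tens_bimodule counit_action_two_cell, unfolded tens_simps]

lemma counit_closed:
  "\<lbrakk>b \<in> Ob B; b' \<in> Ob B; a \<in> Ob A; v \<in> carrier (Val f b a); u \<in> carrier (Val g a b')\<rbrakk>
    \<Longrightarrow> \<epsilon> b b' (pure_tens K f g b b' (a, v, u)) \<in> carrier (Hom B b b')"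
  using two_cell_closed[OF fg.tens_bimodule counit, of b b'] fg.pure_tens_closed by simp

lemma counit_action_pure:
  assumes "b \<in> Ob B" "b' \<in> Ob B" "a \<in> Ob A" "a' \<in> Ob A" "v \<in> carrier (Val f b a')"
    "u \<in> carrier (Val g a' b')" "w \<in> carrier (Val f b' a)"
  shows "counit_action b a (pure_tens K f S b a (a', v, pure_tens K g f a' a (b', u, w)))
    = Act f b' b a a (\<epsilon> b b' (pure_tens K f g b b' (a', v, u))) (Idt A a) w"
  using assms unfolding counit_action_def vcomp_def
  by (simp add: fgf.assoc_inv_pure \<epsilon>f.hcomp_pure fg.pure_tens_closed f.lunit_pure counit_closed
      id_cell_apply)

text \<open>This is the triangle identity for \<open>f\<close>, evaluated at \<open>v \<otimes> 1\<close>.\<close>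

lemma counit_action_unit:
  assumes b: "b \<in> Ob B" and a: "a \<in> Ob A" and v: "v \<in> carrier (Val f b a)"
  shows "counit_action b a (pure_tens K f S b a (a, v, \<eta> a a (Idt A a))) = v"
proof -
  interpret f\<eta>: parallel_composable K A A B f "id_bimod A" f S id_cell \<eta>
    by (intro parallel_composable.intro parallel_composable_axioms.intro fS.composable_axioms
      f.right_unit.composable_axioms unit two_cell_id[OF f.bimodule_axioms])
  have mem: "pure_tens K f (id_bimod A) b a (a, v, Idt A a) \<in> carrier (Val (tens K f (id_bimod A)) b a)"
    using b a v by (simp add: f.right_unit.pure_tens_closed source.Idt_closed)
  from cell_eqD[OF f.right_unit.tens_bimodule triangle_left b a mem] show ?thesis
    using b a v
    by (simp add: counit_action_def vcomp_def f\<eta>.hcomp_pure source.Idt_closed id_cell_apply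
        f.runit_pure f.Act_Idt)
qed

abbreviation "S_mult \<equiv> adj_mult K f g \<epsilon>"

text \<open>The last three maps composed in \<^const>\<open>adj_mult\<close> are the three constituents of \<open>L\<close>, each
  tensored with \<open>g\<close>; the first one only moves the brackets.\<close>

lemma mult_two_cell: "two_cell K (tens K S S) S S_mult"
  and mult_pure: "\<And>a a' b a1 u v s. \<lbrakk>a \<in> Ob A; a' \<in> Ob A; a1 \<in> Ob A; b \<in> Ob B;
    u \<in> carrier (Val g a b); v \<in> carrier (Val f b a1); s \<in> carrier (Val S a1 a')\<rbrakk>
    \<Longrightarrow> S_mult a a' (pure_tens K S S a a' (a1, pure_tens K g f a a1 (b, u, v), s))
      = pure_tens K g f a a' (b, u, counit_action b a' (pure_tens K f S b a' (a1, v, s)))"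
proof -
  interpret c1: composable K A B A g "tens K (tens K f g) f"
    by (intro composable.intro g.kcat_bimodule_axioms fg_f.tens_kcat_bimodule)
  interpret c2: composable K A B A g "tens K (id_bimod B) f"
    by (intro composable.intro g.kcat_bimodule_axioms f.left_unit.tens_kcat_bimodule)
  interpret h1: parallel_composable K A B A g "tens K f S" g "tens K (tens K f g) f" id_cell
    "assoc_inv K f g f"
    by (intro parallel_composable.intro parallel_composable_axioms.intro gfS.right_assoc.composable_axioms
      c1.composable_axioms fgf.assoc_inv_two_cell two_cell_id[OF g.bimodule_axioms])
  interpret h2: parallel_composable K A B A g "tens K (tens K f g) f" g "tens K (id_bimod B) f" id_cell
    "hcomp K (id_bimod B) f \<epsilon> id_cell"
    by (intro parallel_composable.intro parallel_composable_axioms.intro c1.composable_axioms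
      c2.composable_axioms \<epsilon>f.hcomp_two_cell two_cell_id[OF g.bimodule_axioms])
  interpret h3: parallel_composable K A B A g "tens K (id_bimod B) f" g f id_cell "lunit K f"
    by (intro parallel_composable.intro parallel_composable_axioms.intro c2.composable_axioms
      gf.composable_axioms f.lunit_two_cell two_cell_id[OF g.bimodule_axioms])
  have Tgt_f: "Tgt f = B" by (rule f.Tgt)
  show "two_cell K (tens K S S) S S_mult"
    unfolding adj_mult_def Tgt_f
    by (rule two_cell_vcomp[OF SS.tens_bimodule gfS.right_assoc.tens_bimodule S.bimodule_axioms
          two_cell_vcomp[OF gfS.right_assoc.tens_bimodule c1.tens_bimodule S.bimodule_axioms
            two_cell_vcomp[OF c1.tens_bimodule c2.tens_bimodule S.bimodule_axioms
              h3.hcomp_two_cell h2.hcomp_two_cell] h1.hcomp_two_cell] gfS.assoc_two_cell])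
  fix a a' b a1 u v s
  assume *: "a \<in> Ob A" "a' \<in> Ob A" "a1 \<in> Ob A" "b \<in> Ob B" "u \<in> carrier (Val g a b)"
    "v \<in> carrier (Val f b a1)" "s \<in> carrier (Val S a1 a')"
  have 1: "pure_tens K f S b a' (a1, v, s) \<in> carrier (tens_val K f S b a')"
    using * by (simp add: fS.pure_tens_closed)
  note 2 = kmod_hom_closed[OF fgf.assoc_inv_hom 1] kmod_hom_closed[OF \<epsilon>f.hcomp_hom]
  show "S_mult a a' (pure_tens K S S a a' (a1, pure_tens K g f a a1 (b, u, v), s))
      = pure_tens K g f a a' (b, u, counit_action b a' (pure_tens K f S b a' (a1, v, s)))"
    unfolding adj_mult_def Tgt_f counit_action_def vcomp_def
    using * 1 2 by (simp add: gfS.assoc_pure h1.hcomp_pure h2.hcomp_pure h3.hcomp_pure id_cell_apply)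
qed

lemmas mult_hom = two_cellD(1)[OF SS.tens_bimodule mult_two_cell, unfolded tens_simps]

lemma mult_closed:
  "\<lbrakk>a \<in> Ob A; a' \<in> Ob A; a'' \<in> Ob A; s \<in> carrier (tens_val K g f a a'); t \<in> carrier (tens_val K g f a' a'')\<rbrakk>
    \<Longrightarrow> S_mult a a'' (pure_tens K S S a a'' (a', s, t)) \<in> carrier (tens_val K g f a a'')"
  using kmod_hom_closed[OF mult_hom] SS.pure_tens_closed by simp

lemmas SS_left = SS.pure_tens_left[unfolded tens_simps]
  and SS_right = SS.pure_tens_right[unfolded tens_simps]
  and fS_left = fS.pure_tens_left[unfolded tens_simps]
  and fS_right = fS.pure_tens_right[unfolded tens_simps]
  and fS_closed = fS.pure_tens_closed[unfolded tens_simps]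

text \<open>For a pure tensor \<open>s = u \<otimes> w\<close> both sides are \<open>\<epsilon>(v \<otimes> u)\<close> applied to
  \<open>L(w \<otimes> t)\<close>: on the left by the formula for \<open>L\<close>, on the right because \<open>L\<close> is natural in
  the object of \<open>B\<close>.\<close>

lemma counit_action_mult:
  assumes b: "b \<in> Ob B" and a: "a \<in> Ob A" "a' \<in> Ob A" "a1 \<in> Ob A" and v: "v \<in> carrier (Val f b a')"
    and s: "s \<in> carrier (tens_val K g f a' a1)" and t: "t \<in> carrier (tens_val K g f a1 a)"
  shows "counit_action b a (pure_tens K f S b a (a', v, S_mult a' a (pure_tens K S S a' a (a1, s, t))))
    = counit_action b a (pure_tens K f S b a
        (a1, counit_action b a1 (pure_tens K f S b a1 (a', v, s)), t))"
proof (rule gf.tens_hom_eqI[OF a(2,3) _ _ f.Val_module[OF b a(1)] s])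
  show "kmod_hom K (tens_val K g f a' a1) (Val f b a)
      (\<lambda>s. counit_action b a (pure_tens K f S b a (a', v, S_mult a' a (pure_tens K S S a' a (a1, s, t)))))"
    by (rule kmod_hom_comp[OF kmod_hom_comp[OF kmod_hom_comp[OF SS_left[OF a(2,1,3) t]
        mult_hom[OF a(2,1)]] fS_right[OF b a(1,2) v]] counit_action_hom[OF b a(1)]])
  show "kmod_hom K (tens_val K g f a' a1) (Val f b a) (\<lambda>s. counit_action b a (pure_tens K f S b a
        (a1, counit_action b a1 (pure_tens K f S b a1 (a', v, s)), t)))"
    by (rule kmod_hom_comp[OF kmod_hom_comp[OF kmod_hom_comp[OF fS_right[OF b a(3,2) v]
        counit_action_hom[OF b a(3)]] fS_left[OF b a(1,3) t]] counit_action_hom[OF b a(1)]])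
next
  fix b' u w
  assume *: "b' \<in> Ob B" "u \<in> carrier (Val g a' b')" "w \<in> carrier (Val f b' a1)"
  define e where "e = \<epsilon> b b' (pure_tens K f g b b' (a', v, u))"
  have e: "e \<in> carrier (Hom B b b')" unfolding e_def by (rule counit_closed) (use * b a v in auto)
  have wt: "pure_tens K f S b' a (a1, w, t) \<in> carrier (tens_val K f S b' a)"
    using * a t by (simp add: fS_closed)
  note La = kmod_hom_closed[OF counit_action_hom wt]
  have "counit_action b a (pure_tens K f S b a (a', v, S_mult a' a (pure_tens K S S a' a
        (a1, pure_tens K g f a' a1 (b', u, w), t))))
      = Act f b' b a a e (Idt A a) (counit_action b' a (pure_tens K f S b' a (a1, w, t)))"
    using * a b t v La by (simp add: mult_pure counit_action_pure e_def)
  also have "\<dots> = counit_action b a (Act (tens K f S) b' b a a e (Idt A a)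
      (pure_tens K f S b' a (a1, w, t)))"
    using * a b e wt source.Idt_closed by (simp add: counit_action_natural)
  also have "\<dots> = counit_action b a (pure_tens K f S b a (a1, Act f b' b a1 a1 e (Idt A a1) w, t))"
    using * a b e t by (simp add: fS.Act_tens_pure source.Idt_closed S.Act_Idt)
  also have "Act f b' b a1 a1 e (Idt A a1) w
      = counit_action b a1 (pure_tens K f S b a1 (a', v, pure_tens K g f a' a1 (b', u, w)))"
    using * a b v by (simp add: counit_action_pure e_def)
  finally show "counit_action b a (pure_tens K f S b a (a', v, S_mult a' a (pure_tens K S S a' a
        (a1, pure_tens K g f a' a1 (b', u, w), t))))
      = counit_action b a (pure_tens K f S b a (a1, counit_action b a1
          (pure_tens K f S b a1 (a', v, pure_tens K g f a' a1 (b', u, w))), t))" .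
qed

lemma mult_assoc:
  assumes a: "a \<in> Ob A" "a' \<in> Ob A" "a1 \<in> Ob A" "a2 \<in> Ob A"
    and r: "r \<in> carrier (tens_val K g f a a1)" and s: "s \<in> carrier (tens_val K g f a1 a2)"
    and t: "t \<in> carrier (tens_val K g f a2 a')"
  shows "S_mult a a' (pure_tens K S S a a' (a2, S_mult a a2 (pure_tens K S S a a2 (a1, r, s)), t))
    = S_mult a a' (pure_tens K S S a a' (a1, r, S_mult a1 a' (pure_tens K S S a1 a' (a2, s, t))))"
proof (rule gf.tens_hom_eqI[OF a(1,3) _ _ gf.tens_val_module[OF a(1,2)] r])
  have st: "S_mult a1 a' (pure_tens K S S a1 a' (a2, s, t)) \<in> carrier (tens_val K g f a1 a')"
    using a s t by (simp add: mult_closed)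
  show "kmod_hom K (tens_val K g f a a1) (tens_val K g f a a')
      (\<lambda>r. S_mult a a' (pure_tens K S S a a' (a2, S_mult a a2 (pure_tens K S S a a2 (a1, r, s)), t)))"
    by (rule kmod_hom_comp[OF kmod_hom_comp[OF kmod_hom_comp[OF SS_left[OF a(1,4,3) s]
        mult_hom[OF a(1,4)]] SS_left[OF a(1,2,4) t]] mult_hom[OF a(1,2)]])
  show "kmod_hom K (tens_val K g f a a1) (tens_val K g f a a')
      (\<lambda>r. S_mult a a' (pure_tens K S S a a' (a1, r, S_mult a1 a' (pure_tens K S S a1 a' (a2, s, t)))))"
    by (rule kmod_hom_comp[OF SS_left[OF a(1,2,3) st] mult_hom[OF a(1,2)]])
  fix b u v assume *: "b \<in> Ob B" "u \<in> carrier (Val g a b)" "v \<in> carrier (Val f b a1)"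
  have "counit_action b a2 (pure_tens K f S b a2 (a1, v, s)) \<in> carrier (Val f b a2)"
    using kmod_hom_closed[OF counit_action_hom fS_closed] * a s by blast
  then show "S_mult a a' (pure_tens K S S a a' (a2, S_mult a a2 (pure_tens K S S a a2
        (a1, pure_tens K g f a a1 (b, u, v), s)), t))
      = S_mult a a' (pure_tens K S S a a' (a1, pure_tens K g f a a1 (b, u, v),
          S_mult a1 a' (pure_tens K S S a1 a' (a2, s, t))))"
    using * a s t st by (simp add: mult_pure counit_action_mult)
qed

text \<open>The map \<open>N \<rightarrow> S \<otimes> N\<close> given by the unit becomes a split monomorphism after tensoring with
  \<open>f\<close>: the composite of \<open>f \<otimes> (S \<otimes> N) \<rightarrow> (f \<otimes> S) \<otimes> N\<close> with \<open>L \<otimes> N\<close> sends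
  \<open>v \<otimes> (\<eta>(1) \<otimes> X)\<close> to \<open>L(v \<otimes> \<eta>(1)) \<otimes> X = v \<otimes> X\<close>.\<close>

lemma tens_unit_zero_imp_tens_zero:
  assumes N: "kcat_bimodule K A A N" and b: "b \<in> Ob B" and a: "a \<in> Ob A" "a' \<in> Ob A"
    and v: "v \<in> carrier (Val f b a)" and X: "X \<in> carrier (Val N a a')"
    and zero: "pure_tens K S N a a' (a, \<eta> a a (Idt A a), X) = \<zero>\<^bsub>tens_val K S N a a'\<^esub>"
  shows "pure_tens K f N b a' (a, v, X) = \<zero>\<^bsub>tens_val K f N b a'\<^esub>"
proof -
  interpret N: kcat_bimodule K A A N by (rule N)
  interpret fN: composable K A A B f N
    by (intro composable.intro f.kcat_bimodule_axioms N)
  interpret SN: composable K A A A S N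
    by (intro composable.intro S.kcat_bimodule_axioms N)
  interpret fSN: composable3 K A A A B f S N
    by (intro composable3.intro fS.composable_axioms SN.composable_axioms)
  interpret LN: parallel_composable K A A B "tens K f S" N f N counit_action id_cell
    by (intro parallel_composable.intro parallel_composable_axioms.intro fSN.left_assoc.composable_axioms
      fN.composable_axioms counit_action_two_cell two_cell_id[OF N.bimodule_axioms])
  let ?E = "\<lambda>Z. hcomp K f N counit_action id_cell b a' (assoc_inv K f S N b a' Z)"
  have \<eta>: "\<eta> a a (Idt A a) \<in> carrier (tens_val K g f a a)"
    using two_cell_closed[OF source.id_bimod_bimodule unit a(1,1)] source.Idt_closed[OF a(1)] by simp
  have E: "kmod_hom K (tens_val K f (tens K S N) b a') (tens_val K f N b a') ?E"
    by (rule kmod_hom_comp[OF fSN.assoc_inv_hom[OF b a(2)] LN.hcomp_hom[OF b a(2)]])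
  have "?E (pure_tens K f (tens K S N) b a' (a, v, pure_tens K S N a a' (a, \<eta> a a (Idt A a), X)))
      = pure_tens K f N b a' (a, v, X)"
    using a b v X \<eta> by (simp add: fSN.assoc_inv_pure LN.hcomp_pure fS_closed counit_action_unit id_cell_apply)
  moreover have "pure_tens K f (tens K S N) b a' (a, v, \<zero>\<^bsub>tens_val K S N a a'\<^esub>)
      = \<zero>\<^bsub>tens_val K f (tens K S N) b a'\<^esub>"
    using kmod_hom_zero[OF fSN.right_assoc.pure_tens_right[OF b a(2,1) v]] SN.tens_val_module[OF a]
      fSN.right_assoc.tens_val_module[OF b a(2)] by simp
  ultimately show ?thesis
    using zero kmod_hom_zero[OF E fSN.right_assoc.tens_val_module[OF b a(2)] fN.tens_val_module[OF b a(2)]]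
    by simp
qed

end

section \<open>The product of two left subobjects\<close>

locale left_subobject_pair = kcat_adjunction K A B f g \<eta> \<epsilon>
  for K :: "('k, 'z) ring_scheme" (structure) and A :: "('k, 'a, 'm) kcat"
    and B :: "('k, 'b, 'n) kcat" and f :: "('k, 'b, 'n, 'a, 'm, 'x) bimod"
    and g :: "('k, 'a, 'm, 'b, 'n, 'y) bimod"
    and \<eta> :: "('a, 'a, 'm, ('b \<times> 'y \<times> 'x \<Rightarrow> 'k) set) cell"
    and \<epsilon> :: "('b, 'b, ('a \<times> 'x \<times> 'y \<Rightarrow> 'k) set, 'n) cell" +
  fixes I :: "('k, 'a, 'm, 'a, 'm, 'i) bimod" and i
    and J :: "('k, 'a, 'm, 'a, 'm, 'j) bimod" and j
  assumes I: "(I, i) \<in> left_subobjects K f g \<epsilon>" and J: "(J, j) \<in> left_subobjects K f g \<epsilon>"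
begin

sublocale I: kcat_bimodule K A A I
  using I source.kcategory_axioms by (auto simp: left_subobjects_def f.Src intro: kcat_bimodule.intro)

sublocale J: kcat_bimodule K A A J
  using J source.kcategory_axioms by (auto simp: left_subobjects_def f.Src intro: kcat_bimodule.intro)

lemma i: "two_cell K I S i" and j: "two_cell K J S j"
  using I J by (auto simp: left_subobjects_def mono_cell_def)

sublocale IJ: composable K A A A I J
  by (intro composable.intro I.kcat_bimodule_axioms J.kcat_bimodule_axioms)

sublocale SI: composable K A A A S I
  by (intro composable.intro I.kcat_bimodule_axioms S.kcat_bimodule_axioms)

sublocale SJ: composable K A A A S J
  by (intro composable.intro J.kcat_bimodule_axioms S.kcat_bimodule_axioms)

sublocale SIJ: composable3 K A A A A S I J
  by (intro composable3.intro SI.composable_axioms IJ.composable_axioms)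

sublocale ij: parallel_composable K A A A I J S S i j
  by (intro parallel_composable.intro parallel_composable_axioms.intro i j IJ.composable_axioms
      SS.composable_axioms)

sublocale Si: parallel_composable K A A A S I S S id_cell i
  by (intro parallel_composable.intro parallel_composable_axioms.intro i SI.composable_axioms
      SS.composable_axioms two_cell_id[OF S.bimodule_axioms])

sublocale Sj: parallel_composable K A A A S J S S id_cell j
  by (intro parallel_composable.intro parallel_composable_axioms.intro j SJ.composable_axioms
      SS.composable_axioms two_cell_id[OF S.bimodule_axioms])

abbreviation "prod_map \<equiv> subobj_mult K f g \<epsilon> i j"

lemma prod_map_two_cell: "two_cell K (tens K I J) S prod_map"
  unfolding subobj_mult_def
  by (rule two_cell_vcomp[OF IJ.tens_bimodule SS.tens_bimodule S.bimodule_axioms mult_two_cell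
        ij.hcomp_two_cell])

lemmas prod_map_hom = two_cellD(1)[OF IJ.tens_bimodule prod_map_two_cell, unfolded tens_simps]

lemmas i_closed = two_cell_closed[OF I.bimodule_axioms i, unfolded tens_simps]
  and j_closed = two_cell_closed[OF J.bimodule_axioms j, unfolded tens_simps]

lemma prod_map_pure:
  "\<lbrakk>a \<in> Ob A; a' \<in> Ob A; a1 \<in> Ob A; p \<in> carrier (Val I a a1); q \<in> carrier (Val J a1 a')\<rbrakk>
    \<Longrightarrow> prod_map a a' (pure_tens K I J a a' (a1, p, q))
      = S_mult a a' (pure_tens K S S a a' (a1, i a a1 p, j a1 a' q))"
  by (simp add: subobj_mult_def vcomp_def ij.hcomp_pure)

abbreviation "left_mult_I \<equiv> S_mult \<cdot>\<^sub>v hcomp K S S id_cell i"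
abbreviation "left_mult_J \<equiv> S_mult \<cdot>\<^sub>v hcomp K S S id_cell j"

lemma left_mult_two_cells:
  "two_cell K (tens K S I) S left_mult_I" "two_cell K (tens K S J) S left_mult_J"
  using I J by (auto simp: left_subobjects_def iso_cell_def)

sublocale mI: parallel_composable K A A A "tens K S I" J S J left_mult_I id_cell
  by (intro parallel_composable.intro parallel_composable_axioms.intro SIJ.left_assoc.composable_axioms
      SJ.composable_axioms left_mult_two_cells two_cell_id[OF J.bimodule_axioms])

lemma left_mult_pure:
  "\<lbrakk>a \<in> Ob A; a' \<in> Ob A; a1 \<in> Ob A; s \<in> carrier (tens_val K g f a a1); p \<in> carrier (Val I a1 a')\<rbrakk>
    \<Longrightarrow> left_mult_I a a' (pure_tens K S I a a' (a1, s, p))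
      = S_mult a a' (pure_tens K S S a a' (a1, s, i a1 a' p))"
  "\<lbrakk>a \<in> Ob A; a' \<in> Ob A; a1 \<in> Ob A; s \<in> carrier (tens_val K g f a a1); q \<in> carrier (Val J a1 a')\<rbrakk>
    \<Longrightarrow> left_mult_J a a' (pure_tens K S J a a' (a1, s, q))
      = S_mult a a' (pure_tens K S S a a' (a1, s, j a1 a' q))"
  by (simp_all add: vcomp_def Si.hcomp_pure Sj.hcomp_pure id_cell_apply)

text \<open>The composite \<open>S \<otimes> (I \<otimes> J) \<rightarrow> (S \<otimes> I) \<otimes> J \<rightarrow> S \<otimes> J \<rightarrow> S\<close> of isomorphisms: the
  last two come from the isomorphisms that make \<open>I\<close> and \<open>J\<close> left subobjects.\<close>

definition "iterated_mult a a' Z =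
  left_mult_J a a' (hcomp K S J left_mult_I id_cell a a' (assoc_inv K S I J a a' Z))"

lemma iterated_mult_hom:
  assumes "a \<in> Ob A" "a' \<in> Ob A"
  shows "kmod_hom K (tens_val K S (tens K I J) a a') (tens_val K g f a a') (iterated_mult a a')"
  unfolding iterated_mult_def
  using kmod_hom_comp[OF kmod_hom_comp[OF SIJ.assoc_inv_hom[OF assms] mI.hcomp_hom[OF assms]]
      two_cellD(1)[OF SJ.tens_bimodule left_mult_two_cells(2) assms, unfolded tens_simps]] .

text \<open>By associativity of the multiplication, \<open>(s i(p)) j(q) = s (i(p) j(q))\<close>.\<close>

lemma iterated_mult_pure:
  assumes a: "a \<in> Ob A" "a' \<in> Ob A" "a1 \<in> Ob A" and s: "s \<in> carrier (tens_val K g f a a1)"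
    and X: "X \<in> carrier (tens_val K I J a1 a')"
  shows "iterated_mult a a' (pure_tens K S (tens K I J) a a' (a1, s, X))
    = S_mult a a' (pure_tens K S S a a' (a1, s, prod_map a1 a' X))"
proof (rule IJ.tens_hom_eqI[OF a(3,2) _ _ gf.tens_val_module[OF a(1,2)] X])
  show "kmod_hom K (tens_val K I J a1 a') (tens_val K g f a a')
      (\<lambda>X. iterated_mult a a' (pure_tens K S (tens K I J) a a' (a1, s, X)))"
    using kmod_hom_comp[OF SIJ.right_assoc.pure_tens_right[OF a] iterated_mult_hom[OF a(1,2)]] s by simp
  show "kmod_hom K (tens_val K I J a1 a') (tens_val K g f a a')
      (\<lambda>X. S_mult a a' (pure_tens K S S a a' (a1, s, prod_map a1 a' X)))"
    by (rule kmod_hom_comp[OF kmod_hom_comp[OF prod_map_hom[OF a(3,2)] SS_right[OF a s]] mult_hom[OF a(1,2)]])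
  fix a2 p q assume *: "a2 \<in> Ob A" "p \<in> carrier (Val I a1 a2)" "q \<in> carrier (Val J a2 a')"
  have sip: "S_mult a a2 (pure_tens K S S a a2 (a1, s, i a1 a2 p)) \<in> carrier (tens_val K g f a a2)"
    using * a s by (simp add: mult_closed i_closed)
  have "iterated_mult a a' (pure_tens K S (tens K I J) a a' (a1, s, pure_tens K I J a1 a' (a2, p, q)))
      = left_mult_J a a' (pure_tens K S J a a' (a2, left_mult_I a a2 (pure_tens K S I a a2 (a1, s, p)), q))"
    unfolding iterated_mult_def
    using * a s by (simp add: SIJ.assoc_inv_pure mI.hcomp_pure SI.pure_tens_closed id_cell_apply)
  also have "\<dots> = S_mult a a' (pure_tens K S S a a'
      (a2, S_mult a a2 (pure_tens K S S a a2 (a1, s, i a1 a2 p)), j a2 a' q))"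
    using * a s sip by (simp add: left_mult_pure)
  also have "\<dots> = S_mult a a' (pure_tens K S S a a'
      (a1, s, S_mult a1 a' (pure_tens K S S a1 a' (a2, i a1 a2 p, j a2 a' q))))"
    using * a s by (intro mult_assoc i_closed j_closed)
  finally show "iterated_mult a a' (pure_tens K S (tens K I J) a a' (a1, s, pure_tens K I J a1 a' (a2, p, q)))
      = S_mult a a' (pure_tens K S S a a' (a1, s, prod_map a1 a' (pure_tens K I J a1 a' (a2, p, q))))"
    using * a by (simp add: prod_map_pure)
qed

text \<open>Each of the three maps has a left inverse; these are applied one after the other.\<close>

lemma iterated_mult_eq_zero:
  assumes a: "a \<in> Ob A" "a' \<in> Ob A" and Z: "Z \<in> carrier (tens_val K S (tens K I J) a a')"
    and zero: "iterated_mult a a' Z = \<zero>\<^bsub>tens_val K g f a a'\<^esub>"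
  shows "Z = \<zero>\<^bsub>tens_val K S (tens K I J) a a'\<^esub>"
proof -
  from I obtain \<sigma> where \<sigma>: "two_cell K S (tens K S I) \<sigma>" "cell_eq (tens K S I) (\<sigma> \<cdot>\<^sub>v left_mult_I) id_cell"
    by (auto simp: left_subobjects_def iso_cell_def)
  from J obtain \<rho> where \<rho>: "two_cell K S (tens K S J) \<rho>" "cell_eq (tens K S J) (\<rho> \<cdot>\<^sub>v left_mult_J) id_cell"
    by (auto simp: left_subobjects_def iso_cell_def)
  have \<sigma>_inv: "\<sigma> a a1 (left_mult_I a a1 Y) = Y"
    if "a1 \<in> Ob A" "Y \<in> carrier (tens_val K S I a a1)" for a1 Y
    using cell_eqD[OF SI.tens_bimodule \<sigma>(2) a(1) that(1)] that(2) by (simp add: vcomp_def id_cell_apply)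
  have \<rho>_inv: "\<rho> a a' (left_mult_J a a' Y) = Y" if "Y \<in> carrier (tens_val K S J a a')" for Y
    using cell_eqD[OF SJ.tens_bimodule \<rho>(2) a] that by (simp add: vcomp_def id_cell_apply)
  interpret \<sigma>J: parallel_composable K A A A S J "tens K S I" J \<sigma> id_cell
    by (intro parallel_composable.intro parallel_composable_axioms.intro SIJ.left_assoc.composable_axioms
      SJ.composable_axioms \<sigma>(1) two_cell_id[OF J.bimodule_axioms])
  define W where "W = assoc_inv K S I J a a' Z"
  have W: "W \<in> carrier (tens_val K (tens K S I) J a a')"
    unfolding W_def by (rule kmod_hom_closed[OF SIJ.assoc_inv_hom[OF a] Z])
  define V where "V = hcomp K S J left_mult_I id_cell a a' W"
  have V: "V \<in> carrier (tens_val K S J a a')"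
    unfolding V_def by (rule kmod_hom_closed[OF mI.hcomp_hom[OF a] W])
  have "V = \<rho> a a' \<zero>\<^bsub>tens_val K g f a a'\<^esub>"
    using \<rho>_inv[OF V] zero by (simp add: iterated_mult_def W_def V_def)
  also have "\<dots> = \<zero>\<^bsub>tens_val K S J a a'\<^esub>"
    using kmod_hom_zero[OF two_cellD(1)[OF S.bimodule_axioms \<rho>(1) a]] gf.tens_val_module[OF a]
      SJ.tens_val_module[OF a] by simp
  finally have V0: "V = \<zero>\<^bsub>tens_val K S J a a'\<^esub>" .
  have "hcomp K (tens K S I) J \<sigma> id_cell a a' V = W"
    unfolding V_def
  proof (rule SIJ.left_assoc_hom_eqI[OF a kmod_hom_comp[OF mI.hcomp_hom[OF a] \<sigma>J.hcomp_hom[OF a]] _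
        SIJ.left_assoc.tens_val_module[OF a] W])
    fix a1 Y q assume *: "a1 \<in> Ob A" "Y \<in> carrier (tens_val K S I a a1)" "q \<in> carrier (Val J a1 a')"
    then have "left_mult_I a a1 Y \<in> carrier (tens_val K g f a a1)"
      using two_cell_closed[OF SI.tens_bimodule left_mult_two_cells(1) a(1)] by simp
    with * a show "hcomp K (tens K S I) J \<sigma> id_cell a a' (hcomp K S J left_mult_I id_cell a a'
        (pure_tens K (tens K S I) J a a' (a1, Y, q))) = pure_tens K (tens K S I) J a a' (a1, Y, q)"
      by (simp add: mI.hcomp_pure \<sigma>J.hcomp_pure \<sigma>_inv id_cell_apply)
  qed (auto intro: kmod_homI)
  then have "W = \<zero>\<^bsub>tens_val K (tens K S I) J a a'\<^esub>"
    using kmod_hom_zero[OF \<sigma>J.hcomp_hom[OF a] SJ.tens_val_module[OF a] SIJ.left_assoc.tens_val_module[OF a]]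
    by (simp add: V0)
  then show ?thesis
    using SIJ.assoc_assoc_inv[OF a Z] kmod_hom_zero[OF SIJ.assoc_hom[OF a] SIJ.left_assoc.tens_val_module[OF a]
        SIJ.right_assoc.tens_val_module[OF a]]
    by (simp add: W_def)
qed

text \<open>If the product map kills \<open>X\<close>, then the iterated multiplication, which sends
  \<open>\<eta>(1) \<otimes> X\<close> to the product of \<open>\<eta>(1)\<close> with the image of \<open>X\<close>, kills \<open>\<eta>(1) \<otimes> X\<close>. It
  is injective, so \<open>\<eta>(1) \<otimes> X = 0\<close>.\<close>

lemma tens_zero_of_prod_map_zero:
  assumes b: "b \<in> Ob B" and a: "a \<in> Ob A" "a' \<in> Ob A" and v: "v \<in> carrier (Val f b a)"
    and X: "X \<in> carrier (tens_val K I J a a')" and zero: "prod_map a a' X = \<zero>\<^bsub>tens_val K g f a a'\<^esub>"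
  shows "pure_tens K f (tens K I J) b a' (a, v, X) = \<zero>\<^bsub>tens_val K f (tens K I J) b a'\<^esub>"
proof (rule tens_unit_zero_imp_tens_zero[OF IJ.tens_kcat_bimodule b a v])
  have \<eta>: "\<eta> a a (Idt A a) \<in> carrier (tens_val K g f a a)"
    using two_cell_closed[OF source.id_bimod_bimodule unit a(1,1)] source.Idt_closed[OF a(1)] by simp
  have "iterated_mult a a' (pure_tens K S (tens K I J) a a' (a, \<eta> a a (Idt A a), X))
      = S_mult a a' (pure_tens K S S a a' (a, \<eta> a a (Idt A a), \<zero>\<^bsub>tens_val K g f a a'\<^esub>))"
    using iterated_mult_pure[OF a a(1) \<eta> X] zero by simp
  also have "\<dots> = \<zero>\<^bsub>tens_val K g f a a'\<^esub>"
    using kmod_hom_zero[OF kmod_hom_comp[OF SS_right[OF a a(1) \<eta>] mult_hom[OF a]]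
        gf.tens_val_module[OF a] gf.tens_val_module[OF a]] .
  finally show "pure_tens K S (tens K I J) a a' (a, \<eta> a a (Idt A a), X)
      = \<zero>\<^bsub>tens_val K S (tens K I J) a a'\<^esub>"
    using SIJ.right_assoc.pure_tens_closed[OF a a(1)] \<eta> X by (intro iterated_mult_eq_zero a) simp_all
qed (use X in simp)

end

section \<open>Tensor products inside the universe\<close>

lemma infinite_pair_injection:
  obtains p :: "'u::infinite \<times> 'u \<Rightarrow> 'u" where "inj p"
proof -
  obtain p :: "'u \<times> 'u \<Rightarrow> 'u" where "bij_betw p (UNIV \<times> UNIV) UNIV"
    using card_of_Times_same_infinite[OF infinite_UNIV] card_of_ordIso by blast
  then show thesis using that by (auto simp: bij_betw_def)
qed

text \<open>Folding a pairing function is injective on lists of equal length, so the length is stored as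
  well.\<close>

lemma infinite_list_injection:
  obtains c :: "'u::infinite list \<Rightarrow> 'u" where "inj c"
proof -
  obtain p :: "'u \<times> 'u \<Rightarrow> 'u" where p: "inj p" by (rule infinite_pair_injection)
  obtain n :: "nat \<Rightarrow> 'u" where n: "inj n"
    using infinite_countable_subset[OF infinite_UNIV] by blast
  (* n 0 is an arbitrary end marker: the lists compared below have equal length. *)
  define d where "d xs = foldr (\<lambda>x y. p (x, y)) xs (n 0)" for xs
  have d: "xs = ys" if "length xs = length ys" "d xs = d ys" for xs ys
    using that by (induction xs ys rule: list_induct2) (auto simp: d_def dest: injD[OF p])
  have "inj (\<lambda>xs. p (n (length xs), d xs))"
    by (rule injI) (auto dest!: injD[OF p] injD[OF n] intro: d)
  then show thesis by (rule that)
qed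

text \<open>Every tensor is the sum of a list of triples, so there are no more tensors than elements of the
  infinite type.\<close>

lemma tens_val_injection:
  fixes \<phi> :: "('k, 'c, 'l, 'u::infinite, 'n, 'u) bimod" and \<psi> :: "('k, 'u, 'n, 'a, 'm, 'u) bimod"
  assumes "composable K A B C \<phi> \<psi>" and "c \<in> Ob C" and "a \<in> Ob A"
  obtains e :: "('u \<times> 'u \<times> 'u \<Rightarrow> 'k) set \<Rightarrow> 'u" where "inj_on e (carrier (tens_val K \<phi> \<psi> c a))"
proof -
  interpret composable K A B C \<phi> \<psi> by fact
  let ?Q = "tens_val K \<phi> \<psi> c a"
  let ?s = "\<lambda>ts. foldr (\<lambda>t X. X \<oplus>\<^bsub>?Q\<^esub> pure_tens K \<phi> \<psi> c a t) ts \<zero>\<^bsub>?Q\<^esub>"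
  obtain p :: "'u \<times> 'u \<Rightarrow> 'u" where p: "inj p" by (rule infinite_pair_injection)
  obtain l :: "'u list \<Rightarrow> 'u" where l: "inj l" by (rule infinite_list_injection)
  define t :: "'u \<times> 'u \<times> 'u \<Rightarrow> 'u" where "t = (\<lambda>(b, x, y). p (b, p (x, y)))"
  have t: "inj t" by (rule injI) (auto simp: t_def dest!: injD[OF p])
  have "\<exists>ts. X = ?s ts" if "X \<in> carrier ?Q" for X
    using assms(2,3) that
  proof (induction X rule: tens_sum_induct)
    case zero
    show ?case by (rule exI[of _ "[]"]) simp
  next
    case (add X b x y)
    then obtain ts where "X = ?s ts" by blast
    then show ?case by (intro exI[of _ "(b, x, y) # ts"]) simp
  qed
  then have "carrier ?Q \<subseteq> ?s ` UNIV" by blast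
  then have "inj_on (inv_into UNIV ?s) (carrier ?Q)" by (rule inj_on_inv_into)
  moreover have lt: "inj (l \<circ> map t)" using l t by (intro inj_compose) auto
  ultimately have "inj_on ((l \<circ> map t) \<circ> inv_into UNIV ?s) (carrier ?Q)"
    by (rule comp_inj_on[OF _ inj_on_subset[OF _ subset_UNIV]])
  then show thesis by (rule that)
qed

text \<open>The module structure on the image of \<open>e\<close> that makes \<open>e\<close> an isomorphism, provided that
  \<open>e\<close> is injective on the carrier.\<close>

definition transport_module :: "('m \<Rightarrow> 'n) \<Rightarrow> ('k, 'm) module \<Rightarrow> ('k, 'n) module" where
  "transport_module e M = (let d = inv_into (carrier M) e in
     \<lparr>carrier = e ` carrier M, mult = undefined, one = undefined, zero = e \<zero>\<^bsub>M\<^esub>,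
      add = (\<lambda>x y. e (d x \<oplus>\<^bsub>M\<^esub> d y)), smult = (\<lambda>k x. e (k \<odot>\<^bsub>M\<^esub> d x))\<rparr>)"

lemma
  assumes M: "module K M" and e: "inj_on e (carrier M)"
  shows transport_module_module: "module K (transport_module e M)"
    and transport_module_hom: "kmod_hom K M (transport_module e M) e"
    and transport_module_inv_hom: "kmod_hom K (transport_module e M) M (inv_into (carrier M) e)"
proof -
  interpret module K M by (rule M)
  have d: "inv_into (carrier M) e (e x) = x" if "x \<in> carrier M" for x
    using inv_into_f_f[OF e that] .
  have car: "carrier (transport_module e M) = e ` carrier M"
    and zero: "\<zero>\<^bsub>transport_module e M\<^esub> = e \<zero>\<^bsub>M\<^esub>"
    by (simp_all add: transport_module_def Let_def)
  have add: "e x \<oplus>\<^bsub>transport_module e M\<^esub> e y = e (x \<oplus>\<^bsub>M\<^esub> y)"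
    if "x \<in> carrier M" "y \<in> carrier M" for x y
    using that by (simp add: transport_module_def Let_def d)
  have smult: "k \<odot>\<^bsub>transport_module e M\<^esub> e x = e (k \<odot>\<^bsub>M\<^esub> x)" if "x \<in> carrier M" for k x
    using that by (simp add: transport_module_def Let_def d)
  show "kmod_hom K M (transport_module e M) e"
    by (rule kmod_homI) (simp_all add: car add smult)
  show "kmod_hom K (transport_module e M) M (inv_into (carrier M) e)"
    by (rule kmod_homI) (auto simp: car add smult d)
  show "module K (transport_module e M)"
  proof (rule moduleI)
    show "abelian_group (transport_module e M)"
    proof (rule abelian_groupI)
      fix X assume "X \<in> carrier (transport_module e M)"
      then obtain x where x: "x \<in> carrier M" "X = e x" by (auto simp: car)
      then have "e (\<ominus>\<^bsub>M\<^esub> x) \<oplus>\<^bsub>transport_module e M\<^esub> X = \<zero>\<^bsub>transport_module e M\<^esub>"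
        by (simp add: add zero M.l_neg)
      with x show "\<exists>Y\<in>carrier (transport_module e M).
          Y \<oplus>\<^bsub>transport_module e M\<^esub> X = \<zero>\<^bsub>transport_module e M\<^esub>" by (auto simp: car)
    qed (auto simp: car zero add M.a_ac)
  qed (auto simp: car zero add smult smult_l_distr smult_r_distr smult_assoc1 intro: R.is_cring)
qed

definition transport_bimod ::
  "('b \<Rightarrow> 'a \<Rightarrow> 'x \<Rightarrow> 'y) \<Rightarrow> ('k, 'b, 'n, 'a, 'm, 'x) bimod \<Rightarrow> ('k, 'b, 'n, 'a, 'm, 'y) bimod" where
  "transport_bimod e \<phi> = \<lparr>Src = Src \<phi>, Tgt = Tgt \<phi>,
     Val = (\<lambda>b a. transport_module (e b a) (Val \<phi> b a)),
     Act = (\<lambda>b b' a a' \<beta> \<alpha> x.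
       e b' a' (Act \<phi> b b' a a' \<beta> \<alpha> (inv_into (carrier (Val \<phi> b a)) (e b a) x)))\<rparr>"

lemma transport_bimod_simps [simp]:
  "Src (transport_bimod e \<phi>) = Src \<phi>" "Tgt (transport_bimod e \<phi>) = Tgt \<phi>"
  "Val (transport_bimod e \<phi>) b a = transport_module (e b a) (Val \<phi> b a)"
  by (simp_all add: transport_bimod_def)

lemma transport_bimod:
  assumes "bimodule K A B \<phi>"
    and e: "\<And>b a. \<lbrakk>b \<in> Ob B; a \<in> Ob A\<rbrakk> \<Longrightarrow> inj_on (e b a) (carrier (Val \<phi> b a))"
  shows "bimodule K A B (transport_bimod e \<phi>)" and "two_cell K \<phi> (transport_bimod e \<phi>) e"
proof -
  interpret bimodule K A B \<phi> by fact
  note hom = transport_module_hom[OF Val_module e]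
  note inv_hom = transport_module_inv_hom[OF Val_module e]
  have Act: "Act (transport_bimod e \<phi>) b b' a a' \<beta> \<alpha>
      = (\<lambda>x. e b' a' (Act \<phi> b b' a a' \<beta> \<alpha> (inv_into (carrier (Val \<phi> b a)) (e b a) x)))"
    for b b' a a' \<beta> \<alpha> by (simp add: transport_bimod_def)
  have d: "inv_into (carrier (Val \<phi> b a)) (e b a) (e b a x) = x"
    if "b \<in> Ob B" "a \<in> Ob A" "x \<in> carrier (Val \<phi> b a)" for b a x
    using inv_into_f_f[OF e] that by blast
  have car: "carrier (transport_module (e b a) (Val \<phi> b a)) = e b a ` carrier (Val \<phi> b a)" for b a
    by (simp add: transport_module_def Let_def)
  have cl: "Act \<phi> b b' a a' \<beta> \<alpha> x \<in> carrier (Val \<phi> b' a')"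
    if "b \<in> Ob B" "b' \<in> Ob B" "a \<in> Ob A" "a' \<in> Ob A" "\<beta> \<in> carrier (Hom B b' b)"
      "\<alpha> \<in> carrier (Hom A a a')" "x \<in> carrier (Val \<phi> b a)" for b b' a a' \<beta> \<alpha> x
    using kmod_hom_closed[OF Act_linear] that by blast
  show bim: "bimodule K A B (transport_bimod e \<phi>)"
    by (rule bimodule.intro; (unfold transport_bimod_simps Act)?)
      (auto simp: Src Tgt car d cl Act_Idt Act_Comp
        intro: transport_module_module Val_module e
          kmod_hom_comp[OF kmod_hom_comp[OF inv_hom Act_linear] hom]
          kmod_hom_comp[OF Act_linear_left hom] kmod_hom_comp[OF Act_linear_right hom])
  show "two_cell K \<phi> (transport_bimod e \<phi>) e"
    by (rule two_cellI[OF bimodule_axioms bim]) (simp_all add: Act hom d)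
qed

section \<open>Columns of a bimodule\<close>

text \<open>The presheaf \<open>\<phi>(-,a)\<close> as a bimodule with source \<^const>\<open>unit_kcat\<close>, whose arrows are the
  scalars. The column of the identity bimodule at \<open>a\<close> is the representable presheaf.\<close>

definition column ::
  "('k, 'z) ring_scheme \<Rightarrow> ('k, 'b, 'n, 'a, 'm, 'x) bimod \<Rightarrow> 'a \<Rightarrow> ('k, 'b, 'n, unit, 'k, 'x) bimod" where
  "column K \<phi> a = \<lparr>Src = unit_kcat K, Tgt = Tgt \<phi>, Val = (\<lambda>b _. Val \<phi> b a),
     Act = (\<lambda>b b' _ _ \<beta> k x. k \<odot>\<^bsub>Val \<phi> b' a\<^esub> Act \<phi> b b' a a \<beta> (Idt (Src \<phi>) a) x)\<rparr>"

lemma unit_kcat_simps [simp]: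
  "Ob (unit_kcat K) = {()}" "Hom (unit_kcat K) s t = self_module K"
  "Comp (unit_kcat K) s t r k l = k \<otimes>\<^bsub>K\<^esub> l" "Idt (unit_kcat K) s = \<one>\<^bsub>K\<^esub>"
  by (simp_all add: unit_kcat_def)

lemma self_module_simps [simp]:
  "carrier (self_module K) = carrier K" "zero (self_module K) = \<zero>\<^bsub>K\<^esub>"
  "add (self_module K) = add K" "smult (self_module K) = mult K"
  by (simp_all add: self_module_def)

lemma self_module_module:
  assumes "cring K"
  shows "module K (self_module K)"
proof -
  interpret cring K by fact
  show ?thesis
  proof (rule moduleI)
    show "abelian_group (self_module K)"
      by (rule abelian_groupI) (auto simp: a_ac intro!: bexI[of _ "\<ominus>\<^bsub>K\<^esub> _"] l_neg)
  qed (auto simp: l_distr r_distr m_assoc intro: is_cring)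
qed

lemma unit_kcat_kcategory:
  assumes "cring K"
  shows "kcategory K (unit_kcat K)"
proof -
  interpret cring K by fact
  show ?thesis
    by (intro kcategory.intro kcategory_axioms.intro is_cring)
      (auto simp: self_module_module[OF assms] l_distr r_distr m_assoc m_lcomm intro!: kmod_homI)
qed

context kcat_bimodule
begin

lemma column_simps [simp]:
  "Src (column K \<phi> a) = unit_kcat K" "Tgt (column K \<phi> a) = B" "Val (column K \<phi> a) b s = Val \<phi> b a"
  "Act (column K \<phi> a) b b' s s' \<beta> k x = k \<odot>\<^bsub>Val \<phi> b' a\<^esub> Act \<phi> b b' a a \<beta> (Idt A a) x"
  by (simp_all add: column_def Src Tgt)

lemma column_bimodule:
  assumes a: "a \<in> Ob A"
  shows "bimodule K (unit_kcat K) B (column K \<phi> a)"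
proof -
  have 1: "Idt A a \<in> carrier (Hom A a a)" by (rule source.Idt_closed[OF a])
  have smult_hom: "kmod_hom K (Val \<phi> b a) (Val \<phi> b a) (\<lambda>x. k \<odot>\<^bsub>Val \<phi> b a\<^esub> x)"
    if "b \<in> Ob B" "k \<in> carrier K" for b k
  proof -
    interpret V: module K "Val \<phi> b a" by (rule Val_module[OF that(1) a])
    show ?thesis using that(2)
      by (intro kmod_homI) (auto simp: V.smult_r_distr V.smult_assoc1[symmetric] source.m_comm)
  qed
  have scalar_hom: "kmod_hom K (self_module K) (Val \<phi> b a) (\<lambda>k. k \<odot>\<^bsub>Val \<phi> b a\<^esub> x)"
    if "b \<in> Ob B" "x \<in> carrier (Val \<phi> b a)" for b x
  proof -
    interpret V: module K "Val \<phi> b a" by (rule Val_module[OF that(1) a])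
    show ?thesis using that(2)
      by (intro kmod_homI) (auto simp: V.smult_l_distr V.smult_assoc1)
  qed
  have Act_column: "Act (column K \<phi> a) b b' s s' \<beta> k
      = (\<lambda>x. k \<odot>\<^bsub>Val \<phi> b' a\<^esub> Act \<phi> b b' a a \<beta> (Idt A a) x)" for b b' s s' \<beta> k
    by (rule ext) simp
  show ?thesis
  proof (rule bimodule.intro)
    fix b b' b'' s s' s'' \<beta> \<beta>' k k' x
    assume "b \<in> Ob B" "b' \<in> Ob B" "b'' \<in> Ob B" "\<beta> \<in> carrier (Hom B b' b)"
      "\<beta>' \<in> carrier (Hom B b'' b')" "k \<in> carrier (Hom (unit_kcat K) s s')"
      "k' \<in> carrier (Hom (unit_kcat K) s' s'')" "x \<in> carrier (Val (column K \<phi> a) b s)"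
    note * = this[simplified]
    interpret V: module K "Val \<phi> b'' a" by (rule Val_module[OF *(3) a])
    show "Act (column K \<phi> a) b b'' s s'' (Comp B b'' b' b \<beta> \<beta>') (Comp (unit_kcat K) s s' s'' k' k) x
        = Act (column K \<phi> a) b' b'' s' s'' \<beta>' k' (Act (column K \<phi> a) b b' s s' \<beta> k x)"
      using * a 1 by (simp add: kmod_hom_smult[OF Act_linear] Act_closed Act_left_left V.smult_assoc1
        target.Comp_closed)
  next
    fix b s x assume "b \<in> Ob B" "x \<in> carrier (Val (column K \<phi> a) b s)"
    note * = this[simplified]
    interpret V: module K "Val \<phi> b a" by (rule Val_module[OF *(1) a])
    show "Act (column K \<phi> a) b b s s (Idt B b) (Idt (unit_kcat K) s) x = x"
      using * a by (simp add: Act_Idt)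
  qed (use a 1 in \<open>simp_all add: Act_column Val_module kmod_hom_comp[OF Act_linear smult_hom]
      kmod_hom_comp[OF Act_linear_left smult_hom] scalar_hom Act_closed\<close>)
qed

end

section \<open>Faithfulness and the theorem\<close>

text \<open>By the Yoneda lemma \<open>X\<close> corresponds to the map \<open>\<alpha> \<mapsto> X \<alpha>\<close> from the representable
  presheaf \<open>A(-,a)\<close> to \<open>N(-,c)\<close>. On pure tensors \<open>f \<otimes> -\<close> sends this map to
  \<open>v \<otimes> \<alpha> \<mapsto> v \<otimes> X \<alpha> = \<alpha> v \<otimes> X\<close>, which vanishes by assumption. As \<open>f \<otimes> -\<close> is
  faithful, the map itself vanishes, and its value at the identity is \<open>X\<close>. Faithfulness is
  available for presheaves with values in the universe, so \<open>N(-,c)\<close> is first moved there along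
  injections.\<close>

lemma precomonadic_detects_zero:
  fixes f :: "('k, 'b, 'n, 'a, 'u, 'x) bimod" and N :: "('k, 'a, 'u, 'c, 'l, 'y) bimod"
    and e :: "'a \<Rightarrow> 'y \<Rightarrow> 'u"
  assumes pre: "precomonadic TYPE('u) K f g \<eta> \<epsilon>"
    and f: "kcat_bimodule K A B f" and N: "kcat_bimodule K C A N" and c: "c \<in> Ob C"
    and e: "\<And>a. a \<in> Ob A \<Longrightarrow> inj_on (e a) (carrier (Val N a c))"
    and a: "a \<in> Ob A" and X: "X \<in> carrier (Val N a c)"
    and zero: "\<And>b v. \<lbrakk>b \<in> Ob B; v \<in> carrier (Val f b a)\<rbrakk>
      \<Longrightarrow> pure_tens K f N b c (a, v, X) = \<zero>\<^bsub>tens_val K f N b c\<^esub>"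
  shows "X = \<zero>\<^bsub>Val N a c\<^esub>"
proof -
  interpret f: kcat_bimodule K A B f by (rule f)
  interpret N: kcat_bimodule K C A N by (rule N)
  interpret fN: composable K C A B f N by (intro composable.intro f N)
  let ?U = "unit_kcat K"
  have U: "kcategory K ?U" by (rule unit_kcat_kcategory) (rule f.source.is_cring)
  define N' where "N' = transport_bimod (\<lambda>a _. e a) (column K N c)"
  define M where "M = column K (id_bimod A) a"
  have N'_bim: "bimodule K ?U A N'" and e_cell: "two_cell K (column K N c) N' (\<lambda>a _. e a)"
    unfolding N'_def using transport_bimod[OF N.column_bimodule[OF c], of "\<lambda>a _. e a"] e by simp_all
  have M_bim: "bimodule K ?U A M" unfolding M_def 
    by (rule kcat_bimodule.column_bimodule[OF f.source.id_bimod_kcat_bimodule a])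
  interpret N': kcat_bimodule K ?U A N'
    by (intro kcat_bimodule.intro U f.source.kcategory_axioms N'_bim)
  interpret M: kcat_bimodule K ?U A M
    by (intro kcat_bimodule.intro U f.source.kcategory_axioms M_bim)
  interpret fN': composable K ?U A B f N' by (intro composable.intro f N'.kcat_bimodule_axioms)
  interpret fM: composable K ?U A B f M by (intro composable.intro f M.kcat_bimodule_axioms)
  have e_hom: "kmod_hom K (Val N a' c) (Val N' a' ()) (e a')" if "a' \<in> Ob A" for a'
    using two_cellD(1)[OF N.column_bimodule[OF c] e_cell that, of "()"] by simp
  have e_nat: "e a'' (k \<odot>\<^bsub>Val N a'' c\<^esub> Act N a' a'' c c \<alpha> (Idt C c) x) = Act N' a' a'' () () \<alpha> k (e a' x)"
    if "a' \<in> Ob A" "a'' \<in> Ob A" "\<alpha> \<in> carrier (Hom A a'' a')" "k \<in> carrier K" "x \<in> carrier (Val N a' c)"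
    for a' a'' \<alpha> k x
    using two_cellD(2)[OF N.column_bimodule[OF c] e_cell that(1,2), of "()" "()" \<alpha> k x] that by simp
  \<comment> \<open>Moving the hypothesis along \<open>e\<close> uses the linear map \<open>v \<otimes> x \<mapsto> v \<otimes> e x\<close>. It is
    not a horizontal composite, since \<open>N\<close> and \<open>N'\<close> have different source categories.\<close>
  have zero': "pure_tens K f N' b () (a, v, e a X) = \<zero>\<^bsub>tens_val K f N' b ()\<^esub>"
    if b: "b \<in> Ob B" and v: "v \<in> carrier (Val f b a)" for b v
  proof -
    let ?h = "\<lambda>a v x. pure_tens K f N' b () (a, v, e a x)"
    have bal: "balanced K f N b c (tens_val K f N' b ()) ?h"
    proof (rule fN.balancedI)
      fix a' a'' \<alpha> v x
      assume *: "a' \<in> Ob A" "a'' \<in> Ob A" "\<alpha> \<in> carrier (Hom A a' a'')" "v \<in> carrier (Val f b a')"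
        "x \<in> carrier (Val N a'' c)"
      interpret V: module K "Val N a' c" by (rule N.Val_module[OF *(1) c])
      have cl: "Act N a'' a' c c \<alpha> (Idt C c) x \<in> carrier (Val N a' c)"
        using * c by (simp add: N.Act_closed N.source.Idt_closed)
      have "?h a'' (Act f b b a' a'' (Idt B b) \<alpha> v) x
          = pure_tens K f N' b () (a', v, Act N' a'' a' () () \<alpha> (Idt ?U ()) (e a'' x))"
        using * b kmod_hom_closed[OF e_hom] by (intro fN'.pure_tens_slide) auto
      then show "?h a'' (Act f b b a' a'' (Idt B b) \<alpha> v) x = ?h a' v (Act N a'' a' c c \<alpha> (Idt C c) x)"
        using e_nat[of a'' a' \<alpha> "\<one>\<^bsub>K\<^esub>" x] * cl by simp
    next
      fix a' x assume "a' \<in> Ob A" "x \<in> carrier (Val N a' c)"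
      then show "kmod_hom K (Val f b a') (tens_val K f N' b ()) (\<lambda>v. ?h a' v x)"
        using b kmod_hom_closed[OF e_hom] by (intro fN'.pure_tens_left) auto
    next
      fix a' v assume "a' \<in> Ob A" "v \<in> carrier (Val f b a')"
      then show "kmod_hom K (Val N a' c) (tens_val K f N' b ()) (?h a' v)"
        using b by (intro kmod_hom_comp[OF e_hom fN'.pure_tens_right]) auto
    qed
    have P: "module K (tens_val K f N' b ())" by (rule fN'.tens_val_module) (use b in auto)
    show ?thesis
      using fN.tens_lift_pure[OF b c P bal a v X] zero[OF b v]
        kmod_hom_zero[OF fN.tens_lift_hom[OF b c P bal] fN.tens_val_module[OF b c] P] by simp
  qed
  \<comment> \<open>The Yoneda map of \<open>e X\<close>, to be compared with the zero map.\<close>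
  define h where "h = (\<lambda>a' (_::unit) \<alpha>. e a' (Act N a a' c c \<alpha> (Idt C c) X))"
  define z where "z = (\<lambda>a' (_::unit) (\<alpha>::'u). \<zero>\<^bsub>Val N' a' ()\<^esub>)"
  have h: "two_cell K M N' h"
  proof (rule two_cellI[OF M_bim N'_bim])
    show "kmod_hom K (Val M a' s) (Val N' a' s) (h a' s)" if "a' \<in> Ob A" "s \<in> Ob ?U" for a' s
      unfolding M_def h_def using that a c X
      by (simp add: kmod_hom_comp[OF N.Act_linear_left e_hom] N.source.Idt_closed)
  next
    fix a' a'' s s' \<alpha> k x
    assume "a' \<in> Ob A" "a'' \<in> Ob A" "\<alpha> \<in> carrier (Hom A a'' a')"
      "k \<in> carrier (Hom ?U s s')" "x \<in> carrier (Val M a' s)"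
    then have *: "a' \<in> Ob A" "a'' \<in> Ob A" "\<alpha> \<in> carrier (Hom A a'' a')" "k \<in> carrier K"
      "x \<in> carrier (Hom A a' a)" by (simp_all add: M_def)
    interpret V: module K "Hom A a'' a" by (rule f.source.Hom_module[OF *(2) a])
    have xa: "Comp A a'' a' a x \<alpha> \<in> carrier (Hom A a'' a)"
      using * a by (simp add: f.source.Comp_closed)
    have "h a'' s' (Act M a' a'' s s' \<alpha> k x)
        = e a'' (Act N a a'' c c (k \<odot>\<^bsub>Hom A a'' a\<^esub> Comp A a'' a' a x \<alpha>) (Idt C c) X)"
      unfolding h_def M_def using * a xa by (simp add: f.source.Comp_Idt_left)
    also have "\<dots> = e a'' (k \<odot>\<^bsub>Val N a'' c\<^esub> Act N a' a'' c c \<alpha> (Idt C c) (Act N a a' c c x (Idt C c) X))"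
      using * a c X xa
      by (simp add: kmod_hom_smult[OF N.Act_linear_left] N.source.Idt_closed N.Act_left_left)
    also have "\<dots> = Act N' a' a'' () () \<alpha> k (h a' s x)"
      unfolding h_def using * a c X by (intro e_nat) (simp_all add: N.Act_closed N.source.Idt_closed)
    finally show "h a'' s' (Act M a' a'' s s' \<alpha> k x) = Act N' a' a'' s s' \<alpha> k (h a' s x)"
      by simp
  qed
  have z: "two_cell K M N' z"
  proof (rule two_cellI[OF M_bim N'_bim])
    show "kmod_hom K (Val M a' s) (Val N' a' s) (z a' s)" if "a' \<in> Ob A" "s \<in> Ob ?U" for a' s
      unfolding z_def using kmod_hom_const_zero[OF N'.Val_module[OF that]] by simp
    show "z a'' s' (Act M a' a'' s s' \<alpha> k x) = Act N' a' a'' s s' \<alpha> k (z a' s x)"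
      if "a' \<in> Ob A" "a'' \<in> Ob A" "s \<in> Ob ?U" "s' \<in> Ob ?U" "\<alpha> \<in> carrier (Hom A a'' a')"
        "k \<in> carrier (Hom ?U s s')" for a' a'' s s' \<alpha> k x
      using kmod_hom_zero[OF N'.Act_linear[OF that] N'.Val_module N'.Val_module] that
      by (simp add: z_def)
  qed
  interpret fh: parallel_composable K ?U A B f M f N' id_cell h
    by (intro parallel_composable.intro parallel_composable_axioms.intro fM.composable_axioms
      fN'.composable_axioms h two_cell_id[OF f.bimodule_axioms])
  interpret fz: parallel_composable K ?U A B f M f N' id_cell z
    by (intro parallel_composable.intro parallel_composable_axioms.intro fM.composable_axioms
      fN'.composable_axioms z two_cell_id[OF f.bimodule_axioms])
  have "cell_eq (tens K f M) (comparison_map K f N' h) (comparison_map K f N' z)"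
    unfolding cell_eq_def comparison_map_def tens_simps f.Tgt M.Src
  proof (intro ballI)
    fix b s Y assume b: "b \<in> Ob B" and s: "s \<in> Ob ?U" and Y: "Y \<in> carrier (tens_val K f M b s)"
    show "hcomp K f N' id_cell h b s Y = hcomp K f N' id_cell z b s Y"
    proof (rule fM.tens_hom_eqI[OF b s fh.hcomp_hom[OF b s] fz.hcomp_hom[OF b s]
          fN'.tens_val_module[OF b s] Y])
      fix a' v \<alpha> assume *: "a' \<in> Ob A" "v \<in> carrier (Val f b a')" "\<alpha> \<in> carrier (Val M a' s)"
      have \<alpha>: "\<alpha> \<in> carrier (Hom A a' a)" using *(3) by (simp add: M_def)
      interpret V: module K "Val N a' c" by (rule N.Val_module[OF *(1) c])
      have cl: "Act N a a' c c \<alpha> (Idt C c) X \<in> carrier (Val N a' c)"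
        using * \<alpha> a c X by (simp add: N.Act_closed N.source.Idt_closed)
      have "hcomp K f N' id_cell h b s (pure_tens K f M b s (a', v, \<alpha>))
          = pure_tens K f N' b () (a', v, h a' () \<alpha>)"
        using fh.hcomp_pure[OF b s *] s by (simp add: id_cell_apply)
      also have "h a' () \<alpha> = Act N' a a' () () \<alpha> (Idt ?U ()) (e a X)"
        unfolding h_def using e_nat[of a a' \<alpha> "\<one>\<^bsub>K\<^esub>" X] * \<alpha> a X cl by simp
      also have "pure_tens K f N' b () (a', v, \<dots>)
          = pure_tens K f N' b () (a, Act f b b a' a (Idt B b) \<alpha> v, e a X)"
        using * \<alpha> a b X kmod_hom_closed[OF e_hom] by (intro fN'.pure_tens_slide[symmetric]) auto
      also have "\<dots> = \<zero>\<^bsub>tens_val K f N' b ()\<^esub>"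
        using * \<alpha> a b by (intro zero' f.Act_closed f.target.Idt_closed)
      also have "\<dots> = pure_tens K f N' b () (a', v, z a' () \<alpha>)"
        unfolding z_def
        using kmod_hom_zero[OF fN'.pure_tens_right N'.Val_module fN'.tens_val_module] b * by simp
      also have "\<dots> = hcomp K f N' id_cell z b s (pure_tens K f M b s (a', v, \<alpha>))"
        using fz.hcomp_pure[OF b s *] s by (simp add: id_cell_apply)
      finally show "hcomp K f N' id_cell h b s (pure_tens K f M b s (a', v, \<alpha>))
          = hcomp K f N' id_cell z b s (pure_tens K f M b s (a', v, \<alpha>))" .
    qed
  qed
  with pre M_bim N'_bim h z have "cell_eq M h z"
    unfolding precomonadic_def f.Src by blast
  then have "h a () (Idt A a) = z a () (Idt A a)"
    by (rule cell_eqD[OF M_bim]) (simp_all add: a M_def f.source.Idt_closed)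
  moreover have "h a () (Idt A a) = e a X"
    unfolding h_def using a c X by (simp add: N.Act_Idt)
  moreover have "z a () (Idt A a) = e a \<zero>\<^bsub>Val N a c\<^esub>"
    unfolding z_def using kmod_hom_zero[OF e_hom[OF a] N.Val_module[OF a c] N'.Val_module[OF a]] by simp
  moreover have "\<zero>\<^bsub>Val N a c\<^esub> \<in> carrier (Val N a c)"
    using abelian_monoid.zero_closed[OF abelian_group.axioms(1)[OF module.axioms(2)[OF N.Val_module[OF a c]]]] .
  ultimately show ?thesis using e[OF a] X by (simp add: inj_on_eq_iff)
qed

theorem proposition4p4:
  fixes K :: "('u::infinite) ring"
    and A :: "('u, 'u, 'u) kcat" and B :: "('u, 'u, 'u) kcat"
    and f :: "('u, 'u, 'u, 'u, 'u, 'u) bimod" and g :: "('u, 'u, 'u, 'u, 'u, 'u) bimod"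
    and \<eta> :: "('u, 'u, 'u, ('u \<times> 'u \<times> 'u \<Rightarrow> 'u) set) cell"
    and \<epsilon> :: "('u, 'u, ('u \<times> 'u \<times> 'u \<Rightarrow> 'u) set, 'u) cell"
    and I :: "('u, 'u, 'u, 'u, 'u, 'u) bimod" and J :: "('u, 'u, 'u, 'u, 'u, 'u) bimod"
    and i :: "('u, 'u, 'u, ('u \<times> 'u \<times> 'u \<Rightarrow> 'u) set) cell"
    and j :: "('u, 'u, 'u, ('u \<times> 'u \<times> 'u \<Rightarrow> 'u) set) cell"
  assumes "cring K" and "kcategory K A" and "kcategory K B"
    and "bim_adjunction K A B f g \<eta> \<epsilon>"
    and "precomonadic TYPE('u) K f g \<eta> \<epsilon>"
    and "(I, i) \<in> left_subobjects K f g \<epsilon>"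
    and "(J, j) \<in> left_subobjects K f g \<epsilon>"
  shows "iso_cell K (tens K I J) (subobj_prod K f g \<epsilon> (I, i) (J, j)) (subobj_mult K f g \<epsilon> i j)"
proof -
  interpret left_subobject_pair K A B f g \<eta> \<epsilon> I i J j
    by (intro left_subobject_pair.intro left_subobject_pair_axioms.intro kcat_adjunction.intro assms)
  have "X = \<zero>\<^bsub>tens_val K I J a a'\<^esub>"
    if a: "a \<in> Ob A" "a' \<in> Ob A" and X: "X \<in> carrier (tens_val K I J a a')"
      and zero: "prod_map a a' X = \<zero>\<^bsub>tens_val K g f a a'\<^esub>" for a a' X
  proof -
    have "\<forall>a\<in>Ob A. \<exists>e :: _ \<Rightarrow> 'u. inj_on e (carrier (tens_val K I J a a'))"
      using tens_val_injection[OF IJ.composable_axioms _ a(2)] by blast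
    then obtain e :: "'u \<Rightarrow> ('u \<times> 'u \<times> 'u \<Rightarrow> 'u) set \<Rightarrow> 'u"
      where e: "inj_on (e a) (carrier (tens_val K I J a a'))" if "a \<in> Ob A" for a by metis
    show ?thesis
      using precomonadic_detects_zero[OF assms(5) f.kcat_bimodule_axioms IJ.tens_kcat_bimodule a(2) _ a(1),
          unfolded tens_simps, OF e X tens_zero_of_prod_map_zero[OF _ a _ X zero]] .
  qed
  then show ?thesis
    unfolding subobj_prod_def split
    by (intro iso_cell_onto_image[OF IJ.tens_bimodule S.bimodule_axioms prod_map_two_cell]) simp_all
qed

end
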